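(* Let $G$ be a finite simple gap free graph with edge ideal $I$ and $4$-path ideal $I_4$, and suppose $I_4\neq 0$. If, for some integer $p\geq 2$, the minimal free resolution of $I$ is linear up to step $p$, then the minimal free resolution of $I_4$ is also linear up to step $p$. In particular, if $I$ has linear minimal free resolution, then so does $I_4$.
   Context: Let $K$ be a field and $S$ the polynomial ring over $K$ whose variables are the vertices of $G$. The edge ideal $I\subseteq S$ is generated by the monomials $xy$ with $xy$ an edge of $G$. The $4$-path ideal $I_4\subseteq S$ is generated by the monomials $x_1x_2x_3x_4$ with $x_1,\dots,x_4$ distinct vertices and $x_1x_2$, $x_2x_3$, $x_3x_4$ edges of $G$. $G$ is gap free if there are no two vertex-disjoint edges $uv$, $xy$ of $G$ such that $G$ has no edge with one endpoint in $\{u,v\}$ and the other in $\{x,y\}$ (equivalently, the complement $G^c$ has no induced $4$-cycle). For a monomial ideal $J$ generated in degree $d$, the minimal free resolution of $J$ is linear up to step $k$ ("$J$ is $k$-steps linear") if $\operatorname{Tor}_i^S(J,K)_j=0$ for all $1\le i\le k$ and all $j\neq i+d$; $J$ has linear minimal free resolution if this holds for all $k\ge 1$. *)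

theory Defs
  imports Complex_Main "HOL-Library.Poly_Mapping"
begin

text \<open>
  The polynomial ring \<open>S = K[x\<^sub>v]\<close> whose variables are the elements of the type \<open>'v\<close>.
\<close>

type_synonym ('v, 'k) mpoly = "('v \<Rightarrow>\<^sub>0 nat) \<Rightarrow>\<^sub>0 'k"

definition var :: "'v \<Rightarrow> ('v, 'k::field) mpoly"
  where "var x = Poly_Mapping.single (Poly_Mapping.single x 1) 1"

definition ideal_of :: "('v, 'k::field) mpoly set \<Rightarrow> ('v, 'k) mpoly set"
  where "ideal_of B = module.span (*) B"

definition total_deg :: "('v \<Rightarrow>\<^sub>0 nat) \<Rightarrow> nat"
  where "total_deg m = (\<Sum>x\<in>Poly_Mapping.keys m. Poly_Mapping.lookup m x)"

text \<open>Zero is homogeneous of every degree, and it is the only element homogeneous of negative degree.\<close>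

definition homogeneous :: "int \<Rightarrow> ('v, 'k::field) mpoly \<Rightarrow> bool"
  where "homogeneous n f \<longleftrightarrow> (\<forall>m\<in>Poly_Mapping.keys f. int (total_deg m) = n)"


text \<open>
  A simple graph with vertex set \<open>UNIV :: 'v set\<close> is given by its set of two-element edges.
\<close>

definition simple_graph :: "'v set set \<Rightarrow> bool"
  where "simple_graph E \<longleftrightarrow> (\<forall>e\<in>E. card e = 2)"

definition gap_free :: "'v set set \<Rightarrow> bool"
  where "gap_free E \<longleftrightarrow>
    \<not> (\<exists>u v x y. {u, v} \<in> E \<and> {x, y} \<in> E \<and> {u, v} \<inter> {x, y} = {} \<and>
         \<not> (\<exists>a\<in>{u, v}. \<exists>b\<in>{x, y}. {a, b} \<in> E))"

definition edge_ideal :: "'v set set \<Rightarrow> ('v, 'k::field) mpoly set"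
  where "edge_ideal E = ideal_of {var x * var y | x y. {x, y} \<in> E}"

definition path4_ideal :: "'v set set \<Rightarrow> ('v, 'k::field) mpoly set"
  where "path4_ideal E = ideal_of {var a * var b * var c * var d | a b c d.
    distinct [a, b, c, d] \<and> {a, b} \<in> E \<and> {b, c} \<in> E \<and> {c, d} \<in> E}"


text \<open>
  A record of this type describes a sequence of finitely generated graded free modules
  \<open>F\<^sub>i = \<Oplus>\<^sub>k S(-shift i k)\<close> with \<open>k < rank i\<close>, together with maps
  \<open>F\<^sub>i\<^sub>+\<^sub>1 \<rightarrow> F\<^sub>i\<close> sending the basis vector \<open>e\<^sub>k\<close> to \<open>\<Sum>\<^sub>l bd i k l e\<^sub>l\<close>, and a map
  \<open>F\<^sub>0 \<rightarrow> S\<close> sending \<open>e\<^sub>k\<close> to \<open>aug k\<close>. Entries with indices outside the ranks are irrelevant.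
\<close>

record (overloaded) ('v, 'k) graded_free_data =
  rank :: "nat \<Rightarrow> nat"
  shift :: "nat \<Rightarrow> nat \<Rightarrow> int"
  bd :: "nat \<Rightarrow> nat \<Rightarrow> nat \<Rightarrow> ('v, 'k) mpoly"
  aug :: "nat \<Rightarrow> ('v, 'k) mpoly"

definition free_mod :: "('v, 'k::field) graded_free_data \<Rightarrow> nat \<Rightarrow> (nat \<Rightarrow> ('v, 'k) mpoly) set"
  where "free_mod F i = {f. \<forall>k\<ge>rank F i. f k = 0}"

definition bd_map ::
    "('v, 'k::field) graded_free_data \<Rightarrow> nat \<Rightarrow> (nat \<Rightarrow> ('v, 'k) mpoly) \<Rightarrow> nat \<Rightarrow> ('v, 'k) mpoly"
  where "bd_map F i f = (\<lambda>l. if l < rank F i then \<Sum>k<rank F (Suc i). f k * bd F i k l else 0)"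

definition aug_map ::
    "('v, 'k::field) graded_free_data \<Rightarrow> (nat \<Rightarrow> ('v, 'k) mpoly) \<Rightarrow> ('v, 'k) mpoly"
  where "aug_map F f = (\<Sum>k<rank F 0. f k * aug F k)"

text \<open>
  \<open>\<dots> \<rightarrow> F\<^sub>2 \<rightarrow> F\<^sub>1 \<rightarrow> F\<^sub>0 \<rightarrow> J \<rightarrow> 0\<close> is exact and all maps are graded of degree 0.
\<close>

definition graded_free_resolution ::
    "('v, 'k::field) graded_free_data \<Rightarrow> ('v, 'k) mpoly set \<Rightarrow> bool"
  where "graded_free_resolution F J \<longleftrightarrow>
    (\<forall>k<rank F 0. homogeneous (shift F 0 k) (aug F k)) \<and>
    (\<forall>i. \<forall>k<rank F (Suc i). \<forall>l<rank F i.
       homogeneous (shift F (Suc i) k - shift F i l) (bd F i k l)) \<and>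
    aug_map F ` free_mod F 0 = J \<and>
    {f \<in> free_mod F 0. aug_map F f = 0} = bd_map F 0 ` free_mod F 1 \<and>
    (\<forall>i. {f \<in> free_mod F (Suc i). bd_map F i f = (\<lambda>_. 0)} =
       bd_map F (Suc i) ` free_mod F (Suc (Suc i)))"

text \<open>
  The complex \<open>F \<otimes>\<^sub>S K\<close>, where \<open>K = S/\<mm>\<close> for the ideal \<open>\<mm>\<close> generated by the variables:
  \<open>F\<^sub>i \<otimes> K\<close> has \<open>K\<close>-basis \<open>e\<^sub>k\<close> for \<open>k < rank i\<close>, with \<open>e\<^sub>k\<close> in degree \<open>shift i k\<close>, and
  the differential is given by the residues modulo \<open>\<mm>\<close>, i.e. the constant coefficients, of
  the entries of \<open>bd\<close>.
\<close>

definition tensor_K :: "('v, 'k::field) graded_free_data \<Rightarrow> nat \<Rightarrow> int \<Rightarrow> (nat \<Rightarrow> 'k) set"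
  where "tensor_K F i j = {c. \<forall>k. c k \<noteq> 0 \<longrightarrow> k < rank F i \<and> shift F i k = j}"

definition bd_K :: "('v, 'k::field) graded_free_data \<Rightarrow> nat \<Rightarrow> (nat \<Rightarrow> 'k) \<Rightarrow> nat \<Rightarrow> 'k"
  where "bd_K F i c =
    (\<lambda>l. if l < rank F i
         then \<Sum>k<rank F (Suc i). c k * Poly_Mapping.lookup (bd F i k l) 0 else 0)"

fun cycles_K :: "('v, 'k::field) graded_free_data \<Rightarrow> nat \<Rightarrow> int \<Rightarrow> (nat \<Rightarrow> 'k) set"
  where
    "cycles_K F 0 j = tensor_K F 0 j"
  | "cycles_K F (Suc i) j = {c \<in> tensor_K F (Suc i) j. bd_K F i c = (\<lambda>_. 0)}"

definition boundaries_K :: "('v, 'k::field) graded_free_data \<Rightarrow> nat \<Rightarrow> int \<Rightarrow> (nat \<Rightarrow> 'k) set"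
  where "boundaries_K F i j = bd_K F i ` tensor_K F (Suc i) j"

text \<open>
  \<open>Tor\<^sub>i(J, K)\<^sub>j = 0\<close>, computed as the degree-\<open>j\<close> part of the \<open>i\<close>-th homology of
  \<open>F \<otimes>\<^sub>S K\<close>. The choice of the graded free resolution \<open>F\<close> of \<open>J\<close> does not matter.
\<close>

definition tor_zero :: "('v, 'k::field) mpoly set \<Rightarrow> nat \<Rightarrow> int \<Rightarrow> bool"
  where "tor_zero J i j \<longleftrightarrow>
    (\<exists>F. graded_free_resolution F J \<and> cycles_K F i j = boundaries_K F i j)"

text \<open>Here \<open>d\<close> is the degree in which \<open>J\<close> is generated.\<close>

definition linear_up_to :: "nat \<Rightarrow> nat \<Rightarrow> ('v, 'k::field) mpoly set \<Rightarrow> bool"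
  where "linear_up_to d k J \<longleftrightarrow>
    (\<forall>i j. 1 \<le> i \<and> i \<le> k \<and> j \<noteq> int (i + d) \<longrightarrow> tor_zero J i j)"

definition linear_resolution :: "nat \<Rightarrow> ('v, 'k::field) mpoly set \<Rightarrow> bool"
  where "linear_resolution d J \<longleftrightarrow> (\<forall>k\<ge>1. linear_up_to d k J)"

end

theory Submission
  imports Defs "HOL-Library.Countable_Set"
begin

text \<open>
  For a squarefree monomial ideal, given by the up-closed family \<open>J\<close> of supports of its squarefree
  monomials, the elements \<open>e\<^sub>A \<otimes> x\<^sup>B\<close> with \<open>A\<close>, \<open>B\<close> disjoint and \<open>B \<in> J\<close> form the basis of a finite
  free resolution, the squarefree part of the Koszul resolution of \<open>S\<close> over \<open>S \<otimes> S\<close>. Tensored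
  with \<open>K\<close> it splits into strands indexed by the vertex sets \<open>W = A \<union> B\<close>. Since graded free
  resolutions are unique up to homotopy, \<open>Tor\<^sub>i\<close> vanishes in degree \<open>j\<close> iff all strands with
  \<open>card W = j\<close> are exact in position \<open>i\<close>.

  On strands, linearity of \<open>I\<close> up to step \<open>p\<close> forbids induced cycles of length \<open>4, \<dots>, p + 3\<close> in the
  complement of \<open>G\<close>, and conversely their absence forces linearity up to step \<open>p\<close>. If \<open>G\<close> is
  gap free, \<open>I\<^sub>4\<close> is generated by the products of two disjoint edges. Adding the edges \<open>e = ab\<close> one after the
  other to \<open>I\<^sub>4\<close> leads to \<open>I\<close>, and each colon ideal by \<open>e\<close> met on the way is generated by variables
  and by the edges of the graph obtained from \<open>G - a - b\<close> by joining all neighbours of \<open>a\<close> to all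
  neighbours of \<open>b\<close>. The complement of that graph has no new induced cycles of length at least
  \<open>4\<close>, so the colon ideals are linear up to step \<open>p\<close>, and this bounds the degrees in the
  resolution of \<open>I\<^sub>4\<close>.
\<close>

section \<open>Strands of squarefree monomial ideals\<close>

text \<open>Two difficulties shape the proof. \<open>tor_zero\<close> speaks of some unspecified
  resolution, possibly a different one for each degree, so the hypothesis on the edge ideal must
  first be carried over to a resolution that can be computed with. The squarefree Koszul complex is
  far from minimal, but it exists uniformly for all up-closed families. The second point is the
  bookkeeping of sizes. For an ideal generated in degree \<open>d\<close>, a strand with
  \<open>card W < i + d\<close> has no chains in position \<open>i\<close>, so linearity means
  exactness for \<open>card W > i + d\<close>: at least \<open>i + 3\<close> vertices for
  \<open>I\<close>, at least \<open>i + 5\<close> for the 4-path ideal. The difference 2 is the size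
  of an edge: the colon by an edge removes two vertices from \<open>W\<close> and lands exactly at
  the bound for edge ideals. A variable in the colon ideal costs one vertex and one position, which
  preserves that bound. A cycle on \<open>l\<close> vertices has its homology class in position
  \<open>l - 3\<close>, whence the lengths up to \<open>p + 3\<close>. Gap freeness enters twice: it
  turns pairs of disjoint edges into 4-paths, and it keeps the colon graphs free of new
  cycles.\<close>

definition pos_sign :: "'v::finite set \<Rightarrow> 'v \<Rightarrow> 'k::comm_ring_1"
  where "pos_sign F x = (-1) ^ card {y \<in> F. to_nat y < to_nat x}"

lemma pos_sign_square [simp]: "pos_sign F x * pos_sign F x = 1"
  by (simp add: pos_sign_def flip: power_mult_distrib)

lemma pos_sign_square_left [simp]: "pos_sign F x * (pos_sign F x * c) = c"
  by (simp flip: mult.assoc)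

lemma pos_sign_insert:
  assumes "y \<notin> F"
  shows "pos_sign (insert y F) x = (if to_nat y < to_nat x then - pos_sign F x else pos_sign F x)"
proof -
  have "{z \<in> insert y F. to_nat z < to_nat x} =
      (if to_nat y < to_nat x then insert y {z \<in> F. to_nat z < to_nat x} else {z \<in> F. to_nat z <
          to_nat x})"
    by auto
  then show ?thesis
    using assms by (simp add: pos_sign_def)
qed

text \<open>Anticommutativity of exterior multiplication: of two distinct vertices exactly one comes
  first in the order given by \<open>to_nat\<close>, so exactly one of the two later signs is
  flipped.\<close>

lemma pos_sign_swap:
  assumes "x \<noteq> y" "x \<notin> F" "y \<notin> F"
  shows "pos_sign F x * pos_sign (insert x F) y = - (pos_sign F y * pos_sign (insert y F) x)"
proof -
  have "to_nat x < to_nat y \<or> to_nat y < to_nat x"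
    using assms(1) by (meson inj_eq inj_to_nat linorder_neqE_nat)
  then show ?thesis
    using assms by (auto simp: pos_sign_insert mult.commute)
qed

text \<open>Induction rather than the swap \<open>s = - s\<close>, which says nothing in
  characteristic 2. The diagonal is left out because antisymmetry would not make it vanish
  there.\<close>

lemma sum_antisym_eq_0:
  fixes g :: "'a \<Rightarrow> 'a \<Rightarrow> 'b::ab_group_add"
  assumes "finite A" "\<And>x y. x \<in> A \<Longrightarrow> y \<in> A \<Longrightarrow> x \<noteq> y \<Longrightarrow> g x y = - g y x"
  shows "(\<Sum>x\<in>A. \<Sum>y\<in>A - {x}. g x y) = 0"
  using assms
proof (induction A rule: finite_induct)
  case (insert a A)
  have IH: "(\<Sum>x\<in>A. \<Sum>y\<in>A - {x}. g x y) = 0"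
    by (rule insert.IH) (use insert.prems in blast)
  have "(\<Sum>x\<in>A. \<Sum>y\<in>insert a A - {x}. g x y) = (\<Sum>x\<in>A. g x a + (\<Sum>y\<in>A - {x}. g x y))"
  proof (rule sum.cong)
    fix x assume "x \<in> A"
    then have "insert a A - {x} = insert a (A - {x})" using insert.hyps by auto
    then show "(\<Sum>y\<in>insert a A - {x}. g x y) = g x a + (\<Sum>y\<in>A - {x}. g x y)"
      using insert.hyps by simp
  qed simp
  also have "\<dots> = (\<Sum>x\<in>A. g x a)"
    by (simp add: sum.distrib IH)
  also have "\<dots> = (\<Sum>x\<in>A. - g a x)"
    using insert.hyps by (intro sum.cong insert.prems) auto
  finally show ?case
    using insert.hyps by (simp add: sum_negf)
qed simp

text \<open>The Koszul differential written on coefficients: every \<open>insert x F\<close> with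
  \<open>x\<close> outside \<open>F\<close> contributes to the coefficient at \<open>F\<close>. The
  monomial factor is determined by the strand and need not be recorded.\<close>

definition bdry :: "('v::finite set \<Rightarrow> 'k::comm_ring_1) \<Rightarrow> 'v set \<Rightarrow> 'k"
  where "bdry z F = (\<Sum>x\<in>- F. pos_sign F x * z (insert x F))"

lemma bdry_add: "bdry (\<lambda>F. a F + b F) F = bdry a F + bdry b F"
  by (simp add: bdry_def algebra_simps sum.distrib)

lemma bdry_diff: "bdry (\<lambda>F. a F - b F) F = bdry a F - bdry b F"
  by (simp add: bdry_def algebra_simps sum_subtractf)

lemma bdry_zero [simp]: "bdry (\<lambda>_. 0) F = 0"
  by (simp add: bdry_def)

lemma bdry_nonzeroE:
  assumes "bdry z F \<noteq> 0"
  obtains x where "x \<notin> F" "z (insert x F) \<noteq> 0"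
proof -
  obtain x where "x \<in> - F" "pos_sign F x * z (insert x F) \<noteq> 0"
    using assms unfolding bdry_def by (rule sum.not_neutral_contains_not_neutral)
  then show ?thesis
    by (intro that[of x]) auto
qed

lemma bdry_bdry [simp]:
  fixes z :: "'v::finite set \<Rightarrow> 'k::comm_ring_1"
  shows "bdry (bdry z) F = 0"
proof -
  have "bdry (bdry z) F = (\<Sum>x\<in>-F. \<Sum>y\<in>-F - {x}. pos_sign F x * (pos_sign (insert x F) y * z (insert
      y (insert x F))))"
    unfolding bdry_def sum_distrib_left by (intro sum.cong) auto
  also have "\<dots> = 0"
  proof (rule sum_antisym_eq_0)
    fix x y assume "x \<in> - F" "y \<in> - F" "x \<noteq> y"
    then have "pos_sign F x * pos_sign (insert x F) y = (- (pos_sign F y * pos_sign (insert y F)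
        x) :: 'k)"
      by (intro pos_sign_swap) auto
    then show "pos_sign F x * (pos_sign (insert x F) y * z (insert y (insert x F))) =
        - (pos_sign F y * (pos_sign (insert y F) x * z (insert x (insert y F))))"
      by (simp add: insert_commute flip: mult.assoc)
  qed simp
  finally show ?thesis .
qed

section \<open>Cones and contracting homotopies\<close>

definition cone :: "'v::finite \<Rightarrow> ('v set \<Rightarrow> 'k::comm_ring_1) \<Rightarrow> 'v set \<Rightarrow> 'k"
  where "cone x c F = (if x \<in> F then pos_sign (F - {x}) x * c (F - {x}) else 0)"

text \<open>Leibniz rule for exterior multiplication by \<open>x\<close>, applied to a chain free of
  \<open>x\<close>. For a cycle \<open>c\<close> it makes the cone a filling of
  \<open>c\<close>.\<close>

lemma bdry_cone:
  fixes c :: "'v::finite set \<Rightarrow> 'k::comm_ring_1"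
  assumes "\<And>F. x \<in> F \<Longrightarrow> c F = 0"
  shows "bdry (cone x c) F = c F - cone x (bdry c) F"
proof (cases "x \<in> F")
  case False
  have "bdry (cone x c) F = (\<Sum>y\<in>-F. if y = x then c F else 0)"
    unfolding bdry_def cone_def using False by (intro sum.cong) auto
  also have "\<dots> = c F"
    using False by simp
  finally show ?thesis
    using False by (simp add: cone_def)
next
  case True
  define F0 where "F0 = F - {x}"
  have F: "F = insert x F0" "x \<notin> F0" using True by (auto simp: F0_def)
  have sw: "pos_sign F y * pos_sign (insert y F0) x = - (pos_sign F0 x * pos_sign F0 y :: 'k)" if
      "y \<notin> F" for y
  proof -
    have "pos_sign F0 x * pos_sign F y = (- (pos_sign F0 y * pos_sign (insert y F0) x) :: 'k)"
      unfolding F(1) using that F by (intro pos_sign_swap) auto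
    then have "pos_sign F0 x * (pos_sign F0 x * pos_sign F y) * pos_sign (insert y F0) x =
        (- (pos_sign F0 x * pos_sign F0 y * (pos_sign (insert y F0) x * pos_sign (insert y F0) x))
            :: 'k)"
      by (simp add: mult_ac)
    then show ?thesis by (simp add: mult_ac)
  qed
  have "bdry (cone x c) F = (\<Sum>y\<in>-F. - (pos_sign F0 x * (pos_sign F0 y * c (insert y F0))))"
    unfolding bdry_def
  proof (intro sum.cong)
    fix y assume "y \<in> - F"
    then have y: "insert y F - {x} = insert y F0" "y \<notin> F" using F by auto
    have "pos_sign F y * cone x c (insert y F) = (pos_sign F y * pos_sign (insert y F0) x) * c
        (insert y F0)"
      using True y by (simp add: cone_def mult.assoc)
    then show "pos_sign F y * cone x c (insert y F) = - (pos_sign F0 x * (pos_sign F0 y * c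
        (insert y F0)))"
      using sw[OF y(2)] by (simp add: mult.assoc)
  qed simp
  also have "\<dots> = - (pos_sign F0 x * (\<Sum>y\<in>-F. pos_sign F0 y * c (insert y F0)))"
    by (simp add: sum_negf sum_distrib_left)
  also have "(\<Sum>y\<in>-F. pos_sign F0 y * c (insert y F0)) = bdry c F0"
  proof -
    have "- F0 = insert x (- F)" using F by auto
    then show ?thesis using assms True by (simp add: bdry_def)
  qed
  finally show ?thesis using True assms[OF True] by (simp add: cone_def[of x "bdry c"] F0_def)
qed

text \<open>\<open>F\<close> stands for \<open>e\<^sub>F \<otimes> x\<^sup>W\<^sup>-\<^sup>F\<close>.\<close>

definition chain :: "'v::finite set set \<Rightarrow> 'v set \<Rightarrow> nat \<Rightarrow> ('v set \<Rightarrow> 'k::comm_ring_1) \<Rightarrow> bool"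
  where "chain J W i z \<longleftrightarrow> (\<forall>F. z F \<noteq> 0 \<longrightarrow> F \<subseteq> W \<and> card F = i \<and> W - F \<in> J)"

text \<open>The \<open>itself\<close> argument fixes the coefficient ring, which no other argument
  mentions.\<close>

definition exact_at :: "'k::comm_ring_1 itself \<Rightarrow> 'v::finite set set \<Rightarrow> 'v set \<Rightarrow> nat \<Rightarrow> bool"
  where "exact_at _ J W i \<longleftrightarrow>
    (\<forall>z :: 'v set \<Rightarrow> 'k. chain J W i z \<and> (\<forall>F. bdry z F = 0) \<longrightarrow> (\<exists>y. chain J W (Suc i) y \<and> bdry y =
        z))"

section \<open>Exactness of strands: colon ideals and added variables\<close>

definition up_closed :: "'v set set \<Rightarrow> bool"
  where "up_closed J \<longleftrightarrow> (\<forall>A B. A \<in> J \<and> A \<subseteq> B \<longrightarrow> B \<in> J)"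

lemma exact_at_cong:
  fixes K :: "'k::comm_ring_1 itself" and W :: "'v::finite set"
  assumes "\<And>A. A \<subseteq> W \<Longrightarrow> A \<in> J \<longleftrightarrow> A \<in> J'"
  shows "exact_at K J W i \<longleftrightarrow> exact_at K J' W i"
proof -
  have "W - F \<in> J \<longleftrightarrow> W - F \<in> J'" for F
    using assms by simp
  then have "chain J W i z \<longleftrightarrow> chain J' W i z" for i and z :: "'v set \<Rightarrow> 'k"
    unfolding chain_def by simp
  then show ?thesis
    unfolding exact_at_def by simp
qed

lemma exact_at_trivial:
  fixes K :: "'k::comm_ring_1 itself" and W :: "'v::finite set"
  assumes "\<And>F. F \<subseteq> W \<Longrightarrow> card F = i \<Longrightarrow> W - F \<notin> J"
  shows "exact_at K J W i"
  unfolding exact_at_def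
proof (intro allI impI)
  fix z :: "'v set \<Rightarrow> 'k" assume "chain J W i z \<and> (\<forall>F. bdry z F = 0)"
  then have "z = (\<lambda>_. 0)" using assms unfolding chain_def by blast
  then show "\<exists>y. chain J W (Suc i) y \<and> bdry y = z"
    by (intro exI[of _ "\<lambda>_. 0"]) (auto simp: chain_def)
qed

text \<open>Mayer-Vietoris for \<open>J\<close> and the principal ideal of \<open>e\<close>. A set
  \<open>F\<close> with \<open>e \<subseteq> W - F\<close> lies in \<open>W - e\<close>, so the
  strand of the intersection of the two ideals on \<open>W\<close> is the strand of the colon ideal
  on \<open>W - e\<close>.\<close>

lemma exact_at_colon:
  fixes K :: "'k::comm_ring_1 itself" and W :: "'v::finite set"
  assumes up: "up_closed J" and eW: "e \<subseteq> W"
    and ex_add: "exact_at K {A. A \<in> J \<or> e \<subseteq> A} W i"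
    and ex_colon: "exact_at K {A. A \<union> e \<in> J} (W - e) i"
  shows "exact_at K J W i"
  unfolding exact_at_def
proof (intro allI impI)
  fix z :: "'v set \<Rightarrow> 'k" assume z: "chain J W i z \<and> (\<forall>F. bdry z F = 0)"
  then have "chain {A. A \<in> J \<or> e \<subseteq> A} W i z" by (auto simp: chain_def)
  then obtain y where y: "chain {A. A \<in> J \<or> e \<subseteq> A} W (Suc i) y" and zy: "bdry y = z"
    using ex_add z unfolding exact_at_def by blast
  \<comment> \<open>The part of the filling outside \<open>J\<close>; there \<open>W - F\<close>
    must contain \<open>e\<close>.\<close>
  define y2 where "y2 F = (if W - F \<in> J then 0 else y F)" for F
  define y1 where "y1 F = y F - y2 F" for F
  have y2: "F \<subseteq> W - e \<and> card F = Suc i" if "y2 F \<noteq> 0" for F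
    using y that unfolding chain_def y2_def by (auto split: if_splits)
  have y1: "chain J W (Suc i) y1"
    using y unfolding chain_def y1_def y2_def by auto
  have t: "bdry y2 F = z F - bdry y1 F" for F
    unfolding zy[symmetric] y1_def[abs_def] bdry_diff by simp
  have t_chain: "chain {A. A \<union> e \<in> J} (W - e) i (bdry y2)"
    unfolding chain_def
  proof (intro allI impI)
    fix F assume nz: "bdry y2 F \<noteq> 0"
    then obtain x where x: "x \<notin> F" "y2 (insert x F) \<noteq> 0" by (rule bdry_nonzeroE)
    then have F: "F \<subseteq> W - e" "card F = i" using y2[OF x(2)] by auto
    \<comment> \<open>That \<open>F\<close> avoids \<open>e\<close> was read off \<open>y2\<close>;
      membership in \<open>J\<close> is read off \<open>z - bdry y1\<close>, whose two terms both
      live in \<open>J\<close>.\<close>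
    have "W - F \<in> J"
    proof (cases "z F = 0")
      case True
      then obtain x where "y1 (insert x F) \<noteq> 0" using t nz by (metis bdry_nonzeroE diff_zero)
      then have "W - insert x F \<in> J" using y1 unfolding chain_def by blast
      then show ?thesis using up unfolding up_closed_def by (meson Diff_mono order_refl
          subset_insertI)
    qed (use z in \<open>auto simp: chain_def\<close>)
    moreover have "W - e - F \<union> e = W - F" using eW F by auto
    ultimately show "F \<subseteq> W - e \<and> card F = i \<and> W - e - F \<in> {A. A \<union> e \<in> J}" using F by simp
  qed
  then obtain u where u: "chain {A. A \<union> e \<in> J} (W - e) (Suc i) u" "bdry u = bdry y2"
    using ex_colon unfolding exact_at_def by (metis bdry_bdry)
  have "chain J W (Suc i) (\<lambda>F. y1 F + u F)"
    unfolding chain_def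
  proof (intro allI impI)
    fix F assume "y1 F + u F \<noteq> 0"
    then consider "y1 F \<noteq> 0" | "u F \<noteq> 0" by force
    then show "F \<subseteq> W \<and> card F = Suc i \<and> W - F \<in> J"
    proof cases
      case 2
      then have F: "F \<subseteq> W - e" "card F = Suc i" "W - e - F \<union> e \<in> J"
        using u(1) unfolding chain_def by auto
      moreover have "W - e - F \<union> e = W - F" using eW F by auto
      ultimately show ?thesis by auto
    qed (use y1 in \<open>auto simp: chain_def\<close>)
  qed
  moreover have "bdry (\<lambda>F. y1 F + u F) = z"
    using t u(2) by (auto simp: bdry_add)
  ultimately show "\<exists>y. chain J W (Suc i) y \<and> bdry y = z" by blast
qed

text \<open>Write \<open>z\<close> as a part free of \<open>x\<close> plus \<open>x\<close> times a
  part free of \<open>x\<close>. Splitting \<open>bdry z = 0\<close> in the same way gives the two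
  equations for \<open>a\<close> and \<open>b\<close>.\<close>

lemma cone_decomposition:
  fixes z :: "'v::finite set \<Rightarrow> 'k::comm_ring_1" and x :: 'v
  defines "a \<equiv> (\<lambda>F. if x \<in> F then 0 else z F)"
    and "b \<equiv> (\<lambda>F. if x \<in> F then 0 else pos_sign F x * z (insert x F))"
  assumes "\<And>F. bdry z F = 0"
  shows "z F = a F + cone x b F" and "bdry b F = 0" and "bdry a F = - b F"
proof -
  show dec: "z F = a F + cone x b F" for F
    by (auto simp: a_def b_def cone_def insert_absorb)
  have bx: "b F = 0" if "x \<in> F" for F using that by (simp add: b_def)
  have "bdry z F = bdry a F + bdry (cone x b) F" for F
    by (simp flip: bdry_add dec)
  then have eq: "bdry a F + b F - cone x (bdry b) F = 0" for F
    using assms(3)[of F] bdry_cone[of x b F] bx by (simp add: algebra_simps)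
  have av: "bdry a F = 0" "bdry b F = 0" "b F = 0" if "x \<in> F" for F
    unfolding bdry_def a_def b_def using that by (auto intro!: sum.neutral)
  have "bdry b F = 0" if "x \<notin> F" for F
    using eq[of "insert x F"] av[of "insert x F"] that
    by (simp add: cone_def) (metis mult_zero_right pos_sign_square_left)
  then show b: "bdry b F = 0" for F using av by blast
  show "bdry a F = - b F"
    using eq[of F] b by (simp add: cone_def eq_neg_iff_add_eq_0 split: if_splits)
qed

text \<open>For the unit ideal the strand is the augmented chain complex of a full simplex, which
  the cone over any vertex contracts.\<close>

lemma exact_at_UNIV:
  fixes K :: "'k::comm_ring_1 itself" and W :: "'v::finite set"
  assumes "x \<in> W"
  shows "exact_at K UNIV W i"
  unfolding exact_at_def
proof (intro allI impI)
  fix z :: "'v set \<Rightarrow> 'k" assume z: "chain UNIV W i z \<and> (\<forall>F. bdry z F = 0)"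
  define a where "a F = (if x \<in> F then 0 else z F)" for F
  define b where "b F = (if x \<in> F then 0 else pos_sign F x * z (insert x F))" for F
  have dec: "z F = a F + cone x b F" "bdry a F = - b F" for F
    using cone_decomposition[where z=z and x=x and F=F] z unfolding a_def b_def by auto
  have "bdry (cone x a) F = z F" for F
    using bdry_cone[of x a F] dec(1)[of F] dec(2) by (auto simp: a_def[of F] a_def cone_def[of x
        "bdry a"] cone_def[of x b] split: if_splits)
  moreover have "chain UNIV W (Suc i) (cone x a)"
    unfolding chain_def
  proof (intro allI impI)
    fix F assume "cone x a F \<noteq> 0"
    then have "x \<in> F" "z (F - {x}) \<noteq> 0" by (auto simp: cone_def a_def split: if_splits)
    then show "F \<subseteq> W \<and> card F = Suc i \<and> W - F \<in> UNIV"
      using z assms card_Suc_Diff1[of F x] unfolding chain_def by auto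
  qed
  ultimately show "\<exists>y. chain UNIV W (Suc i) y \<and> bdry y = z" by blast
qed

text \<open>In \<open>z = a + x b\<close> the term \<open>b\<close> uses up \<open>x\<close>, so it
  is a cycle of \<open>J\<close> on \<open>W - {x}\<close> one position lower and has a filling
  \<open>c\<close> there. Then \<open>a + c\<close> is a cycle free of \<open>x\<close>; all its
  complements contain \<open>x\<close>, so only the unit ideal on \<open>W - {x}\<close> matters and
  it has a filling \<open>v\<close>. The filling of \<open>z\<close> is \<open>v\<close> minus the
  cone over \<open>c\<close>. \<open>W \<noteq> {x}\<close> supplies the vertex needed to find
  \<open>v\<close>.\<close>

lemma exact_at_add_var:
  fixes K :: "'k::comm_ring_1 itself" and W :: "'v::finite set"
  assumes "x \<in> W" "W \<noteq> {x}" and ex: "i > 0 \<Longrightarrow> exact_at K J (W - {x}) (i - 1)"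
  shows "exact_at K {A. A \<in> J \<or> x \<in> A} W i"
  unfolding exact_at_def
proof (intro allI impI)
  fix z :: "'v set \<Rightarrow> 'k" assume z: "chain {A. A \<in> J \<or> x \<in> A} W i z \<and> (\<forall>F. bdry z F = 0)"
  define a where "a F = (if x \<in> F then 0 else z F)" for F
  define b where "b F = (if x \<in> F then 0 else pos_sign F x * z (insert x F))" for F
  have dec: "z F = a F + cone x b F" "bdry a F = - b F" "bdry b F = 0" for F
    using cone_decomposition[where z=z and x=x and F=F] z unfolding a_def b_def by auto
  have b: "F \<subseteq> W - {x} \<and> card F = i - 1 \<and> i > 0 \<and> W - {x} - F \<in> J" if "b F \<noteq> 0" for F
  proof -
    have F: "x \<notin> F" "z (insert x F) \<noteq> 0" using that by (auto simp: b_def split: if_splits)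
    then have "insert x F \<subseteq> W \<and> card (insert x F) = i \<and> W - insert x F \<in> J"
      using z unfolding chain_def by blast
    moreover have "card (insert x F) = Suc (card F)" using F(1) by simp
    moreover have "W - {x} - F = W - insert x F" by auto
    ultimately show ?thesis using F(1) by auto
  qed
  obtain c where c: "chain J (W - {x}) i c" "bdry c = b"
  proof (cases "i = 0")
    case True
    then have "b = (\<lambda>_. 0)" using b by blast
    then show ?thesis by (intro that[of "\<lambda>_. 0"]) (auto simp: chain_def)
  next
    case False
    then have "chain J (W - {x}) (i - 1) b" using b unfolding chain_def by blast
    then show ?thesis using ex False dec(3) that unfolding exact_at_def by auto
  qed
  have cx: "c F = 0" if "x \<in> F" for F using c(1) that unfolding chain_def by blast
  define a' where "a' F = a F + c F" for F
  have "chain UNIV (W - {x}) i a'"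
    unfolding chain_def
  proof (intro allI impI)
    fix F assume "a' F \<noteq> 0"
    then have "a F \<noteq> 0 \<or> c F \<noteq> 0" by (auto simp: a'_def)
    then show "F \<subseteq> W - {x} \<and> card F = i \<and> W - {x} - F \<in> UNIV"
      using z c(1) by (auto simp: a_def chain_def split: if_splits)
  qed
  moreover have "bdry a' F = 0" for F unfolding a'_def[abs_def] bdry_add using dec c by simp
  moreover obtain x' where "x' \<in> W - {x}" using assms by blast
  ultimately obtain v where v: "chain UNIV (W - {x}) (Suc i) v" "bdry v = a'"
    using exact_at_UNIV[of x' "W - {x}" K i] unfolding exact_at_def by blast
  have "bdry (\<lambda>F. v F - cone x c F) F = z F" for F
    using bdry_cone[of x c F] cx v(2) c(2) dec by (simp add: bdry_diff a'_def)
  moreover have "chain {A. A \<in> J \<or> x \<in> A} W (Suc i) (\<lambda>F. v F - cone x c F)"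
    unfolding chain_def
  proof (intro allI impI)
    fix F assume "v F - cone x c F \<noteq> 0"
    then consider "v F \<noteq> 0" | "x \<in> F" "c (F - {x}) \<noteq> 0" by (force simp: cone_def split: if_splits)
    then show "F \<subseteq> W \<and> card F = Suc i \<and> W - F \<in> {A. A \<in> J \<or> x \<in> A}"
    proof cases
      case 1
      then show ?thesis using v(1) assms(1) unfolding chain_def by auto
    next
      case 2
      then have *: "F - {x} \<subseteq> W - {x} \<and> card (F - {x}) = i \<and> W - {x} - (F - {x}) \<in> J"
        using c(1) unfolding chain_def by blast
      moreover have "W - {x} - (F - {x}) = W - F" using 2 by auto
      moreover have "card F = Suc i" using * 2 by (metis card_Suc_Diff1 finite)
      ultimately show ?thesis using assms(1) 2 by auto
    qed
  qed
  ultimately show "\<exists>y. chain {A. A \<in> J \<or> x \<in> A} W (Suc i) y \<and> bdry y = z" by blast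
qed

text \<open>Each variable lowers the number of vertices and the position by one, so
  \<open>card W \<ge> i + 2\<close> persists and keeps \<open>W\<close> from shrinking to the
  variable being added. With more than \<open>i\<close> variables the position runs out first, and
  nothing about \<open>J\<close> is needed.\<close>

lemma exact_at_add_vars:
  fixes K :: "'k::comm_ring_1 itself" and W :: "'v::finite set"
  assumes "finite X" "X \<subseteq> W" "card W \<ge> i + 2"
    and "card X \<le> i \<Longrightarrow> exact_at K J (W - X) (i - card X)"
  shows "exact_at K {A. A \<in> J \<or> A \<inter> X \<noteq> {}} W i"
  using assms
proof (induction X arbitrary: W i rule: finite_induct)
  case (insert x X)
  let ?J = "{A. A \<in> J \<or> A \<inter> X \<noteq> {}}"
  have x: "x \<in> W" "W \<noteq> {x}" using insert.prems by auto
  have "exact_at K ?J (W - {x}) (i - 1)" if "i > 0"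
  proof (rule insert.IH)
    show "X \<subseteq> W - {x}" using insert by auto
    show "i - 1 + 2 \<le> card (W - {x})" using insert.prems x that by simp
    have "W - {x} - X = W - insert x X" "i - 1 - card X = i - card (insert x X)"
      using insert.hyps by auto
    moreover
    assume "card X \<le> i - 1"
    ultimately show "exact_at K J (W - {x} - X) (i - 1 - card X)"
      using insert.prems(3) insert.hyps(1,2) that by simp
  qed
  then have "exact_at K {A. A \<in> ?J \<or> x \<in> A} W i"
    by (rule exact_at_add_var[OF x])
  moreover have "{A. A \<in> ?J \<or> x \<in> A} = {A. A \<in> J \<or> A \<inter> insert x X \<noteq> {}}" by auto
  ultimately show ?case by simp
qed simp

section \<open>Edge ideals and induced cycles of the complement\<close>

definition upset :: "'v set set \<Rightarrow> 'v set set"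
  where "upset E = {A. \<exists>e\<in>E. e \<subseteq> A}"

lemma up_closed_upset: "up_closed (upset E)"
  by (auto simp: up_closed_def upset_def)

text \<open>An induced cycle of length \<open>l \<ge> 4\<close> of the complement of \<open>E\<close>, unrolled periodically.\<close>

definition anticycle :: "'v set set \<Rightarrow> nat \<Rightarrow> (nat \<Rightarrow> 'v) \<Rightarrow> bool"
  where "anticycle E l f \<longleftrightarrow> l \<ge> 4 \<and> (\<forall>i. f (i + l) = f i) \<and>
    (\<forall>i j. 0 < j \<and> j < l \<longrightarrow> f i \<noteq> f (i + j) \<and> ({f i, f (i + j)} \<in> E \<longleftrightarrow> 1 < j \<and> j < l - 1))"

text \<open>A pair that straddles the end of the period has distance \<open>l - j\<close> inside one
  period, and the condition on \<open>j\<close> is symmetric under replacing \<open>j\<close> by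
  \<open>l - j\<close>.\<close>

lemma anticycleI:
  assumes "l \<ge> 4"
    and "\<And>r s. r < s \<Longrightarrow> s < l \<Longrightarrow> g r \<noteq> g s \<and> ({g r, g s} \<in> E \<longleftrightarrow> 1 < s - r \<and> s - r < l - 1)"
  shows "anticycle E l (\<lambda>i. g (i mod l))"
  unfolding anticycle_def
proof (intro conjI allI impI)
  fix i j assume j: "0 < j \<and> j < l"
  define r where "r = i mod l"
  have r: "r < l" unfolding r_def using assms(1) by simp
  have ij: "(i + j) mod l = (r + j) mod l" unfolding r_def by (simp add: mod_add_left_eq)
  have "g (i mod l) \<noteq> g ((i + j) mod l) \<and>
    ({g (i mod l), g ((i + j) mod l)} \<in> E \<longleftrightarrow> 1 < j \<and> j < l - 1)"
  proof (cases "r + j < l")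
    case True
    then have "(i + j) mod l = r + j" using ij by simp
    then show ?thesis using assms(2)[of r "r + j"] True j by (simp add: r_def)
  next
    case False
    have "(i + j) mod l = r + j - l" using ij False r j by (simp add: mod_if)
    moreover have "r - (r + j - l) = l - j" "1 < l - j \<and> l - j < l - 1 \<longleftrightarrow> 1 < j \<and> j < l - 1"
      using False j by auto
    moreover have "g (r + j - l) \<noteq> g r \<and> ({g (r + j - l), g r} \<in> E \<longleftrightarrow>
        1 < r - (r + j - l) \<and> r - (r + j - l) < l - 1)"
      using False j r by (intro assms(2)) auto
    ultimately show ?thesis unfolding r_def[symmetric] by (metis insert_commute)
  qed
  then show "g (i mod l) \<noteq> g ((i + j) mod l)"
    and "{g (i mod l), g ((i + j) mod l)} \<in> E \<longleftrightarrow> 1 < j \<and> j < l - 1" by auto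
qed (use assms in auto)

text \<open>Here \<open>w\<close> is read as the function \<open>u \<mapsto> pos_sign W u * w (W - {u})\<close> on the vertices.\<close>

lemma bdry_codim_two_eq_0_iff:
  fixes w :: "'v::finite set \<Rightarrow> 'k::comm_ring_1"
  assumes "u \<in> W" "v \<in> W" "u \<noteq> v" and w: "\<And>F. w F \<noteq> 0 \<Longrightarrow> F \<subseteq> W"
  shows "bdry w (W - {u, v}) = 0 \<longleftrightarrow> pos_sign W u * w (W - {u}) = pos_sign W v * w (W - {v})"
proof -
  define F where "F = W - {u, v}"
  have ins: "insert u F = W - {v}" "insert v F = W - {u}" using assms by (auto simp: F_def)
  have sign_F: "pos_sign W x = (if to_nat y < to_nat x then - pos_sign F x else pos_sign F x :: 'k)"
    if "{x, y} = {u, v}" for x y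
  proof -
    have "W = insert x (insert y F)" "x \<notin> insert y F" "y \<notin> F"
      using that assms by (auto simp: F_def doubleton_eq_iff)
    then show ?thesis by (simp add: pos_sign_insert)
  qed
  have "bdry w F = (\<Sum>x\<in>{u, v}. pos_sign F x * w (insert x F))"
    unfolding bdry_def
  proof (intro sum.mono_neutral_right ballI)
    fix x assume "x \<in> - F - {u, v}"
    then have "x \<notin> W" by (auto simp: F_def)
    then show "pos_sign F x * w (insert x F) = 0" using w[of "insert x F"] by (cases "w (insert x
        F) = 0") auto
  qed (auto simp: F_def)
  then have bdry: "bdry w F = pos_sign F u * w (W - {v}) + pos_sign F v * w (W - {u})"
    using assms(3) ins by simp
  have neq: "to_nat u \<noteq> to_nat v" using assms(3) by simp
  have 1: "pos_sign F u * pos_sign F v * bdry w F = pos_sign F v * w (W - {v}) + pos_sign F u * w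
      (W - {u})"
    by (simp add: bdry distrib_left mult_ac)
  have 2: "bdry w F = 0 \<longleftrightarrow> pos_sign F u * pos_sign F v * bdry w F = 0"
  proof
    assume "pos_sign F u * pos_sign F v * bdry w F = 0"
    then have "pos_sign F v * (pos_sign F u * (pos_sign F u * pos_sign F v * bdry w F)) = 0" by simp
    then show "bdry w F = 0" by (simp add: mult.assoc)
  qed simp
  have 3: "pos_sign F v * w (W - {v}) + pos_sign F u * w (W - {u}) = 0 \<longleftrightarrow>
      pos_sign W u * w (W - {u}) = pos_sign W v * w (W - {v})"
  proof (cases "to_nat u < to_nat v")
    case True
    then have signs: "pos_sign W u = (pos_sign F u :: 'k)" "pos_sign W v = (- pos_sign F v :: 'k)"
      using sign_F[of u v] sign_F[of v u] by auto
    show ?thesis unfolding signs mult_minus_left eq_neg_iff_add_eq_0 by (simp only: add.commute)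
  next
    case False
    then have signs: "pos_sign W u = (- pos_sign F u :: 'k)" "pos_sign W v = (pos_sign F v :: 'k)"
      using sign_F[of u v] sign_F[of v u] neq by auto
    show ?thesis unfolding signs mult_minus_left neg_eq_iff_add_eq_0 by (simp only: add.commute)
  qed
  show ?thesis
    using 2 unfolding 1 3 by (simp only: F_def)
qed

text \<open>The fundamental class of the cycle survives. As the complement has no triangle on
  \<open>W\<close>, the boundary of the single non-edge \<open>{f 0, f 1}\<close> is an admissible
  cycle. A filling by edges of \<open>E\<close> would differ from that non-edge by the boundary of a
  function \<open>w\<close> on vertices, and such a function cannot jump across exactly one link of
  a closed cycle.\<close>

lemma anticycle_not_exact:
  fixes K :: "'k::comm_ring_1 itself" and E :: "'v::finite set set"
  assumes E: "simple_graph E" and f: "anticycle E l f" and l: "l = i + 3"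
  shows "card (f ` {..<l}) = l" and "\<not> exact_at K (upset E) (f ` {..<l}) i"
proof -
  define W where "W = f ` {..<l}"
  have l4: "l \<ge> 4" and per: "f (i + l) = f i" and
    ne: "0 < j \<Longrightarrow> j < l \<Longrightarrow> f i \<noteq> f (i + j)" and
    edge: "0 < j \<Longrightarrow> j < l \<Longrightarrow> {f i, f (i + j)} \<in> E \<longleftrightarrow> 1 < j \<and> j < l - 1" for i j
    using f unfolding anticycle_def by auto
  have ne': "f r \<noteq> f s" if "r < s" "s < l" for r s
    using ne[of "s - r" r] that by simp
  have "inj_on f {..<l}"
    by (rule inj_onI) (metis lessThan_iff linorder_neqE_nat ne')
  then show card: "card (f ` {..<l}) = l" by (simp add: card_image)
  have fW: "f k \<in> W" if "k \<le> l" for k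
    unfolding W_def using that per[of 0] l4 by (cases "k = l") (auto intro!: image_eqI[of _ _ 0])
  show "\<not> exact_at K (upset E) (f ` {..<l}) i"
    unfolding W_def[symmetric]
  proof
    assume ex: "exact_at K (upset E) W i"
    define F0 where "F0 = W - {f 0, f 1}"
    define \<delta> :: "'v set \<Rightarrow> 'k" where "\<delta> F = (if F = F0 then 1 else 0)" for F
    have f01: "f 0 \<noteq> f 1" "f 0 \<in> W" "f 1 \<in> W" using ne'[of 0 1] l4 fW by auto
    have F0: "F0 \<subseteq> W" "card F0 = Suc i"
      using card f01 l unfolding F0_def W_def[symmetric] by (auto simp: card_Diff_subset)
    have "chain (upset E) W i (bdry \<delta>)"
      unfolding chain_def
    proof (intro allI impI)
      fix F assume "bdry \<delta> F \<noteq> 0"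
      then obtain x where x: "x \<notin> F" "\<delta> (insert x F) \<noteq> 0" by (rule bdry_nonzeroE)
      then have xF: "insert x F = F0" by (auto simp: \<delta>_def split: if_splits)
      then have FW: "F \<subseteq> W" "card F = i" using F0 x by auto
      have WF: "W - F = {f 0, f 1, x}" using xF x f01 F0 unfolding F0_def by blast
      have xW: "x \<in> W" "x \<noteq> f 0" "x \<noteq> f 1" using xF F0_def by auto
      then obtain k where k: "x = f k" "k < l" unfolding W_def by auto
      then have "k \<noteq> 0" "k \<noteq> 1" using xW by metis+
      \<comment> \<open>\<open>f 2\<close> is next to \<open>f 1\<close> on the cycle and hence
        joined to \<open>f 0\<close>; every later vertex is joined to \<open>f 1\<close>.\<close>
      then have "{f 0, x} \<in> E \<or> {f 1, x} \<in> E"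
        using edge[of k 0] edge[of "k - 1" 1] k l4 by (cases "k = 2") (auto simp: numeral_2_eq_2)
      then obtain e where "e \<in> E" "e \<subseteq> W - F" unfolding WF by blast
      then show "F \<subseteq> W \<and> card F = i \<and> W - F \<in> upset E"
        using FW by (auto simp: upset_def)
    qed
    then obtain y where y: "chain (upset E) W (Suc i) y" "bdry y = bdry \<delta>"
      using ex unfolding exact_at_def by (metis bdry_bdry)
    have dl0: "bdry (\<lambda>F. \<delta> F - y F) F = 0" for F using y(2) by (simp add: bdry_diff)
    have chain_diff: "chain UNIV W (Suc i) (\<lambda>F. \<delta> F - y F)"
      unfolding chain_def
    proof (intro allI impI)
      fix F assume "\<delta> F - y F \<noteq> 0"
      then have "\<delta> F \<noteq> 0 \<or> y F \<noteq> 0" by auto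
      then show "F \<subseteq> W \<and> card F = Suc i \<and> W - F \<in> UNIV"
        using F0 y(1) by (auto simp: \<delta>_def chain_def split: if_splits)
    qed
    \<comment> \<open>On the full simplex the cycle bounds. \<open>w\<close> is supported on
      complements of single vertices, so up to sign it is a vertex potential, constant along every
      link where the cycle vanishes.\<close>
    obtain w where w: "chain UNIV W (Suc (Suc i)) w" "bdry w = (\<lambda>F. \<delta> F - y F)"
      using exact_at_UNIV[OF f01(2), of K "Suc i"] chain_diff dl0 unfolding exact_at_def by blast
    have wW: "w F \<noteq> 0 \<Longrightarrow> F \<subseteq> W" for F using w(1) unfolding chain_def by blast
    have yk: "y (W - {f k, f (Suc k)}) = 0" if "k < l" for k
    proof (rule ccontr)
      assume "y (W - {f k, f (Suc k)}) \<noteq> 0"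
      then have "W - (W - {f k, f (Suc k)}) \<in> upset E" using y(1) unfolding chain_def by blast
      then obtain e where e: "e \<in> E" "e \<subseteq> {f k, f (Suc k)}" unfolding upset_def by blast
      have "f k \<noteq> f (Suc k)" using ne[of 1 k] l4 by simp
      then have "e = {f k, f (Suc k)}"
        using e E by (intro card_subset_eq) (auto simp: simple_graph_def)
      then show False using e(1) edge[of 1 k] l4 by simp
    qed
    have d: "\<delta> (W - {f k, f (Suc k)}) = 0 \<longleftrightarrow>
        pos_sign W (f k) * w (W - {f k}) = pos_sign W (f (Suc k)) * w (W - {f (Suc k)})" if "k <
            l" for k
    proof -
      have "f k \<noteq> f (Suc k)" using ne[of 1 k] l4 by simp
      then show ?thesis
        using bdry_codim_two_eq_0_iff[of "f k" W "f (Suc k)" w] fW that wW w(2) yk by auto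
    qed
    have step: "pos_sign W (f k) * w (W - {f k}) = pos_sign W (f (Suc k)) * w (W - {f (Suc k)})"
      if "1 \<le> k" "k < l" for k
    proof -
      have "{f k, f (Suc k)} \<noteq> {f 0, f 1}"
        using ne'[of 0 k] ne'[of 1 k] ne'[of 0 2] ne'[of 1 2] that l4
        by (cases "k = 1") (auto simp: doubleton_eq_iff numeral_2_eq_2)
      moreover have "{f k, f (Suc k)} \<subseteq> W" using fW that by auto
      ultimately have "W - {f k, f (Suc k)} \<noteq> F0"
        unfolding F0_def using f01 by blast
      then show ?thesis using d[of k] that by (simp add: \<delta>_def)
    qed
    \<comment> \<open>The long way round from \<open>f 1\<close> to \<open>f l\<close>, which is
      \<open>f 0\<close>, avoids the marked link.\<close>
    have "pos_sign W (f 1) * w (W - {f 1}) = pos_sign W (f k) * w (W - {f k})" if "1 \<le> k" "k \<le> l"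
        for k
      using that by (induction k rule: dec_induct) (simp_all add: step)
    from this[of l] have "pos_sign W (f 0) * w (W - {f 0}) = pos_sign W (f 1) * w (W - {f 1})"
      using per[of 0] l4 by simp
    then have "\<delta> F0 = 0" using d[of 0] l4 by (simp add: F0_def)
    then show False by (simp add: \<delta>_def)
  qed
qed

section \<open>Chordal complements and simplicial vertices\<close>

definition nonadj :: "'v set set \<Rightarrow> 'v \<Rightarrow> 'v \<Rightarrow> bool"
  where "nonadj E u v \<longleftrightarrow> u \<noteq> v \<and> {u, v} \<notin> E"

lemma nonadj_sym: "nonadj E u v \<longleftrightarrow> nonadj E v u"
  by (auto simp: nonadj_def insert_commute)

text \<open>Paths of the complement graph. Only inner vertices are bound to \<open>A\<close>, so
  that the two ends may lie in its neighbourhood.\<close>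

definition is_path :: "'v set set \<Rightarrow> 'v set \<Rightarrow> nat \<Rightarrow> (nat \<Rightarrow> 'v) \<Rightarrow> bool"
  where "is_path E A n p \<longleftrightarrow> (\<forall>k. 0 < k \<and> k < n \<longrightarrow> p k \<in> A) \<and> (\<forall>k<n. nonadj E (p k) (p (Suc k)))"

text \<open>A repeated vertex allows the loop between its two visits to be cut out, and a chord
  replaces the segment that it spans; either would shorten the path.\<close>

lemma shortest_path_induced:
  assumes p: "is_path E A n p" and s: "s < t" "t \<le> n"
    and least: "\<And>m q. is_path E A m q \<Longrightarrow> q 0 = p 0 \<Longrightarrow> q m = p n \<Longrightarrow> n \<le> m"
  shows "p s \<noteq> p t" and "nonadj E (p s) (p t) \<longleftrightarrow> t = Suc s"
proof -
  show "p s \<noteq> p t"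
  proof
    assume eq: "p s = p t"
    define q where "q k = (if k \<le> s then p k else p (k + (t - s)))" for k
    have "is_path E A (n - (t - s)) q"
      unfolding is_path_def
    proof (intro conjI allI impI)
      fix k assume k: "0 < k \<and> k < n - (t - s)"
      then show "q k \<in> A" using p s by (auto simp: is_path_def q_def)
    next
      fix k assume k: "k < n - (t - s)"
      consider "k < s" | "k = s" | "k > s" by linarith
      then show "nonadj E (q k) (q (Suc k))"
      proof cases
        case 2
        then have "nonadj E (p t) (p (Suc t))" using p k s by (auto simp: is_path_def)
        then show ?thesis using 2 eq s by (simp add: q_def)
      qed (use p k s in \<open>auto simp: is_path_def q_def\<close>)
    qed
    moreover have "q (n - (t - s)) = p n"
      using eq s by (cases "t = n") (auto simp: q_def)
    ultimately have "n \<le> n - (t - s)" using least[of "n - (t - s)" q] by (simp add: q_def[of 0])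
    then show False using s by simp
  qed
  show "nonadj E (p s) (p t) \<longleftrightarrow> t = Suc s"
  proof
    assume adj: "nonadj E (p s) (p t)"
    define d where "d = t - s - 1"
    define q where "q k = (if k \<le> s then p k else p (k + d))" for k
    have "is_path E A (n - d) q"
      unfolding is_path_def
    proof (intro conjI allI impI)
      fix k assume k: "0 < k \<and> k < n - d"
      then show "q k \<in> A" using p s by (auto simp: is_path_def q_def d_def)
    next
      fix k assume k: "k < n - d"
      consider "k < s" | "k = s" | "k > s" by linarith
      then show "nonadj E (q k) (q (Suc k))"
      proof cases
        case 2
        then show ?thesis using adj s by (simp add: q_def d_def)
      qed (use p k s in \<open>auto simp: is_path_def q_def d_def\<close>)
    qed
    moreover have "q (n - d) = p n"
      using s by (auto simp: q_def d_def)
    ultimately have "n \<le> n - d" using least[of "n - d" q] by (simp add: q_def[of 0])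
    then show "t = Suc s" using s by (simp add: d_def)
  qed (use p s in \<open>auto simp: is_path_def\<close>)
qed

lemma reach_imp_path:
  assumes "(\<lambda>u v. nonadj E u v \<and> v \<in> A)\<^sup>*\<^sup>* x y" "x \<in> A" "nonadj E b x"
  shows "\<exists>n p. is_path E A n p \<and> p 0 = b \<and> p n = y \<and> n > 0 \<and> y \<in> A"
  using assms(1)
proof (induction rule: rtranclp_induct)
  case base
  show ?case using assms by (intro exI[of _ 1] exI[of _ "\<lambda>k. if k = 0 then b else x"]) (auto simp:
      is_path_def)
next
  case (step y z)
  then obtain n p where p: "is_path E A n p" "p 0 = b" "p n = y" "n > 0" "y \<in> A" by blast
  then have "is_path E A (Suc n) (p(Suc n := z))"
    using step.hyps(2) unfolding is_path_def by (auto simp: less_Suc_eq)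
  moreover have "(p(Suc n := z)) 0 = b" "(p(Suc n := z)) (Suc n) = z" using p by auto
  ultimately show ?case using step.hyps(2) by blast
qed

text \<open>
  Dirac's theorem: a chordal graph has a simplicial vertex. Take a maximal connected \<open>A\<close> that
  does not dominate \<open>W\<close>, let \<open>B\<close> be its neighbourhood and \<open>C\<close> the rest. By maximality
  every vertex of \<open>B\<close> is joined to every vertex of \<open>C\<close>; then \<open>B\<close> is a clique, since two
  non-adjacent vertices of \<open>B\<close>, a shortest path between them through \<open>A\<close>, and a vertex of \<open>C\<close>
  form an induced cycle. So a vertex that is simplicial in \<open>C\<close> is simplicial in \<open>W\<close>.
\<close>

lemma simplicial_vertex_exists:
  fixes E :: "'v set set"
  assumes "finite W" "W \<noteq> {}" "card W \<le> n" and chordal: "\<And>l f. l \<le> n \<Longrightarrow> \<not> anticycle E l f"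
  shows "\<exists>x\<in>W. \<forall>u\<in>W. \<forall>v\<in>W. nonadj E x u \<and> nonadj E x v \<and> u \<noteq> v \<longrightarrow> nonadj E u v"
  using assms(1-3)
proof (induction "card W" arbitrary: W rule: less_induct)
  case less
  define R where "R A = (\<lambda>u v. nonadj E u v \<and> v \<in> A)\<^sup>*\<^sup>*" for A
  define S where "S = {A. A \<subseteq> W \<and> A \<noteq> {} \<and> (\<forall>x\<in>A. \<forall>y\<in>A. R A x y) \<and>
    (\<exists>c\<in>W - A. \<forall>a\<in>A. \<not> nonadj E a c)}"
  show ?case
  proof (cases "S = {}")
    case True
    \<comment> \<open>Singletons are connected, so an empty \<open>S\<close> means that
      \<open>W\<close> is a clique of the complement and every vertex is simplicial.\<close>
    have "nonadj E u v" if "u \<in> W" "v \<in> W" "u \<noteq> v" for u v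
    proof (rule ccontr)
      assume "\<not> nonadj E u v"
      then have "{u} \<in> S" using that by (auto simp: S_def R_def)
      then show False using True by simp
    qed
    then show ?thesis using less.prems by blast
  next
    case False
    have "finite S" using less.prems(1) by (auto simp: S_def intro: finite_subset[of _ "Pow W"])
    then have "Max (card ` S) \<in> card ` S" using False by simp
    then obtain A where A: "A \<in> S" and card_A: "card A = Max (card ` S)" by auto
    have maxA: "card A' \<le> card A" if "A' \<in> S" for A'
      unfolding card_A using that \<open>finite S\<close> by simp
    have AW: "A \<subseteq> W" "A \<noteq> {}" and conn: "\<And>x y. x \<in> A \<Longrightarrow> y \<in> A \<Longrightarrow> R A x y"
      using A unfolding S_def by auto
    have finA: "finite A" using AW less.prems(1) finite_subset by blast
    define B where "B = {b \<in> W - A. \<exists>a\<in>A. nonadj E a b}"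
    define C where "C = W - A - B"
    have C: "C \<noteq> {}" "C \<subseteq> W" "C \<inter> A = {}" "\<And>a c. a \<in> A \<Longrightarrow> c \<in> C \<Longrightarrow> \<not> nonadj E a c"
      using A unfolding S_def C_def B_def by auto
    have BC: "nonadj E b c" if b: "b \<in> B" and c: "c \<in> C" for b c
    proof (rule ccontr)
      assume nbc: "\<not> nonadj E b c"
      obtain a where a: "a \<in> A" "nonadj E a b" using b by (auto simp: B_def)
      \<comment> \<open>If \<open>b\<close> and \<open>c\<close> were not joined,
        \<open>insert b A\<close> would again be connected and again miss \<open>c\<close>, although
        it is larger than \<open>A\<close>.\<close>
      have mono: "R (insert b A) x y" if "R A x y" for x y
        using that unfolding R_def by (rule rtranclp_mono[THEN predicate2D, rotated]) auto
      have ab: "R (insert b A) x b" if "x \<in> A" for x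
        using mono[OF conn[OF that a(1)]] a(2) unfolding R_def
        by (simp add: rtranclp.rtrancl_into_rtrancl)
      have ba: "R (insert b A) b y" if "y \<in> A" for y
      proof -
        have "nonadj E b a \<and> a \<in> insert b A" using a nonadj_sym[of E] by auto
        then show ?thesis
          using mono[OF conn[OF a(1) that]] unfolding R_def by (simp add:
              converse_rtranclp_into_rtranclp)
      qed
      have "R (insert b A) b b" by (simp add: R_def)
      then have "\<forall>x\<in>insert b A. \<forall>y\<in>insert b A. R (insert b A) x y"
        using mono[OF conn] ab ba by blast
      moreover have "insert b A \<subseteq> W" "c \<in> W - insert b A" using AW b c by (auto simp: B_def C_def)
      moreover have "\<forall>a\<in>insert b A. \<not> nonadj E a c" using nbc C(4) c by blast
      ultimately have "insert b A \<in> S" unfolding S_def by blast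
      then have "card (insert b A) \<le> card A" by (rule maxA)
      then show False using finA b by (simp add: B_def)
    qed
    have BB: "nonadj E b b'" if b: "b \<in> B" "b' \<in> B" "b \<noteq> b'" for b b'
    proof (rule ccontr)
      assume nb: "\<not> nonadj E b b'"
      obtain a a' where a: "a \<in> A" "nonadj E a b" "a' \<in> A" "nonadj E a' b'"
        using b by (auto simp: B_def)
      have "\<exists>n p. is_path E A n p \<and> p 0 = b \<and> p n = a' \<and> n > 0 \<and> a' \<in> A"
        by (rule reach_imp_path[OF _ a(1)]) (use conn[OF a(1,3)] a nonadj_sym[of E] in \<open>auto simp:
            R_def\<close>)
      then obtain m q where q: "is_path E A m q" "q 0 = b" "q m = a'" "m > 0" by blast
      have "is_path E A (Suc m) (q(Suc m := b'))"
        using q a unfolding is_path_def by (auto simp: less_Suc_eq)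
      then have ex: "\<exists>m q. is_path E A m q \<and> q 0 = b \<and> q m = b'"
        using q by (metis fun_upd_apply nat.distinct(1))
      define k where "k = (LEAST m. \<exists>q. is_path E A m q \<and> q 0 = b \<and> q m = b')"
      obtain p where p: "is_path E A k p" "p 0 = b" "p k = b'"
        using LeastI_ex[OF ex] unfolding k_def by blast
      have least: "k \<le> m" if "is_path E A m q" "q 0 = p 0" "q m = p k" for m q
        unfolding k_def using that p by (intro Least_le) auto
      note induced = shortest_path_induced[OF p(1) _ _ least]
      have k2: "k \<ge> 2"
      proof (rule ccontr)
        assume "\<not> k \<ge> 2"
        then have "k = 0 \<or> k = 1" by auto
        then show False using p b nb by (auto simp: is_path_def)
      qed
      obtain c where c: "c \<in> C" using C by blast
      have pA: "p r \<in> A" if "0 < r" "r < k" for r using p(1) that by (simp add: is_path_def)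
      have pW: "p r \<in> W - C" if "r \<le> k" for r
      proof (cases "r = 0 \<or> r = k")
        case True
        then have "p r \<in> B" using p(2,3) b(1,2) by blast
        then show ?thesis by (auto simp: B_def C_def)
      next
        case False
        then have "p r \<in> A" using pA[of r] that by simp
        then show ?thesis using AW C(3) by blast
      qed
      \<comment> \<open>The vertex \<open>c\<close> closes the path at index \<open>Suc k\<close>:
        it is joined to both ends, which lie in \<open>B\<close>, and to no inner vertex, as these
        lie in \<open>A\<close>.\<close>
      define g where "g r = (if r = Suc k then c else p r)" for r
      have "anticycle E (k + 2) (\<lambda>i. g (i mod (k + 2)))"
      proof (rule anticycleI)
        fix r s assume rs: "r < s" "s < k + 2"
        show "g r \<noteq> g s \<and> ({g r, g s} \<in> E \<longleftrightarrow> 1 < s - r \<and> s - r < k + 2 - 1)"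
        proof (cases "s = Suc k")
          case False
          then have "p r \<noteq> p s" "nonadj E (p r) (p s) \<longleftrightarrow> s = Suc r"
            using induced[of r s] rs by auto
          moreover have "r \<noteq> Suc k" using rs by simp
          ultimately show ?thesis using rs False by (auto simp: g_def nonadj_def)
        next
          case True
          have ne: "p r \<noteq> c" using pW[of r] c rs True by auto
          have "nonadj E (p r) c \<longleftrightarrow> r = 0 \<or> r = k"
          proof (cases "r = 0 \<or> r = k")
            case ends: True
            then have "p r \<in> B" using p(2,3) b(1,2) by blast
            then show ?thesis using BC c ends by blast
          next
            case False
            then have "p r \<in> A" using pA[of r] rs True by simp
            then show ?thesis using C(4) c False by blast
          qed
          then have "{p r, c} \<in> E \<longleftrightarrow> r \<noteq> 0 \<and> r \<noteq> k" using ne by (auto simp: nonadj_def)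
          then show ?thesis using True rs ne by (auto simp: g_def)
        qed
      qed (use k2 in simp)
      \<comment> \<open>The \<open>k + 1\<close> path vertices and \<open>c\<close> are distinct
        elements of \<open>W\<close>.\<close>
      moreover have "k + 2 \<le> n"
      proof -
        have "p r \<noteq> p s" if "r < s" "s \<le> k" for r s
          using induced(1)[OF that] .
        then have "inj_on p {..k}"
          by (intro linorder_inj_onI) auto
        then have "card (p ` {..k}) = Suc k" by (simp add: card_image)
        moreover have "p ` {..k} \<subseteq> W - {c}" using pW c by auto
        moreover have "card (W - {c}) = card W - 1" using c C(2) less.prems by auto
        moreover have "card W > 0" using less.prems by (simp add: card_gt_0_iff)
        ultimately show ?thesis
          using card_mono[of "W - {c}" "p ` {..k}"] less.prems by auto
      qed
      ultimately show False using chordal by blast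
    qed
    have "C \<subset> W" using AW C by blast
    then have "card C < card W" by (simp add: less.prems(1) psubset_card_mono)
    moreover have "finite C" using C(2) less.prems(1) finite_subset by blast
    ultimately obtain x where x: "x \<in> C"
      "\<And>u v. u \<in> C \<Longrightarrow> v \<in> C \<Longrightarrow> nonadj E x u \<Longrightarrow> nonadj E x v \<Longrightarrow> u \<noteq> v \<Longrightarrow> nonadj E u v"
      using less.hyps[of C] C(1) less.prems(3) by (metis le_trans less_imp_le)
    have nbr: "u \<in> B \<or> u \<in> C" if "u \<in> W" "nonadj E x u" for u
      using C(4)[of u x] x(1) that nonadj_sym[of E] by (auto simp: C_def)
    show ?thesis
    proof (rule bexI[of _ x], intro ballI impI)
      fix u v assume "u \<in> W" "v \<in> W" "nonadj E x u \<and> nonadj E x v \<and> u \<noteq> v"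
      then show "nonadj E u v"
        using nbr[of u] nbr[of v] x(2)[of u v] BB[of u v] BC[of u v] BC[of v u] nonadj_sym[of E]
            by blast
    qed (use x C in auto)
  qed
qed

text \<open>Induction through the colon by a single vertex \<open>x\<close>: adding \<open>x\<close>
  leads to \<open>W - {x}\<close> one position lower, and the colon by \<open>x\<close> is the edge
  ideal plus the variables in \<open>N x\<close>. After these variables are removed, the position
  has dropped by \<open>card (N x)\<close> but the vertex set by one more, so one vertex of slack is
  needed.\<close>

lemma exact_at_upset_edges:
  fixes K :: "'k::comm_ring_1 itself" and E :: "'v::finite set set"
  assumes E: "simple_graph E" and "card W \<ge> i + 3"
    and "\<And>l f. l \<le> i + 3 \<Longrightarrow> \<not> anticycle E l f"
  shows "exact_at K (upset E) W i"
  using assms(2-)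
proof (induction "card W" arbitrary: W i rule: less_induct)
  case less
  have W: "W \<noteq> {}" using less.prems by auto
  define N where "N x = {u \<in> W. {x, u} \<in> E}" for x
  have N: "x \<notin> N x" for x using E by (auto simp: N_def simple_graph_def)
  have reduce: "exact_at K (upset E) W i"
    if x: "x \<in> W"
      and rest: "card (N x) \<le> i \<Longrightarrow> exact_at K (upset E) (W - {x} - N x) (i - card (N x))" for x
  proof (rule exact_at_colon[OF up_closed_upset])
    show "{x} \<subseteq> W" using x by simp
    have "exact_at K (upset E) (W - {x}) (i - 1)" if "i > 0"
      using less.prems that x by (intro less.hyps) (auto simp: card_gt_0_iff)
    moreover have "W \<noteq> {x}" using less.prems by auto
    ultimately have "exact_at K {A. A \<in> upset E \<or> x \<in> A} W i"
      using x by (intro exact_at_add_var) auto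
    then show "exact_at K {A. A \<in> upset E \<or> {x} \<subseteq> A} W i" by simp
    have "exact_at K {A. A \<in> upset E \<or> A \<inter> N x \<noteq> {}} (W - {x}) i"
    proof (rule exact_at_add_vars)
      show "N x \<subseteq> W - {x}" using N by (auto simp: N_def)
      show "i + 2 \<le> card (W - {x})" using x less.prems by simp
    qed (use rest in auto)
    moreover have "A \<union> {x} \<in> upset E \<longleftrightarrow> A \<in> upset E \<or> A \<inter> N x \<noteq> {}" if "A \<subseteq> W - {x}" for A
    proof
      assume "A \<union> {x} \<in> upset E"
      then obtain e where e: "e \<in> E" "e \<subseteq> insert x A" by (auto simp: upset_def)
      show "A \<in> upset E \<or> A \<inter> N x \<noteq> {}"
      proof (cases "x \<in> e")
        case True
        obtain u where "e = {x, u}" "u \<noteq> x"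
          using True e(1) E unfolding simple_graph_def by (metis card_2_iff doubleton_eq_iff
              insertE singletonD)
        then show ?thesis using e that by (auto simp: N_def)
      qed (use e in \<open>auto simp: upset_def\<close>)
    qed (auto simp: upset_def N_def)
    ultimately show "exact_at K {A. A \<union> {x} \<in> upset E} (W - {x}) i"
      by (subst exact_at_cong[where J' = "{A. A \<in> upset E \<or> A \<inter> N x \<noteq> {}}"]) auto
  qed
  show ?case
  proof (cases "card W = i + 3")
    case True
    \<comment> \<open>No slack is left. But the cycles excluded by assumption now have all lengths
      up to \<open>card W\<close>, so the complement is chordal on \<open>W\<close>; for a
      simplicial \<open>x\<close> the vertices outside \<open>N x\<close> span no edge, and the
      colon strand has no chains.\<close>
    obtain x where x: "x \<in> W" and
      simplicial: "\<forall>u\<in>W. \<forall>v\<in>W. nonadj E x u \<and> nonadj E x v \<and> u \<noteq> v \<longrightarrow> nonadj E u v"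
      using simplicial_vertex_exists[OF finite W eq_refl[OF True] less.prems(2)] by blast
    show ?thesis
    proof (rule reduce[OF x], rule exact_at_trivial)
      fix F
      show "W - {x} - N x - F \<notin> upset E"
      proof
        assume "W - {x} - N x - F \<in> upset E"
        then obtain e where e: "e \<in> E" "e \<subseteq> W - {x} - N x" by (auto simp: upset_def)
        then obtain u v where uv: "e = {u, v}" "u \<noteq> v" using E by (auto simp: simple_graph_def
            card_2_iff)
        then have "u \<in> W" "v \<in> W" "nonadj E x u" "nonadj E x v"
          using e by (auto simp: nonadj_def N_def)
        then have "nonadj E u v" using simplicial uv(2) by blast
        then show False using e uv by (simp add: nonadj_def)
      qed
    qed
  next
    case False
    \<comment> \<open>Any vertex will do, since the extra vertex pays for \<open>x\<close>
      itself.\<close>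
    obtain x where x: "x \<in> W" using W by blast
    show ?thesis
    proof (rule reduce[OF x], rule less.hyps)
      assume N_le: "card (N x) \<le> i"
      have "N x \<subseteq> W - {x}" using N by (auto simp: N_def)
      then have card: "card (W - {x} - N x) = card W - 1 - card (N x)"
        using x by (simp add: card_Diff_subset)
      then show "card (W - {x} - N x) < card W" "i - card (N x) + 3 \<le> card (W - {x} - N x)"
        using less.prems False N_le by auto
      show "\<not> anticycle E l f" if "l \<le> i - card (N x) + 3" for l f
        using less.prems(2) that by auto
    qed
  qed
qed

section \<open>Edge colon ideals in gap free graphs\<close>

text \<open>A common neighbour \<open>u\<close> of \<open>a\<close> and \<open>b\<close> gives no
  generator of its own: the edges \<open>{a, u}\<close> and \<open>{b, u}\<close> are not disjoint.
  Hence \<open>u \<noteq> v\<close>.\<close>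

definition colon_graph :: "'v set set \<Rightarrow> 'v \<Rightarrow> 'v \<Rightarrow> 'v set set"
  where "colon_graph E a b = {e \<in> E. a \<notin> e \<and> b \<notin> e} \<union>
    {{u, v} | u v. {a, u} \<in> E \<and> {b, v} \<in> E \<and> u \<noteq> v \<and> {u, v} \<inter> {a, b} = {}}"

lemma simple_colon_graph: "simple_graph E \<Longrightarrow> simple_graph (colon_graph E a b)"
  by (auto simp: simple_graph_def colon_graph_def)

text \<open>
  Consecutive vertices of the cycle are not joined in the colon graph, so an arc cannot pass
  directly from the neighbours of \<open>a\<close> to those of \<open>b\<close>.
\<close>

lemma arc_escape:
  assumes "simple_graph E" and f: "anticycle (colon_graph E a b) l f"
    and s: "{a, f s} \<in> E" "{b, f (s + m)} \<in> E" "0 < m"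
  shows "\<exists>k. 0 < k \<and> k < m \<and> {a, f (s + k)} \<notin> E \<and> {b, f (s + k)} \<notin> E"
proof (rule ccontr)
  assume contr: "\<not> ?thesis"
  have l4: "l \<ge> 4" and ne: "0 < j \<Longrightarrow> j < l \<Longrightarrow> f i \<noteq> f (i + j)" and
    edge: "0 < j \<Longrightarrow> j < l \<Longrightarrow> {f i, f (i + j)} \<in> colon_graph E a b \<longleftrightarrow> 1 < j \<and> j < l - 1" for i j
    using f unfolding anticycle_def by auto
  have avoid: "f i \<noteq> a \<and> f i \<noteq> b" for i
  proof -
    have "{f i, f (i + 2)} \<in> colon_graph E a b" using edge[of 2 i] l4 by simp
    then show ?thesis by (auto simp: colon_graph_def doubleton_eq_iff)
  qed
  have consec: "\<not> ({a, f i} \<in> E \<and> {b, f (Suc i)} \<in> E)" for i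
  proof
    assume "{a, f i} \<in> E \<and> {b, f (Suc i)} \<in> E"
    moreover have "f i \<noteq> f (Suc i)" using ne[of 1 i] l4 by simp
    ultimately have "{f i, f (Suc i)} \<in> colon_graph E a b"
      using avoid[of i] avoid[of "Suc i"] unfolding colon_graph_def by blast
    then show False using edge[of 1 i] l4 by simp
  qed
  \<comment> \<open>If every inner vertex of the arc sees \<open>a\<close> or \<open>b\<close>, then
    adjacency to \<open>a\<close> propagates along the arc, right up to the predecessor of
    \<open>f (s + m)\<close>.\<close>
  have "{a, f (s + k)} \<in> E" if "k < m" for k
    using that
  proof (induction k)
    case (Suc k)
    then have "{b, f (Suc (s + k))} \<notin> E" using consec by auto
    then show ?case using contr Suc.prems by auto
  qed (use s in simp)
  from this[of "m - 1"] show False using consec[of "s + (m - 1)"] s by simp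
qed

text \<open>Suppose a pair of the cycle is joined only by a new edge. It cuts the cycle into two
  arcs, and each contains an inner vertex that sees neither \<open>a\<close> nor \<open>b\<close>.
  These two vertices are not consecutive, so they are joined in the colon graph, necessarily by an
  old edge, and this edge forms a gap with \<open>{a, b}\<close>.\<close>

lemma anticycle_colon_graph:
  assumes E: "simple_graph E" "gap_free E" and ab: "{a, b} \<in> E"
    and f: "anticycle (colon_graph E a b) l f"
  shows "anticycle E l f"
proof -
  have l4: "l \<ge> 4" and per: "f (i + l) = f i" and ne: "0 < j \<Longrightarrow> j < l \<Longrightarrow> f i \<noteq> f (i + j)" and
    edge: "0 < j \<Longrightarrow> j < l \<Longrightarrow> {f i, f (i + j)} \<in> colon_graph E a b \<longleftrightarrow> 1 < j \<and> j < l - 1" for i j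
    using f unfolding anticycle_def by auto
  have avoid: "f i \<noteq> a \<and> f i \<noteq> b" for i
  proof -
    have "{f i, f (i + 2)} \<in> colon_graph E a b" using edge[of 2 i] l4 by simp
    then show ?thesis by (auto simp: colon_graph_def doubleton_eq_iff)
  qed
  have swap: "colon_graph E b a = colon_graph E a b"
    unfolding colon_graph_def by (auto simp: insert_commute)
  have no_escape: "{a, f i} \<in> E \<or> {b, f i} \<in> E \<or> {a, f (i + j)} \<in> E \<or> {b, f (i + j)} \<in> E"
    if j: "1 < j" "j < l - 1" for i j
  proof (rule ccontr)
    assume contr: "\<not> ?thesis"
    have "{f i, f (i + j)} \<in> colon_graph E a b" using edge[of j i] j by simp
    then have "{f i, f (i + j)} \<in> E"
      using contr by (auto simp: colon_graph_def doubleton_eq_iff)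
    moreover have "{f i, f (i + j)} \<inter> {a, b} = {}" using avoid by auto
    ultimately have "\<exists>x\<in>{f i, f (i + j)}. \<exists>y\<in>{a, b}. {x, y} \<in> E"
      using E(2) ab unfolding gap_free_def by blast
    then show False using contr by (auto simp: insert_commute)
  qed
  have opp: False
    if s: "{a, f s} \<in> E" "{b, f (s + m)} \<in> E" "1 < m" "m < l - 1" for s m
  proof -
    obtain k where k: "0 < k" "k < m" "{a, f (s + k)} \<notin> E" "{b, f (s + k)} \<notin> E"
      using arc_escape[OF E(1) f s(1,2)] s by auto
    \<comment> \<open>The second arc runs from \<open>s + m\<close> on to \<open>s + l\<close>; the
      roles of \<open>a\<close> and \<open>b\<close> are exchanged on it.\<close>
    have "{a, f (s + m + (l - m))} \<in> E" using per[of s] s by simp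
    then obtain k' where k': "0 < k'" "k' < l - m" "{a, f (s + m + k')} \<notin> E" "{b, f (s + m + k')}
        \<notin> E"
      using arc_escape[OF E(1), of b a l f "s + m" "l - m"] f s unfolding swap by force
    \<comment> \<open>The end \<open>f (s + m)\<close> separates the two vertices on one side and
      \<open>f s\<close> on the other, so their distance is neither 1 nor
      \<open>l - 1\<close>.\<close>
    have "s + k + (m - k + k') = s + m + k'" "1 < m - k + k'" "m - k + k' < l - 1"
      using k k' s by auto
    then show False using no_escape[of "m - k + k'" "s + k"] k k' by metis
  qed
  have "{f i, f (i + j)} \<in> E" if j: "1 < j" "j < l - 1" for i j
  proof (rule ccontr)
    assume notE: "{f i, f (i + j)} \<notin> E"
    have "{f i, f (i + j)} \<in> colon_graph E a b" using edge[of j i] j by simp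
    then consider "{a, f i} \<in> E" "{b, f (i + j)} \<in> E" | "{b, f i} \<in> E" "{a, f (i + j)} \<in> E"
      using notE by (auto simp: colon_graph_def doubleton_eq_iff)
    then show False
    proof cases
      case 2
      have "i + j + (l - j) = i + l" "1 < l - j" "l - j < l - 1" using j by auto
      then show False using opp[of "i + j" "l - j"] 2 per[of i] by metis
    qed (use opp j in blast)
  qed
  moreover have "{f i, f (i + j)} \<notin> E" if "0 < j" "j < l" "\<not> (1 < j \<and> j < l - 1)" for i j
  proof
    assume "{f i, f (i + j)} \<in> E"
    then have "{f i, f (i + j)} \<in> colon_graph E a b" using avoid by (auto simp: colon_graph_def)
    then show False using edge[of j i] that by simp
  qed
  ultimately show ?thesis
    unfolding anticycle_def using l4 per ne by blast
qed

section \<open>The ideal generated by products of two disjoint edges\<close>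

definition two_matchings :: "'v set set \<Rightarrow> 'v set set"
  where "two_matchings E = {A. \<exists>e\<in>E. \<exists>e'\<in>E. e \<inter> e' = {} \<and> e \<subseteq> A \<and> e' \<subseteq> A}"

lemma edge_through:
  assumes "simple_graph E" "e \<in> E" "x \<in> e"
  obtains u where "e = {x, u}" "u \<noteq> x"
proof -
  obtain y z where "e = {y, z}" "y \<noteq> z" using assms by (metis simple_graph_def card_2_iff)
  then show ?thesis using that[of z] that[of y] assms(3) by auto
qed

text \<open>An old edge avoiding \<open>a\<close> and \<open>b\<close> pairs with
  \<open>{a, b}\<close> itself, hence lies in the colon. Two disjoint edges that both meet
  \<open>{a, b}\<close> must meet it in different vertices, and their other ends form a new edge. An
  edge of \<open>S\<close> meeting \<open>{a, b}\<close> leaves just one variable, because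
  \<open>{a, b} \<notin> S\<close>. The description has the same shape for every \<open>S\<close>,
  so the order in which edges are added is immaterial.\<close>

lemma two_matchings_colon:
  assumes E: "simple_graph E" and S: "S \<subseteq> E" and ab: "{a, b} \<in> E" "{a, b} \<notin> S"
    and A: "A \<subseteq> - {a, b}"
  shows "A \<union> {a, b} \<in> two_matchings E \<union> upset S \<longleftrightarrow>
    A \<in> upset (colon_graph E a b) \<or> (\<exists>x\<in>A. {a, x} \<in> S \<or> {b, x} \<in> S)"
    (is "?L \<longleftrightarrow> ?R")
proof
  have neq: "a \<noteq> b" using E ab by (auto simp: simple_graph_def)
  have disj: ?R if "e \<in> E" "a \<notin> e" "b \<notin> e" "e \<subseteq> A \<union> {a, b}" for e
  proof -
    have "e \<subseteq> A" "e \<in> colon_graph E a b" using that by (auto simp: colon_graph_def)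
    then show ?R by (auto simp: upset_def)
  qed
  assume ?L
  then consider "A \<union> {a, b} \<in> upset S" | "A \<union> {a, b} \<in> two_matchings E" by blast
  then show ?R
  proof cases
    case 1
    then obtain e where e: "e \<in> S" "e \<subseteq> A \<union> {a, b}" by (auto simp: upset_def)
    consider "a \<in> e" | "b \<in> e" | "a \<notin> e" "b \<notin> e" by blast
    then show ?R
    proof cases
      case 1
      then obtain u where "e = {a, u}" "u \<noteq> a" using edge_through[OF E] e S by blast
      then show ?R using e ab by auto
    next
      case 2
      then obtain u where u: "e = {b, u}" "u \<noteq> b" using edge_through[OF E] e S by blast
      then have "u \<noteq> a" using e ab by (auto simp: insert_commute)
      then show ?R using e u by auto
    next
      case 3
      then show ?R using disj e S by blast
    qed
  next
    case 2
    then obtain e e' where e: "e \<in> E" "e' \<in> E" "e \<inter> e' = {}" "e \<subseteq> A \<union> {a, b}" "e' \<subseteq> A \<union> {a, b}"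
      by (auto simp: two_matchings_def)
    have main: ?R if h: "h \<in> E" "h' \<in> E" "h \<inter> h' = {}" "h \<subseteq> A \<union> {a, b}" "h' \<subseteq> A \<union> {a, b}"
      "a \<in> h" "b \<in> h'" for h h'
    proof -
      obtain u where u: "h = {a, u}" "u \<noteq> a" using edge_through[OF E] h by blast
      obtain v where v: "h' = {b, v}" "v \<noteq> b" using edge_through[OF E] h by blast
      have "u \<in> A" "v \<in> A" "u \<noteq> v" using u v h by auto
      then have "{u, v} \<in> colon_graph E a b" using u v h A unfolding colon_graph_def by blast
      moreover have "{u, v} \<subseteq> A" using \<open>u \<in> A\<close> \<open>v \<in> A\<close> by blast
      ultimately show ?R unfolding upset_def by blast
    qed
    consider "a \<notin> e" "b \<notin> e" | "a \<notin> e'" "b \<notin> e'" | "a \<in> e" "b \<in> e'" | "b \<in> e" "a \<in> e'"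
      using e(3) by blast
    then show ?R
    proof cases
      case 1
      then show ?R using disj e by blast
    next
      case 2
      then show ?R using disj e by blast
    next
      case 3
      then show ?R by (rule main[OF e])
    next
      case 4
      have "e' \<inter> e = {}" using e(3) by blast
      from main[OF e(2,1) this e(5,4) 4(2,1)] show ?R .
    qed
  qed
next
  assume ?R
  then consider e where "e \<in> E" "a \<notin> e" "b \<notin> e" "e \<subseteq> A"
    | u v where "{a, u} \<in> E" "{b, v} \<in> E" "u \<noteq> v" "u \<in> A" "v \<in> A"
    | x where "x \<in> A" "{a, x} \<in> S \<or> {b, x} \<in> S"
    by (auto simp: upset_def colon_graph_def)
  then show ?L
  proof cases
    case 1
    then have "A \<union> {a, b} \<in> two_matchings E" unfolding two_matchings_def
      using ab by (intro CollectI bexI[of _ e] bexI[of _ "{a, b}"]) auto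
    then show ?thesis by blast
  next
    case 2
    have "{a, u} \<inter> {b, v} = {}" using 2 A ab E by (auto simp: simple_graph_def)
    then have "A \<union> {a, b} \<in> two_matchings E" unfolding two_matchings_def
      using 2 by (intro CollectI bexI[of _ "{a, u}"] bexI[of _ "{b, v}"]) auto
    then show ?thesis by blast
  next
    case 3
    then have "{a, x} \<subseteq> A \<union> {a, b}" "{b, x} \<subseteq> A \<union> {a, b}" by auto
    then show ?thesis using 3(2) unfolding upset_def by blast
  qed
qed

lemma up_closed_two_matchings_upset: "up_closed (two_matchings E \<union> upset S)"
  unfolding up_closed_def two_matchings_def upset_def Un_iff mem_Collect_eq
  by (meson subset_trans)

text \<open>\<open>T\<close> collects the edges withheld from the sum: for empty \<open>T\<close>
  the ideal is the edge ideal, for \<open>T = E\<close> it is the ideal of two disjoint edges. The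
  induction therefore descends, from the ideal with \<open>e\<close> to the one without it. Of the
  \<open>i + 5\<close> vertices the colon by \<open>e\<close> keeps \<open>i + 3\<close>, just
  enough for the edge ideal of the colon graph.\<close>

lemma exact_at_two_matchings:
  fixes K :: "'k::comm_ring_1 itself" and E :: "'v::finite set set"
  assumes E: "simple_graph E" "gap_free E" and W: "card W \<ge> i + 5"
    and cyc: "\<And>l f. l \<le> i + 3 \<Longrightarrow> \<not> anticycle E l f"
  shows "exact_at K (two_matchings E) W i"
proof -
  have "exact_at K (two_matchings E \<union> upset (E - T)) W i" if "T \<subseteq> E" for T
    using finite[of T] that
  proof (induction T rule: finite_induct)
    case empty
    have "two_matchings E \<union> upset (E - {}) = upset E"
      unfolding two_matchings_def upset_def by blast
    moreover have "exact_at K (upset E) W i"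
      by (rule exact_at_upset_edges[OF E(1)]) (use W cyc in auto)
    ultimately show ?case by simp
  next
    case (insert e T)
    define S where "S = E - insert e T"
    have e: "e \<in> E" "e \<notin> S" "S \<subseteq> E" "E - T = insert e S"
      using insert by (auto simp: S_def)
    obtain a b where ab: "e = {a, b}" "a \<noteq> b" using e E by (metis simple_graph_def card_2_iff)
    have IH: "exact_at K (two_matchings E \<union> upset (insert e S)) W i"
      using insert.IH insert.prems e by simp
    have eq: "two_matchings E \<union> upset (insert e S) = {A. A \<in> two_matchings E \<union> upset S \<or> e \<subseteq> A}"
      by (auto simp: upset_def)
    show ?case
      unfolding S_def[symmetric]
    proof (cases "e \<subseteq> W")
      case False
      \<comment> \<open>The generator \<open>e\<close> does not divide any monomial of this strand,
        so adding it changes nothing.\<close>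
      then have "\<not> e \<subseteq> A" if "A \<subseteq> W" for A using that by blast
      then show "exact_at K (two_matchings E \<union> upset S) W i"
        using IH unfolding eq by (subst exact_at_cong[where J' = "{A. A \<in> two_matchings E \<union> upset
            S \<or> e \<subseteq> A}"]) auto
    next
      case True
      \<comment> \<open>The variables of the colon ideal: the other ends of edges in
        \<open>S\<close> that touch \<open>e\<close>, as far as they lie in
        \<open>W\<close>.\<close>
      define X where "X = {x \<in> W - e. {a, x} \<in> S \<or> {b, x} \<in> S}"
      show "exact_at K (two_matchings E \<union> upset S) W i"
      proof (rule exact_at_colon[OF up_closed_two_matchings_upset True])
        show "exact_at K {A. A \<in> two_matchings E \<union> upset S \<or> e \<subseteq> A} W i"
          using IH unfolding eq .
        have card: "card (W - e) \<ge> i + 3"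
          using True ab W by (simp add: card_Diff_subset)
        have XW: "X \<subseteq> W - e" by (auto simp: X_def)
        have "exact_at K {A. A \<in> upset (colon_graph E a b) \<or> A \<inter> X \<noteq> {}} (W - e) i"
        proof (rule exact_at_add_vars[OF finite XW])
          show "i + 2 \<le> card (W - e)" using card by simp
          assume X: "card X \<le> i"
          show "exact_at K (upset (colon_graph E a b)) (W - e - X) (i - card X)"
          proof (rule exact_at_upset_edges[OF simple_colon_graph[OF E(1)]])
            show "i - card X + 3 \<le> card (W - e - X)"
              using card X XW by (simp add: card_Diff_subset)
            show "\<not> anticycle (colon_graph E a b) l f" if "l \<le> i - card X + 3" for l f
              using anticycle_colon_graph[OF E] e(1) ab(1) cyc that by fastforce
          qed
        qed
        moreover have "A \<union> e \<in> two_matchings E \<union> upset S \<longleftrightarrow>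
            A \<in> upset (colon_graph E a b) \<or> A \<inter> X \<noteq> {}" if "A \<subseteq> W - e" for A
          using two_matchings_colon[OF E(1) e(3), of a b A] e(1,2) that ab(1)
          by (auto simp: X_def)
        ultimately show "exact_at K {A. A \<union> e \<in> two_matchings E \<union> upset S} (W - e) i"
          by (subst exact_at_cong[where J' = "{A. A \<in> upset (colon_graph E a b) \<or> A \<inter> X \<noteq> {}}"])
              auto
      qed
    qed
  qed
  from this[OF order_refl] show ?thesis by (simp add: upset_def)
qed

text \<open>Gap freeness provides an edge between two disjoint edges, which becomes the middle edge
  of a path. Conversely the two outer edges of a path are disjoint.\<close>

lemma path4_supersets:
  assumes "gap_free E" "simple_graph E"
  shows "A \<in> two_matchings E \<longleftrightarrow>
    (\<exists>a b c d. distinct [a, b, c, d] \<and> {a, b} \<in> E \<and> {b, c} \<in> E \<and> {c, d} \<in> E \<and> {a, b, c, d} \<subseteq> A)"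
    (is "_ \<longleftrightarrow> ?R")
proof
  assume "A \<in> two_matchings E"
  then obtain e e' where e: "e \<in> E" "e' \<in> E" "e \<inter> e' = {}" "e \<subseteq> A" "e' \<subseteq> A"
    by (auto simp: two_matchings_def)
  obtain u v where uv: "e = {u, v}" using e assms by (metis simple_graph_def card_2_iff)
  obtain x y where xy: "e' = {x, y}" using e assms by (metis simple_graph_def card_2_iff)
  obtain b c where bc: "b \<in> e" "c \<in> e'" "{b, c} \<in> E"
  proof -
    have "{u, v} \<in> E \<and> {x, y} \<in> E \<and> {u, v} \<inter> {x, y} = {}" using e uv xy by simp
    then have "\<exists>b\<in>{u, v}. \<exists>c\<in>{x, y}. {b, c} \<in> E"
      using assms(1) unfolding gap_free_def by meson
    then show ?thesis using that uv xy by blast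
  qed
  obtain a where a: "e = {b, a}" "a \<noteq> b" using edge_through[OF assms(2)] e(1) bc(1) by blast
  obtain d where d: "e' = {c, d}" "d \<noteq> c" using edge_through[OF assms(2)] e(2) bc(2) by blast
  have ab: "{a, b} \<in> E" using e(1) a by (simp add: insert_commute)
  have cd: "{c, d} \<in> E" using e(2) d by simp
  have "distinct [a, b, c, d]" "{a, b, c, d} \<subseteq> A" using e(3-5) a d by auto
  then show ?R using ab bc(3) cd by metis
next
  assume ?R
  then obtain a b c d where "distinct [a, b, c, d]" "{a, b} \<in> E" "{c, d} \<in> E" "{a, b, c, d} \<subseteq> A"
    by (elim exE conjE) (rule that)
  then show "A \<in> two_matchings E"
    unfolding two_matchings_def mem_Collect_eq
    by (intro bexI[of _ "{a, b}"] bexI[of _ "{c, d}"]) auto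
qed

section \<open>Comparison of graded free resolutions\<close>

lemma total_deg_eq: "total_deg m = (\<Sum>x\<in>UNIV. Poly_Mapping.lookup m x)" for m :: "'v::finite \<Rightarrow>\<^sub>0 nat"
  unfolding total_deg_def by (intro sum.mono_neutral_left) (auto simp: in_keys_iff)

lemma total_deg_add [simp]: "total_deg (a + b) = total_deg a + total_deg b" for a :: "'v::finite
    \<Rightarrow>\<^sub>0 nat"
  by (simp add: total_deg_eq lookup_add sum.distrib)

lemma homogeneous_0 [simp]: "homogeneous n 0"
  by (simp add: homogeneous_def)

lemma homogeneous_add: "homogeneous n f \<Longrightarrow> homogeneous n g \<Longrightarrow> homogeneous n (f + g)"
  using keys_add[of f g] by (auto simp: homogeneous_def)

lemma homogeneous_diff: "homogeneous n f \<Longrightarrow> homogeneous n g \<Longrightarrow> homogeneous n (f - g)"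
  by (auto simp: homogeneous_def in_keys_iff lookup_minus)

lemma homogeneous_sum: "(\<And>x. x \<in> A \<Longrightarrow> homogeneous n (f x)) \<Longrightarrow> homogeneous n (sum f A)"
  by (induction A rule: infinite_finite_induct) (auto intro: homogeneous_add)

lemma homogeneous_mult:
  fixes f :: "('v::finite, 'k::field) mpoly"
  assumes "homogeneous a f" "homogeneous b g"
  shows "homogeneous (a + b) (f * g)"
  using keys_mult[of f g] assms unfolding homogeneous_def by fastforce

lemma homogeneous_1 [simp]: "homogeneous 0 1"
  by (simp add: homogeneous_def total_deg_def)

definition hcomp :: "int \<Rightarrow> ('v, 'k::field) mpoly \<Rightarrow> ('v, 'k) mpoly"
  where "hcomp n f = (\<Sum>m\<in>{m \<in> Poly_Mapping.keys f. int (total_deg m) = n}.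
    Poly_Mapping.single m (Poly_Mapping.lookup f m))"

lemma lookup_hcomp:
  "Poly_Mapping.lookup (hcomp n f) m = (if int (total_deg m) = n then Poly_Mapping.lookup f m else
      0)"
  by (auto simp: hcomp_def lookup_sum lookup_single when_def in_keys_iff)

lemma homogeneous_hcomp: "homogeneous n (hcomp n f)"
  by (auto simp: homogeneous_def in_keys_iff lookup_hcomp split: if_splits)

lemma hcomp_add: "hcomp n (f + g) = hcomp n f + hcomp n g"
  by (rule poly_mapping_eqI) (simp add: lookup_hcomp lookup_add)

lemma hcomp_sum: "hcomp n (sum f A) = (\<Sum>x\<in>A. hcomp n (f x))"
  by (rule poly_mapping_eqI) (simp add: lookup_hcomp lookup_sum)

lemma hcomp_homogeneous: "homogeneous n f \<Longrightarrow> hcomp n f = f"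
  by (rule poly_mapping_eqI) (auto simp: lookup_hcomp homogeneous_def in_keys_iff)

lemma hcomp_mult:
  fixes f :: "('v::finite, 'k::field) mpoly"
  assumes g: "homogeneous d g"
  shows "hcomp n (f * g) = hcomp (n - d) f * g"
proof -
  define r where "r = f - hcomp (n - d) f"
  have "hcomp n (r * g) = 0"
  proof (rule poly_mapping_eqI)
    fix m
    have "int (total_deg m) \<noteq> n" if m: "m \<in> Poly_Mapping.keys (r * g)"
    proof -
      obtain a b where "a \<in> Poly_Mapping.keys r" "b \<in> Poly_Mapping.keys g" "m = a + b"
        using keys_mult[of r g] m by blast
      moreover from this have "int (total_deg a) \<noteq> n - d"
        by (auto simp: r_def in_keys_iff lookup_minus lookup_hcomp split: if_splits)
      ultimately show ?thesis using g by (auto simp: homogeneous_def)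
    qed
    then show "Poly_Mapping.lookup (hcomp n (r * g)) m = Poly_Mapping.lookup 0 m"
      by (auto simp: lookup_hcomp in_keys_iff)
  qed
  moreover have "homogeneous n (hcomp (n - d) f * g)"
    using homogeneous_mult[OF homogeneous_hcomp g, of "n - d" f] by simp
  moreover have "f * g = hcomp (n - d) f * g + r * g" by (simp add: r_def algebra_simps)
  ultimately show ?thesis by (simp add: hcomp_add hcomp_homogeneous)
qed

text \<open>The zero exponent splits only as \<open>0 + 0\<close>; thus passing to the constant
  coefficient, the reduction modulo the variables, respects products.\<close>

lemma lookup_mult_0:
  fixes f :: "('v::finite, 'k::field) mpoly"
  shows "Poly_Mapping.lookup (f * g) 0 = Poly_Mapping.lookup f 0 * Poly_Mapping.lookup g 0"
proof -
  have split: "(0 :: 'v \<Rightarrow>\<^sub>0 nat) = a + b \<longleftrightarrow> a = 0 \<and> b = 0" for a b :: "'v \<Rightarrow>\<^sub>0 nat"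
    by (auto simp: poly_mapping_eq_iff fun_eq_iff lookup_add)
  have "(\<Sum>b. Poly_Mapping.lookup g b when 0 = a + b) = (Poly_Mapping.lookup g 0 when a = 0)"
    for a :: "'v \<Rightarrow>\<^sub>0 nat"
    unfolding split by (cases "a = 0") (simp_all add: when_def flip: when_def)
  then show ?thesis by (simp add: lookup_mult mult_when)
qed

section \<open>Matrices, augmented complexes and homogeneous lifting\<close>

definition mat_act :: "nat \<Rightarrow> (nat \<Rightarrow> nat \<Rightarrow> 'a::comm_ring_1) \<Rightarrow> (nat \<Rightarrow> 'a) \<Rightarrow> nat \<Rightarrow> 'a"
  where "mat_act n \<phi> f = (\<lambda>l. \<Sum>k<n. f k * \<phi> k l)"

definition unit_vec :: "nat \<Rightarrow> nat \<Rightarrow> 'a::comm_ring_1"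
  where "unit_vec k l = (if l = k then 1 else 0)"

lemma mat_act_mat_act: "mat_act n \<phi> (mat_act m \<psi> f) = mat_act m (\<lambda>k. mat_act n \<phi> (\<psi> k)) f"
proof
  fix l
  have "mat_act n \<phi> (mat_act m \<psi> f) l = (\<Sum>k<n. \<Sum>j<m. f j * (\<psi> j k * \<phi> k l))"
    by (simp add: mat_act_def sum_distrib_right mult.assoc)
  also have "\<dots> = (\<Sum>j<m. \<Sum>k<n. f j * (\<psi> j k * \<phi> k l))"
    by (rule sum.swap)
  also have "\<dots> = mat_act m (\<lambda>k. mat_act n \<phi> (\<psi> k)) f l"
    by (simp add: mat_act_def sum_distrib_left)
  finally show "mat_act n \<phi> (mat_act m \<psi> f) l = mat_act m (\<lambda>k. mat_act n \<phi> (\<psi> k)) f l" .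
qed

lemma mat_act_cong: "(\<And>k. k < n \<Longrightarrow> \<phi> k = \<psi> k) \<Longrightarrow> mat_act n \<phi> f = mat_act n \<psi> f"
  by (simp add: mat_act_def)

lemma mat_act_diff: "mat_act n \<phi> (\<lambda>k. f k - g k) = (\<lambda>l. mat_act n \<phi> f l - mat_act n \<phi> g l)"
  by (simp add: mat_act_def left_diff_distrib sum_subtractf)

lemma mat_act_diff_matrix: "mat_act n (\<lambda>k l. \<phi> k l - \<psi> k l) f = (\<lambda>l. mat_act n \<phi> f l - mat_act n \<psi>
    f l)"
  by (simp add: mat_act_def right_diff_distrib sum_subtractf)

lemma mat_act_zero [simp]: "mat_act n \<phi> (\<lambda>_. 0) = (\<lambda>_. 0)"
  by (simp add: mat_act_def)

lemma mat_act_zero_matrix [simp]: "mat_act n (\<lambda>_ _. 0) f = (\<lambda>_. 0)"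
  by (simp add: mat_act_def)

lemma mat_act_unit_vec: "k < n \<Longrightarrow> mat_act n \<phi> (unit_vec k) = \<phi> k"
proof
  fix l assume "k < n"
  have "mat_act n \<phi> (unit_vec k) l = (\<Sum>j<n. if j = k then \<phi> k l else 0)"
    unfolding mat_act_def unit_vec_def by (intro sum.cong) auto
  then show "mat_act n \<phi> (unit_vec k) l = \<phi> k l" using \<open>k < n\<close> by simp
qed

lemma mat_act_unit_vec_matrix:
  assumes "\<And>k. k \<ge> n \<Longrightarrow> f k = 0"
  shows "mat_act n unit_vec f = f"
proof
  fix l
  have "mat_act n unit_vec f l = (\<Sum>k<n. if k = l then f l else 0)"
    unfolding mat_act_def unit_vec_def by (intro sum.cong) auto
  then show "mat_act n unit_vec f l = f l" using assms[of l] by (cases "l < n") auto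
qed

text \<open>
  The augmented complex \<open>\<dots> \<rightarrow> F\<^sub>1 \<rightarrow> F\<^sub>0 \<rightarrow> S\<close>, with \<open>S\<close> in position \<open>0\<close> and \<open>F\<^sub>i\<close> in position
  \<open>i + 1\<close>; \<open>cyc F J i\<close> are the cycles in position \<open>i\<close>, where \<open>J\<close> plays this role in position \<open>0\<close>.
\<close>

fun aug_rank :: "('v, 'k::field) graded_free_data \<Rightarrow> nat \<Rightarrow> nat"
  where "aug_rank F 0 = 1" | "aug_rank F (Suc i) = rank F i"

fun aug_shift :: "('v, 'k::field) graded_free_data \<Rightarrow> nat \<Rightarrow> nat \<Rightarrow> int"
  where "aug_shift F 0 k = 0" | "aug_shift F (Suc i) k = shift F i k"

fun aug_mat :: "('v, 'k::field) graded_free_data \<Rightarrow> nat \<Rightarrow> nat \<Rightarrow> nat \<Rightarrow> ('v, 'k) mpoly"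
  where
    "aug_mat F 0 k l = (if k < rank F 0 \<and> l = 0 then aug F k else 0)"
  | "aug_mat F (Suc i) k l = (if k < rank F (Suc i) \<and> l < rank F i then bd F i k l else 0)"

definition vecs :: "('v, 'k::field) graded_free_data \<Rightarrow> nat \<Rightarrow> (nat \<Rightarrow> ('v, 'k) mpoly) set"
  where "vecs F i = {f. \<forall>k\<ge>aug_rank F i. f k = 0}"

abbreviation aug_diff :: "('v, 'k::field) graded_free_data \<Rightarrow> nat \<Rightarrow> (nat \<Rightarrow> ('v, 'k) mpoly) \<Rightarrow> nat \<Rightarrow>
    ('v, 'k) mpoly"
  where "aug_diff F i \<equiv> mat_act (aug_rank F (Suc i)) (aug_mat F i)"

fun cyc :: "('v, 'k::field) graded_free_data \<Rightarrow> ('v, 'k) mpoly set \<Rightarrow> nat \<Rightarrow> (nat \<Rightarrow> ('v, 'k) mpoly)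
    set"
  where
    "cyc F J 0 = {f \<in> vecs F 0. f 0 \<in> J}"
  | "cyc F J (Suc i) = {f \<in> vecs F (Suc i). aug_diff F i f = (\<lambda>_. 0)}"

definition hvec :: "('v, 'k::field) graded_free_data \<Rightarrow> nat \<Rightarrow> int \<Rightarrow> (nat \<Rightarrow> ('v, 'k) mpoly) \<Rightarrow> bool"
  where "hvec F i d f \<longleftrightarrow> f \<in> vecs F i \<and> (\<forall>l. homogeneous (d - aug_shift F i l) (f l))"

lemma hvec_diff: "hvec F i d f \<Longrightarrow> hvec F i d g \<Longrightarrow> hvec F i d (\<lambda>l. f l - g l)"
  by (auto simp: hvec_def vecs_def homogeneous_diff)

lemma hvec_mat_act:
  fixes G :: "('v::finite, 'k::field) graded_free_data"
  assumes "\<And>k. k < n \<Longrightarrow> hvec G j (s k) (\<phi> k)" and "\<And>k. k < n \<Longrightarrow> homogeneous (d - s k) (f k)"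
  shows "hvec G j d (mat_act n \<phi> f)"
  unfolding hvec_def
proof (intro conjI allI)
  show "mat_act n \<phi> f \<in> vecs G j" using assms(1) by (auto simp: vecs_def hvec_def mat_act_def)
  fix l
  have "homogeneous (d - s k + (s k - aug_shift G j l)) (f k * \<phi> k l)" if "k < n" for k
    by (rule homogeneous_mult) (use assms[OF that] in \<open>auto simp: hvec_def\<close>)
  then show "homogeneous (d - aug_shift G j l) (mat_act n \<phi> f l)"
    unfolding mat_act_def by (intro homogeneous_sum) simp
qed

lemma hvec_unit_vec: "k < aug_rank F i \<Longrightarrow> hvec F i (aug_shift F i k) (unit_vec k)"
  by (auto simp: hvec_def vecs_def unit_vec_def)

lemma aug_mat_vecs: "aug_mat F i k \<in> vecs F i"
  by (cases i) (auto simp: vecs_def)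

lemma aug_diff_vecs: "aug_diff F i f \<in> vecs F i"
  using aug_mat_vecs[of F i] by (auto simp: vecs_def mat_act_def)

lemma bd_map_eq: "bd_map F i f = aug_diff F (Suc i) f"
  by (auto simp: bd_map_def mat_act_def)

lemma aug_map_eq: "aug_diff F 0 f = (\<lambda>l. if l = 0 then aug_map F f else 0)"
  by (auto simp: aug_map_def mat_act_def)

lemma free_mod_eq: "free_mod F i = vecs F (Suc i)"
  by (simp add: free_mod_def vecs_def)

locale resolution =
  fixes F :: "('v::finite, 'k::field) graded_free_data" and J :: "('v, 'k) mpoly set"
  assumes res: "graded_free_resolution F J"
begin

lemma hvec_aug_mat: "k < aug_rank F (Suc i) \<Longrightarrow> hvec F i (aug_shift F (Suc i) k) (aug_mat F i k)"
  using res by (cases i) (auto simp: hvec_def aug_mat_vecs graded_free_resolution_def)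

text \<open>All exactness conditions of a resolution in one formula; position \<open>0\<close>
  expresses that the augmentation has image \<open>J\<close>. This lets the inductions below start
  at the ring itself.\<close>

lemma cyc_eq: "cyc F J i = aug_diff F i ` vecs F (Suc i)"
proof (cases i)
  case 0
  have *: "aug_map F ` vecs F (Suc 0) = J"
    using res unfolding graded_free_resolution_def free_mod_eq by blast
  have "f \<in> aug_diff F 0 ` vecs F (Suc 0)" if "f \<in> vecs F 0" "f 0 \<in> J" for f
  proof -
    obtain g where "g \<in> vecs F (Suc 0)" "f 0 = aug_map F g" using * \<open>f 0 \<in> J\<close> by blast
    then show ?thesis using that(1) by (intro image_eqI[of _ _ g]) (auto simp: aug_map_eq vecs_def
        simp del: aug_mat.simps aug_rank.simps(2))
  qed
  moreover have "aug_map F g \<in> J" if "g \<in> vecs F (Suc 0)" for g using * that by blast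
  moreover have "aug_diff F 0 g 0 = aug_map F g" for g
    using fun_cong[OF aug_map_eq, of F g 0] by simp
  ultimately show ?thesis
    unfolding 0 cyc.simps using aug_diff_vecs[of F 0] by (auto simp del: aug_mat.simps
        aug_rank.simps)
next
  case (Suc i')
  show ?thesis
  proof (cases i')
    case 0
    have "{f \<in> vecs F (Suc 0). aug_map F f = 0} = aug_diff F (Suc 0) ` vecs F (Suc (Suc 0))"
      using res unfolding graded_free_resolution_def free_mod_eq bd_map_eq by simp
    moreover have "aug_map F f = 0 \<longleftrightarrow> aug_diff F 0 f = (\<lambda>_. 0)" for f
      unfolding aug_map_eq by (auto simp: fun_eq_iff)
    ultimately show ?thesis unfolding Suc 0 cyc.simps by simp
  next
    case (Suc n)
    then show ?thesis
      using res \<open>i = Suc i'\<close> unfolding graded_free_resolution_def free_mod_eq bd_map_eq by auto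
  qed
qed

lemma aug_mat_cyc: "k < aug_rank F (Suc i) \<Longrightarrow> aug_mat F i k \<in> cyc F J i"
  unfolding cyc_eq
  by (rule image_eqI[of _ _ "unit_vec k"]) (use hvec_unit_vec[of k F "Suc i"] in \<open>auto simp:
      mat_act_unit_vec hvec_def simp del: aug_rank.simps\<close>)

text \<open>Exactness yields some preimage. As the differential is graded, keeping only the
  components of the right degree still gives a preimage.\<close>

lemma lift:
  assumes "y \<in> cyc F J i" "hvec F i d y"
  shows "\<exists>x. hvec F (Suc i) d x \<and> aug_diff F i x = y"
proof -
  obtain x where x: "x \<in> vecs F (Suc i)" "y = aug_diff F i x" using assms cyc_eq by blast
  define x' where "x' k = hcomp (d - aug_shift F (Suc i) k) (x k)" for k
  have "hcomp n 0 = 0" for n by (rule hcomp_homogeneous) simp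
  then have "hvec F (Suc i) d x'"
    using x(1) by (auto simp: hvec_def vecs_def x'_def homogeneous_hcomp)
  moreover have "aug_diff F i x' l = y l" for l
  proof -
    have "aug_diff F i x' l = (\<Sum>k<aug_rank F (Suc i). hcomp (d - aug_shift F i l) (x k * aug_mat F
        i k l))"
      unfolding mat_act_def
    proof (intro sum.cong refl)
      fix k assume "k \<in> {..<aug_rank F (Suc i)}"
      then have "homogeneous (aug_shift F (Suc i) k - aug_shift F i l) (aug_mat F i k l)"
        using hvec_aug_mat[of k i] by (simp add: hvec_def del: aug_shift.simps aug_rank.simps)
      from hcomp_mult[OF this, of "d - aug_shift F i l" "x k"]
      show "x' k * aug_mat F i k l = hcomp (d - aug_shift F i l) (x k * aug_mat F i k l)"
        by (simp add: x'_def del: aug_shift.simps)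
    qed
    also have "\<dots> = hcomp (d - aug_shift F i l) (y l)"
      by (simp add: x(2) mat_act_def hcomp_sum del: aug_rank.simps)
    also have "\<dots> = y l" using assms(2) by (simp add: hvec_def hcomp_homogeneous)
    finally show ?thesis .
  qed
  ultimately show ?thesis by blast
qed

text \<open>A graded chain endomorphism that kills \<open>J\<close> is null-homotopic. The
  construction starts with the zero map in position \<open>0\<close>; only two consecutive homotopy
  maps are returned, as one homotopy equation is all that is used later.\<close>

lemma homotopy:
  assumes \<theta>_hvec: "\<And>i k. k < aug_rank F i \<Longrightarrow> hvec F i (aug_shift F i k) (\<theta> i k)"
    and \<theta>_comm: "\<And>i k. k < aug_rank F (Suc i) \<Longrightarrow> aug_diff F i (\<theta> (Suc i) k) = mat_act (aug_rank F
        i) (\<theta> i) (aug_mat F i k)"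
    and \<theta>_0: "\<And>f. f \<in> cyc F J 0 \<Longrightarrow> mat_act (aug_rank F 0) (\<theta> 0) f = (\<lambda>_. 0)"
  shows "\<exists>h h'. (\<forall>k<aug_rank F i. hvec F (Suc i) (aug_shift F i k) (h k)) \<and>
    (\<forall>k<aug_rank F (Suc i). hvec F (Suc (Suc i)) (aug_shift F (Suc i) k) (h' k)) \<and>
    (\<forall>k<aug_rank F (Suc i). aug_diff F (Suc i) (h' k) = (\<lambda>l. \<theta> (Suc i) k l - mat_act (aug_rank F
        i) h (aug_mat F i k) l))"
proof -
  \<comment> \<open>The homotopy equation restricted to cycles, where its second term disappears. It
    is the invariant needed to go on: it makes the right-hand side of the next equation a cycle on
    each basis vector.\<close>
  let ?Q = "\<lambda>i h. (\<forall>k<aug_rank F i. hvec F (Suc i) (aug_shift F i k) (h k)) \<and>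
    (\<forall>f\<in>cyc F J i. aug_diff F i (mat_act (aug_rank F i) h f) = mat_act (aug_rank F i) (\<theta> i) f)"
  have step: "\<exists>h'. (\<forall>k<aug_rank F (Suc i). hvec F (Suc (Suc i)) (aug_shift F (Suc i) k) (h' k)) \<and>
    (\<forall>k<aug_rank F (Suc i). aug_diff F (Suc i) (h' k) = (\<lambda>l. \<theta> (Suc i) k l - mat_act (aug_rank F
        i) h (aug_mat F i k) l))"
    if h: "?Q i h" for i h
  proof -
    have "\<exists>x. hvec F (Suc (Suc i)) (aug_shift F (Suc i) k) x \<and>
        aug_diff F (Suc i) x = (\<lambda>l. \<theta> (Suc i) k l - mat_act (aug_rank F i) h (aug_mat F i k) l)"
      if k: "k < aug_rank F (Suc i)" for k
    proof (rule lift)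
      let ?t = "\<lambda>l. \<theta> (Suc i) k l - mat_act (aug_rank F i) h (aug_mat F i k) l"
      have "hvec F (Suc i) (aug_shift F (Suc i) k) (mat_act (aug_rank F i) h (aug_mat F i k))"
        using h hvec_aug_mat[OF k] by (intro hvec_mat_act[where s = "aug_shift F i"]) (auto simp:
            hvec_def)
      then show t: "hvec F (Suc i) (aug_shift F (Suc i) k) ?t"
        using \<theta>_hvec[OF k] by (intro hvec_diff)
      have "aug_diff F i ?t = (\<lambda>_. 0)"
        unfolding mat_act_diff using \<theta>_comm[OF k] h aug_mat_cyc[OF k] by simp
      then show "?t \<in> cyc F J (Suc i)" using t by (simp add: hvec_def)
    qed
    then show ?thesis by metis
  qed
  have "\<exists>h. ?Q i h" for i
  proof (induction i)
    case 0
    show ?case using \<theta>_0 by (intro exI[of _ "\<lambda>_ _. 0"]) (auto simp: hvec_def vecs_def)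
  next
    case (Suc i)
    then obtain h where h: "?Q i h" by blast
    from step[OF h] obtain h' where h':
      "\<forall>k<aug_rank F (Suc i). hvec F (Suc (Suc i)) (aug_shift F (Suc i) k) (h' k)"
      "\<forall>k<aug_rank F (Suc i). aug_diff F (Suc i) (h' k) = (\<lambda>l. \<theta> (Suc i) k l - mat_act (aug_rank F
          i) h (aug_mat F i k) l)"
      by blast
    have "aug_diff F (Suc i) (mat_act (aug_rank F (Suc i)) h' f) = mat_act (aug_rank F (Suc i)) (\<theta>
        (Suc i)) f"
      if f: "f \<in> cyc F J (Suc i)" for f
    proof -
      have "aug_diff F (Suc i) (mat_act (aug_rank F (Suc i)) h' f) =
          mat_act (aug_rank F (Suc i)) (\<lambda>k l. \<theta> (Suc i) k l - mat_act (aug_rank F i) h (aug_mat F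
              i k) l) f"
        unfolding mat_act_mat_act by (rule mat_act_cong) (use h'(2) in blast)
      also have "\<dots> = (\<lambda>l. mat_act (aug_rank F (Suc i)) (\<theta> (Suc i)) f l - mat_act (aug_rank F i) h
          (aug_diff F i f) l)"
        unfolding mat_act_diff_matrix mat_act_mat_act ..
      finally show ?thesis using f by simp
    qed
    then show ?case using h'(1) by blast
  qed
  then obtain h where h: "?Q i h" by blast
  from step[OF h] obtain h' where
    "\<forall>k<aug_rank F (Suc i). hvec F (Suc (Suc i)) (aug_shift F (Suc i) k) (h' k)"
    "\<forall>k<aug_rank F (Suc i). aug_diff F (Suc i) (h' k) = (\<lambda>l. \<theta> (Suc i) k l - mat_act (aug_rank F
        i) h (aug_mat F i k) l)"
    by blast
  then show ?thesis using h by (intro exI[of _ h] exI[of _ h'] conjI) simp_all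
qed

end

text \<open>The identity of the ring is lifted one position at a time. Maps are given by images of
  basis vectors, so homogeneity has to be ensured only there.\<close>

lemma comparison_map:
  fixes F G :: "('v::finite, 'k::field) graded_free_data"
  assumes "graded_free_resolution F J" "graded_free_resolution G J"
  shows "\<exists>\<phi>. \<phi> 0 = unit_vec \<and> (\<forall>i. (\<forall>k<aug_rank F i. hvec G i (aug_shift F i k) (\<phi> i k)) \<and>
    (\<forall>k<aug_rank F (Suc i). aug_diff G i (\<phi> (Suc i) k) = mat_act (aug_rank F i) (\<phi> i) (aug_mat F i
        k)))"
proof -
  interpret F: resolution F J by unfold_locales fact
  interpret G: resolution G J by unfold_locales fact
  \<comment> \<open>Besides the degrees, \<open>P\<close> records that cycles go to cycles, which is
    what permits the next lifting; \<open>Q\<close> links neighbouring choices.\<close>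
  define P where "P i \<phi> \<longleftrightarrow> (i = 0 \<longrightarrow> \<phi> = unit_vec) \<and> (\<forall>k<aug_rank F i. hvec G i (aug_shift F i k) (\<phi>
      k)) \<and>
    (\<forall>f\<in>cyc F J i. mat_act (aug_rank F i) \<phi> f \<in> cyc G J i)" for i \<phi>
  define Q where "Q i \<phi> \<phi>' \<longleftrightarrow>
    (\<forall>k<aug_rank F (Suc i). aug_diff G i (\<phi>' k) = mat_act (aug_rank F i) \<phi> (aug_mat F i k))" for i
        \<phi> \<phi>'
  have "\<exists>\<phi>. \<forall>i. P i (\<phi> i) \<and> Q i (\<phi> i) (\<phi> (Suc i))"
  proof (rule dependent_nat_choice)
    have "mat_act (Suc 0) unit_vec f = f" if "f \<in> vecs F 0" for f
      using that by (intro mat_act_unit_vec_matrix) (auto simp: vecs_def)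
    then show "\<exists>\<phi>. P 0 \<phi>"
      by (auto simp: P_def vecs_def hvec_def unit_vec_def)
  next
    fix \<phi> i assume P: "P i \<phi>"
    have "\<exists>x. hvec G (Suc i) (aug_shift F (Suc i) k) x \<and> aug_diff G i x = mat_act (aug_rank F i) \<phi>
        (aug_mat F i k)"
      if k: "k < aug_rank F (Suc i)" for k
    proof (rule G.lift)
      show "mat_act (aug_rank F i) \<phi> (aug_mat F i k) \<in> cyc G J i"
        using P F.aug_mat_cyc[OF k] by (auto simp: P_def)
      show "hvec G i (aug_shift F (Suc i) k) (mat_act (aug_rank F i) \<phi> (aug_mat F i k))"
        using P F.hvec_aug_mat[OF k] by (intro hvec_mat_act[where s = "aug_shift F i"]) (auto
            simp: P_def hvec_def)
    qed
    then obtain \<phi>' where \<phi>': "\<And>k. k < aug_rank F (Suc i) \<Longrightarrow> hvec G (Suc i) (aug_shift F (Suc i) k)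
        (\<phi>' k)"
      "\<And>k. k < aug_rank F (Suc i) \<Longrightarrow> aug_diff G i (\<phi>' k) = mat_act (aug_rank F i) \<phi> (aug_mat F i
          k)" by metis
    have "mat_act (aug_rank F (Suc i)) \<phi>' f \<in> cyc G J (Suc i)" if f: "f \<in> cyc F J (Suc i)" for f
    proof -
      have "aug_diff G i (mat_act (aug_rank F (Suc i)) \<phi>' f) = mat_act (aug_rank F i) \<phi> (aug_diff
          F i f)"
        unfolding mat_act_mat_act by (rule mat_act_cong) (use \<phi>'(2) in blast)
      also have "\<dots> = (\<lambda>_. 0)" using f by simp
      finally have "aug_diff G i (mat_act (aug_rank F (Suc i)) \<phi>' f) = (\<lambda>_. 0)" .
      moreover have "mat_act (aug_rank F (Suc i)) \<phi>' f \<in> vecs G (Suc i)"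
        using \<phi>'(1) by (auto simp: hvec_def vecs_def mat_act_def)
      ultimately show ?thesis by simp
    qed
    then have "P (Suc i) \<phi>'" unfolding P_def using \<phi>'(1) by auto
    moreover have "Q i \<phi> \<phi>'" unfolding Q_def using \<phi>'(2) by auto
    ultimately show "\<exists>\<phi>'. P (Suc i) \<phi>' \<and> Q i \<phi> \<phi>'" by blast
  qed
  then obtain \<phi> where \<phi>: "\<And>i. P i (\<phi> i)" "\<And>i. Q i (\<phi> i) (\<phi> (Suc i))" by blast
  have 0: "\<phi> 0 = unit_vec" using \<phi>(1)[of 0] unfolding P_def by (elim conjE) (erule mp, rule refl)
  have 1: "\<forall>k<aug_rank F i. hvec G i (aug_shift F i k) (\<phi> i k)" for i
    using \<phi>(1)[of i] unfolding P_def by (elim conjE)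
  have 2: "\<forall>k<aug_rank F (Suc i). aug_diff G i (\<phi> (Suc i) k) = mat_act (aug_rank F i) (\<phi> i)
      (aug_mat F i k)" for i
    using \<phi>(2)[of i] unfolding Q_def .
  show ?thesis by (rule exI[of _ \<phi>]) (rule conjI[OF 0 allI[OF conjI[OF 1 2]]])
qed

section \<open>Reduction modulo the variables and independence of Tor\<close>

abbreviation const_mat :: "(nat \<Rightarrow> nat \<Rightarrow> ('v, 'k::field) mpoly) \<Rightarrow> nat \<Rightarrow> nat \<Rightarrow> 'k"
  where "const_mat \<phi> \<equiv> \<lambda>k l. Poly_Mapping.lookup (\<phi> k l) 0"

lemma const_mat_mat_act:
  fixes \<phi> :: "nat \<Rightarrow> nat \<Rightarrow> ('v::finite, 'k::field) mpoly"
  shows "(\<lambda>l. Poly_Mapping.lookup (mat_act n \<phi> f l) 0) = mat_act n (const_mat \<phi>) (\<lambda>k.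
      Poly_Mapping.lookup (f k) 0)"
  by (simp add: mat_act_def lookup_sum lookup_mult_0)

lemma bd_K_eq: "bd_K F i c = mat_act (rank F (Suc i)) (const_mat (aug_mat F (Suc i))) c"
  by (auto simp: bd_K_def mat_act_def)

lemma bd_K_diff: "bd_K F i (\<lambda>k. c k - c' k) = (\<lambda>l. bd_K F i c l - bd_K F i c' l)"
  unfolding bd_K_eq by (rule mat_act_diff)

lemma const_coeff_hvec:
  assumes "hvec F i d f" "Poly_Mapping.lookup (f l) 0 \<noteq> 0"
  shows "l < aug_rank F i" "aug_shift F i l = d"
proof -
  have "f l \<noteq> 0" using assms(2) by auto
  then show "l < aug_rank F i" using assms(1) unfolding hvec_def vecs_def by (metis (mono_tags,
      lifting) mem_Collect_eq not_le)
  have "0 \<in> Poly_Mapping.keys (f l)" using assms(2) by (simp add: in_keys_iff)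
  then have "int (total_deg (0 :: 'a \<Rightarrow>\<^sub>0 nat)) = d - aug_shift F i l"
    using assms(1) unfolding hvec_def homogeneous_def by blast
  then show "aug_shift F i l = d" by (simp add: total_deg_def)
qed

lemma mat_act_tensor_K:
  assumes "\<And>k. k < rank F i \<Longrightarrow> hvec G (Suc i') (shift F i k) (\<phi> k)" "c \<in> tensor_K F i j"
  shows "mat_act (rank F i) (const_mat \<phi>) c \<in> tensor_K G i' j"
  unfolding tensor_K_def
proof (intro CollectI allI impI)
  fix l assume "mat_act (rank F i) (const_mat \<phi>) c l \<noteq> 0"
  then obtain k where k: "k < rank F i" "c k * const_mat \<phi> k l \<noteq> 0"
    unfolding mat_act_def by (metis (no_types, lifting) lessThan_iff sum.neutral)
  then have "shift F i k = j" using assms(2) by (auto simp: tensor_K_def)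
  then show "l < rank G i' \<and> shift G i' l = j"
    using const_coeff_hvec[OF assms(1)[OF k(1)], of l] k(2) by auto
qed

text \<open>Compare \<open>R\<close> with the witness \<open>F\<close> of \<open>tor_zero\<close> in
  both directions. The image of a cycle \<open>z\<close> in \<open>F\<close> bounds, and returning
  to \<open>R\<close> changes \<open>z\<close> only by a boundary, because the round trip is
  homotopic to the identity.\<close>

theorem tor_zero_imp_cycles_subset_boundaries:
  fixes R :: "('v::finite, 'k::field) graded_free_data"
  assumes R: "graded_free_resolution R J" and tor: "tor_zero J (Suc i) j"
  shows "cycles_K R (Suc i) j \<subseteq> boundaries_K R (Suc i) j"
proof
  obtain F where F: "graded_free_resolution F J" "cycles_K F (Suc i) j = boundaries_K F (Suc i) j"
    using tor by (auto simp: tor_zero_def)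
  interpret R: resolution R J by unfold_locales fact
  obtain \<phi> where \<phi>0: "\<phi> 0 = unit_vec"
    and \<phi>_hvec: "\<And>i k. k < aug_rank R i \<Longrightarrow> hvec F i (aug_shift R i k) (\<phi> i k)"
    and \<phi>_comm: "\<And>i k. k < aug_rank R (Suc i) \<Longrightarrow> aug_diff F i (\<phi> (Suc i) k) = mat_act (aug_rank R
        i) (\<phi> i) (aug_mat R i k)"
    using comparison_map[OF R F(1)] by blast
  obtain \<psi> where \<psi>0: "\<psi> 0 = unit_vec"
    and \<psi>_hvec: "\<And>i k. k < aug_rank F i \<Longrightarrow> hvec R i (aug_shift F i k) (\<psi> i k)"
    and \<psi>_comm: "\<And>i k. k < aug_rank F (Suc i) \<Longrightarrow> aug_diff R i (\<psi> (Suc i) k) = mat_act (aug_rank F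
        i) (\<psi> i) (aug_mat F i k)"
    using comparison_map[OF F(1) R] by blast
  define \<theta> where "\<theta> i k = (\<lambda>l. mat_act (aug_rank F i) (\<psi> i) (\<phi> i k) l - unit_vec k l)" for i k
  \<comment> \<open>Augmented positions are shifted by one: homology in position
    \<open>Suc i\<close> of \<open>R\<close> sits at \<open>Suc (Suc i)\<close> here, and its
    homotopy equation involves \<open>h\<close> from the position before and \<open>h'\<close> from
    this one.\<close>
  have "\<exists>h h'. (\<forall>k<aug_rank R (Suc i). hvec R (Suc (Suc i)) (aug_shift R (Suc i) k) (h k)) \<and>
    (\<forall>k<aug_rank R (Suc (Suc i)). hvec R (Suc (Suc (Suc i))) (aug_shift R (Suc (Suc i)) k) (h' k)) \<and>
    (\<forall>k<aug_rank R (Suc (Suc i)). aug_diff R (Suc (Suc i)) (h' k) =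
      (\<lambda>l. \<theta> (Suc (Suc i)) k l - mat_act (aug_rank R (Suc i)) h (aug_mat R (Suc i) k) l))"
  proof (rule R.homotopy)
    fix i k assume k: "k < aug_rank R i"
    have "hvec R i (aug_shift R i k) (mat_act (aug_rank F i) (\<psi> i) (\<phi> i k))"
      using \<psi>_hvec \<phi>_hvec[OF k] by (intro hvec_mat_act[where s = "aug_shift F i"]) (auto simp:
          hvec_def)
    then show "hvec R i (aug_shift R i k) (\<theta> i k)"
      unfolding \<theta>_def using hvec_unit_vec[OF k] by (rule hvec_diff)
  next
    fix i k assume k: "k < aug_rank R (Suc i)"
    have "aug_diff R i (mat_act (aug_rank F (Suc i)) (\<psi> (Suc i)) (\<phi> (Suc i) k)) =
        mat_act (aug_rank F i) (\<psi> i) (aug_diff F i (\<phi> (Suc i) k))"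
      unfolding mat_act_mat_act by (rule mat_act_cong) (rule \<psi>_comm)
    also have "\<dots> = mat_act (aug_rank F i) (\<psi> i) (mat_act (aug_rank R i) (\<phi> i) (aug_mat R i k))"
      by (simp only: \<phi>_comm[OF k])
    also have "\<dots> = mat_act (aug_rank R i) (\<lambda>k. mat_act (aug_rank F i) (\<psi> i) (\<phi> i k)) (aug_mat R i
        k)"
      by (rule mat_act_mat_act)
    finally have *: "aug_diff R i (mat_act (aug_rank F (Suc i)) (\<psi> (Suc i)) (\<phi> (Suc i) k)) = \<dots>" .
    have "aug_mat R i k = mat_act (aug_rank R i) unit_vec (aug_mat R i k)"
      using aug_mat_vecs[of R i k] by (intro mat_act_unit_vec_matrix[symmetric]) (auto simp:
          vecs_def)
    then show "aug_diff R i (\<theta> (Suc i) k) = mat_act (aug_rank R i) (\<theta> i) (aug_mat R i k)"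
      unfolding \<theta>_def mat_act_diff mat_act_diff_matrix * mat_act_unit_vec[OF k] by simp
  next
    fix f assume "f \<in> cyc R J 0"
    have "mat_act (aug_rank F 0) (\<psi> 0) (\<phi> 0 k) = unit_vec k" if "k < aug_rank R 0" for k
      unfolding \<phi>0 \<psi>0 using that by (intro mat_act_unit_vec_matrix) (auto simp: unit_vec_def)
    then have "\<theta> 0 k = (\<lambda>_. 0)" if "k < aug_rank R 0" for k using that by (simp add: \<theta>_def)
    then show "mat_act (aug_rank R 0) (\<theta> 0) f = (\<lambda>_. 0)" by (simp add: mat_act_def)
  qed
  then obtain h h' where
    h': "\<And>k. k < aug_rank R (Suc (Suc i)) \<Longrightarrow> hvec R (Suc (Suc (Suc i))) (aug_shift R (Suc (Suc i))
        k) (h' k)"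
    and hh': "\<And>k. k < aug_rank R (Suc (Suc i)) \<Longrightarrow> aug_diff R (Suc (Suc i)) (h' k) =
      (\<lambda>l. \<theta> (Suc (Suc i)) k l - mat_act (aug_rank R (Suc i)) h (aug_mat R (Suc i) k) l)" by blast
  fix z assume "z \<in> cycles_K R (Suc i) j"
  then have z: "z \<in> tensor_K R (Suc i) j" "bd_K R i z = (\<lambda>_. 0)" by auto
  let ?\<phi> = "mat_act (rank R (Suc i)) (const_mat (\<phi> (Suc (Suc i))))"
  have "bd_K F i (?\<phi> z) = mat_act (rank R (Suc i)) (\<lambda>k. mat_act (rank F (Suc i)) (const_mat
      (aug_mat F (Suc i))) (const_mat (\<phi> (Suc (Suc i))) k)) z"
    unfolding bd_K_eq by (rule mat_act_mat_act)
  also have "\<dots> = mat_act (rank R (Suc i)) (\<lambda>k. mat_act (rank R i) (const_mat (\<phi> (Suc i)))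
      (const_mat (aug_mat R (Suc i)) k)) z"
  proof (rule mat_act_cong)
    fix k assume "k < rank R (Suc i)"
    then have "aug_diff F (Suc i) (\<phi> (Suc (Suc i)) k) = mat_act (aug_rank R (Suc i)) (\<phi> (Suc i))
        (aug_mat R (Suc i) k)"
      by (intro \<phi>_comm) simp
    then show "mat_act (rank F (Suc i)) (const_mat (aug_mat F (Suc i))) (const_mat (\<phi> (Suc (Suc
        i))) k) =
        mat_act (rank R i) (const_mat (\<phi> (Suc i))) (const_mat (aug_mat R (Suc i)) k)"
      unfolding const_mat_mat_act[symmetric] aug_rank.simps by (simp del: aug_mat.simps)
  qed
  also have "\<dots> = mat_act (rank R i) (const_mat (\<phi> (Suc i))) (bd_K R i z)"
    unfolding bd_K_eq by (rule mat_act_mat_act[symmetric])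
  also have "\<dots> = (\<lambda>_. 0)" by (simp add: z(2))
  finally have "bd_K F i (?\<phi> z) = (\<lambda>_. 0)" .
  moreover have "?\<phi> z \<in> tensor_K F (Suc i) j"
    using z(1) \<phi>_hvec[of _ "Suc (Suc i)"] by (intro mat_act_tensor_K) auto
  ultimately have "?\<phi> z \<in> boundaries_K F (Suc i) j" using F(2) by auto
  then obtain y where y: "y \<in> tensor_K F (Suc (Suc i)) j" "?\<phi> z = bd_K F (Suc i) y"
    by (auto simp: boundaries_K_def)
  \<comment> \<open>With \<open>y\<close> filling the image of \<open>z\<close>, the filling of
    \<open>z\<close> is \<open>x1\<close>, the image of \<open>y\<close>, corrected by
    \<open>x2\<close> from the homotopy. The term through \<open>h\<close> drops out since
    \<open>z\<close> is a cycle.\<close>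
  define x1 where "x1 = mat_act (rank F (Suc (Suc i))) (const_mat (\<psi> (Suc (Suc (Suc i))))) y"
  define x2 where "x2 = mat_act (rank R (Suc i)) (const_mat h') z"
  have "bd_K R (Suc i) x1 = mat_act (rank F (Suc (Suc i))) (\<lambda>k. mat_act (rank R (Suc (Suc i)))
      (const_mat (aug_mat R (Suc (Suc i)))) (const_mat (\<psi> (Suc (Suc (Suc i)))) k)) y"
    unfolding bd_K_eq x1_def by (rule mat_act_mat_act)
  also have "\<dots> = mat_act (rank F (Suc (Suc i))) (\<lambda>k. mat_act (rank F (Suc i)) (const_mat (\<psi> (Suc
      (Suc i))))
      (const_mat (aug_mat F (Suc (Suc i))) k)) y"
  proof (rule mat_act_cong)
    fix k assume "k < rank F (Suc (Suc i))"
    then have "aug_diff R (Suc (Suc i)) (\<psi> (Suc (Suc (Suc i))) k) =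
        mat_act (aug_rank F (Suc (Suc i))) (\<psi> (Suc (Suc i))) (aug_mat F (Suc (Suc i)) k)"
      by (intro \<psi>_comm) simp
    then show "mat_act (rank R (Suc (Suc i))) (const_mat (aug_mat R (Suc (Suc i)))) (const_mat (\<psi>
        (Suc (Suc (Suc i)))) k) =
        mat_act (rank F (Suc i)) (const_mat (\<psi> (Suc (Suc i)))) (const_mat (aug_mat F (Suc (Suc
            i))) k)"
      unfolding const_mat_mat_act[symmetric] aug_rank.simps by (simp del: aug_mat.simps)
  qed
  also have "\<dots> = mat_act (rank F (Suc i)) (const_mat (\<psi> (Suc (Suc i)))) (?\<phi> z)"
    unfolding y(2) bd_K_eq by (rule mat_act_mat_act[symmetric])
  finally have x1: "bd_K R (Suc i) x1 = mat_act (rank F (Suc i)) (const_mat (\<psi> (Suc (Suc i)))) (?\<phi>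
      z)" .
  have unit: "(\<lambda>l. Poly_Mapping.lookup (unit_vec k l :: ('v, 'k) mpoly) 0) = unit_vec k" for k
    by (auto simp: unit_vec_def)
  have "bd_K R (Suc i) x2 = mat_act (rank R (Suc i)) (\<lambda>k. mat_act (rank R (Suc (Suc i)))
      (const_mat (aug_mat R (Suc (Suc i)))) (const_mat h' k)) z"
    unfolding bd_K_eq x2_def by (rule mat_act_mat_act)
  also have "\<dots> = mat_act (rank R (Suc i)) (\<lambda>k l. mat_act (rank F (Suc i)) (const_mat (\<psi> (Suc (Suc
      i)))) (const_mat (\<phi> (Suc (Suc i))) k) l
      - unit_vec k l - mat_act (rank R i) (const_mat h) (const_mat (aug_mat R (Suc i)) k) l) z"
  proof (rule mat_act_cong)
    fix k assume "k < rank R (Suc i)"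
    then have "aug_diff R (Suc (Suc i)) (h' k) =
        (\<lambda>l. \<theta> (Suc (Suc i)) k l - mat_act (aug_rank R (Suc i)) h (aug_mat R (Suc i) k) l)"
      by (intro hh') simp
    then show "mat_act (rank R (Suc (Suc i))) (const_mat (aug_mat R (Suc (Suc i)))) (const_mat h'
        k) =
      (\<lambda>l. mat_act (rank F (Suc i)) (const_mat (\<psi> (Suc (Suc i)))) (const_mat (\<phi> (Suc (Suc i))) k) l
      - unit_vec k l - mat_act (rank R i) (const_mat h) (const_mat (aug_mat R (Suc i)) k) l)"
      unfolding const_mat_mat_act[symmetric] unit[symmetric] aug_rank.simps by (simp add: \<theta>_def
          lookup_minus del: aug_mat.simps)
  qed
  also have "\<dots> = (\<lambda>l. mat_act (rank F (Suc i)) (const_mat (\<psi> (Suc (Suc i)))) (?\<phi> z) l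
      - mat_act (rank R (Suc i)) unit_vec z l - mat_act (rank R i) (const_mat h) (bd_K R i z) l)"
    unfolding mat_act_diff_matrix mat_act_mat_act bd_K_eq ..
  also have "mat_act (rank R (Suc i)) unit_vec z = z"
    using z(1) by (intro mat_act_unit_vec_matrix) (force simp: tensor_K_def)
  finally have "z = bd_K R (Suc i) (\<lambda>l. x1 l - x2 l)"
    using x1 by (simp add: bd_K_diff z(2) fun_eq_iff)
  moreover have "(\<lambda>l. x1 l - x2 l) \<in> tensor_K R (Suc (Suc i)) j"
  proof -
    have "x1 \<in> tensor_K R (Suc (Suc i)) j" unfolding x1_def
      using y(1) \<psi>_hvec[of _ "Suc (Suc (Suc i))"] by (intro mat_act_tensor_K) auto
    moreover have "x2 \<in> tensor_K R (Suc (Suc i)) j" unfolding x2_def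
      using z(1) h' by (intro mat_act_tensor_K) auto
    ultimately show ?thesis unfolding tensor_K_def mem_Collect_eq by (metis diff_self)
  qed
  ultimately show "z \<in> boundaries_K R (Suc i) j" by (auto simp: boundaries_K_def)
qed

section \<open>The squarefree Koszul resolution\<close>

text \<open>
  The pair \<open>(F, G)\<close> stands for \<open>e\<^sub>F \<otimes> x\<^sup>G\<close>, which is sent to the sum of
  \<open>\<plusminus> (x e\<^sub>F\<^sub>-\<^sub>x \<otimes> x\<^sup>G - e\<^sub>F\<^sub>-\<^sub>x \<otimes> x\<^sup>G\<^sup>+\<^sup>x)\<close> over \<open>x \<in> F\<close>; here the variable \<open>x\<close> is set to \<open>1\<close>.
\<close>

definition pair_bdry :: "('v::finite set \<Rightarrow> 'v set \<Rightarrow> 'k::comm_ring_1) \<Rightarrow> 'v set \<Rightarrow> 'v set \<Rightarrow> 'k"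
  where "pair_bdry z F G = (\<Sum>x\<in>- F. pos_sign F x *
    (if x \<in> G then - z (insert x F) (G - {x}) else z (insert x F) G))"

definition pchain :: "'v set set \<Rightarrow> 'v set \<Rightarrow> nat \<Rightarrow> ('v set \<Rightarrow> 'v set \<Rightarrow> 'a::zero) \<Rightarrow> bool"
  where "pchain J U i z \<longleftrightarrow>
    (\<forall>F G. z F G \<noteq> 0 \<longrightarrow> F \<inter> G = {} \<and> F \<union> G \<subseteq> U \<and> card F = i \<and> G \<in> J)"

lemma pchainD:
  assumes "pchain J U i z" "z F G \<noteq> 0"
  shows "F \<inter> G = {} \<and> F \<union> G \<subseteq> U \<and> card F = i \<and> G \<in> J"
  using assms by (simp add: pchain_def)

lemma pair_bdry_nonzeroE:
  assumes "pair_bdry z F G \<noteq> 0"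
  obtains x where "x \<notin> F" "x \<in> G" "z (insert x F) (G - {x}) \<noteq> 0"
  | x where "x \<notin> F" "x \<notin> G" "z (insert x F) G \<noteq> 0"
proof -
  obtain x where x: "x \<in> - F" "pos_sign F x * (if x \<in> G then - z (insert x F) (G - {x}) else z
      (insert x F) G) \<noteq> 0"
    using assms unfolding pair_bdry_def by (rule sum.not_neutral_contains_not_neutral)
  have "(if x \<in> G then - z (insert x F) (G - {x}) else z (insert x F) G) \<noteq> 0"
    using x(2) by (metis mult_zero_right)
  then show ?thesis using that x(1) by (cases "x \<in> G") auto
qed

lemma pair_bdry_diff: "pair_bdry (\<lambda>F G. a F G - b F G) F G = pair_bdry a F G - pair_bdry b F G"
  unfolding pair_bdry_def sum_subtractf[symmetric] by (intro sum.cong) (auto simp: algebra_simps)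

lemma pair_bdry_add: "pair_bdry (\<lambda>F G. a F G + b F G) F G = pair_bdry a F G + pair_bdry b F G"
  unfolding pair_bdry_def sum.distrib[symmetric] by (intro sum.cong) (auto simp: algebra_simps)

lemma pair_bdry_zero [simp]: "pair_bdry (\<lambda>_ _. 0) F G = 0"
  by (auto simp: pair_bdry_def intro!: sum.neutral)

lemma pair_bdry_pair_bdry [simp]:
  fixes z :: "'v::finite set \<Rightarrow> 'v set \<Rightarrow> 'k::comm_ring_1"
  shows "pair_bdry (pair_bdry z) F G = 0"
proof -
  \<comment> \<open>The entry reached after removing \<open>x\<close> and \<open>y\<close> from the
    first component, with one minus sign for each of them that lies in \<open>G\<close>. It is
    symmetric, so the cancellation comes from \<open>pos_sign\<close> alone.\<close>
  define t where "t x y = (if x \<in> G then if y \<in> G then z (insert y (insert x F)) (G - {x} - {y})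
      else - z (insert y (insert x F)) (G - {x})
    else if y \<in> G then - z (insert y (insert x F)) (G - {y}) else z (insert y (insert x F)) G)"
        for x y
  have t: "t x y = t y x" for x y
    by (auto simp: t_def insert_commute Diff_insert2[symmetric] Diff_insert[symmetric])
  have "pair_bdry (pair_bdry z) F G = (\<Sum>x\<in>-F. \<Sum>y\<in>-F - {x}. pos_sign F x * (pos_sign (insert x F) y
      * t x y))"
    unfolding pair_bdry_def[of "pair_bdry z"]
  proof (intro sum.cong refl)
    fix x
    have compl: "- insert x F = - F - {x}" by auto
    have "(if x \<in> G then - pair_bdry z (insert x F) (G - {x}) else pair_bdry z (insert x F) G) =
        (\<Sum>y\<in>-F - {x}. pos_sign (insert x F) y * t x y)"
    proof (cases "x \<in> G")
      case True
      then show ?thesis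
        unfolding pair_bdry_def compl t_def if_P[OF True] sum_negf[symmetric] by (intro sum.cong)
            simp_all
    next
      case False
      then show ?thesis
        unfolding pair_bdry_def compl t_def if_not_P[OF False] by (intro sum.cong) simp_all
    qed
    then show "pos_sign F x * (if x \<in> G then - pair_bdry z (insert x F) (G - {x}) else pair_bdry z
        (insert x F) G) =
      (\<Sum>y\<in>-F - {x}. pos_sign F x * (pos_sign (insert x F) y * t x y))"
      by (simp only: sum_distrib_left)
  qed
  also have "\<dots> = 0"
  proof (rule sum_antisym_eq_0)
    fix x y assume "x \<in> - F" "y \<in> - F" "x \<noteq> y"
    then have "pos_sign F x * pos_sign (insert x F) y = (- (pos_sign F y * pos_sign (insert y F)
        x) :: 'k)"
      by (intro pos_sign_swap) auto
    then show "pos_sign F x * (pos_sign (insert x F) y * t x y) = - (pos_sign F y * (pos_sign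
        (insert y F) x * t y x))"
      unfolding t[of y x] by (simp flip: mult.assoc)
  qed simp
  finally show ?thesis .
qed

text \<open>The augmentation sends each \<open>({}, G)\<close> to the same monomial of the
  multidegree. For fixed \<open>x\<close> the sets \<open>G\<close> with and without
  \<open>x\<close> pair off with opposite signs.\<close>

lemma sum_pair_bdry_eq_0:
  fixes z :: "'v::finite set \<Rightarrow> 'v set \<Rightarrow> 'k::comm_ring_1"
  shows "(\<Sum>G\<in>UNIV. pair_bdry z {} G) = 0"
proof -
  have "(\<Sum>G\<in>UNIV. if x \<in> G then - z {x} (G - {x}) else z {x} G) = 0" for x
  proof -
    have "(\<Sum>G\<in>{G. x \<in> G}. z {x} (G - {x})) = (\<Sum>G\<in>{G. x \<notin> G}. z {x} G)"
      by (rule sum.reindex_bij_witness[of _ "insert x" "\<lambda>G. G - {x}"]) auto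
    then show ?thesis by (simp add: sum.If_cases sum_negf Collect_neg_eq[symmetric] Compl_eq)
  qed
  then have "(\<Sum>x\<in>-{}. \<Sum>G\<in>UNIV. pos_sign {} x * (if x \<in> G then - z {x} (G - {x}) else z {x} G)) = 0"
    by (simp flip: sum_distrib_left)
  then show ?thesis unfolding pair_bdry_def by (subst sum.swap) simp
qed

lemma pchain_pair_bdry:
  assumes "up_closed J" "pchain J U (Suc i) z"
  shows "pchain J U i (pair_bdry z)"
  unfolding pchain_def
proof (intro allI impI)
  fix F G assume "pair_bdry z F G \<noteq> 0"
  then obtain x G' where x: "x \<notin> F" "z (insert x F) G' \<noteq> 0" "G' = G \<or> x \<in> G \<and> G' = G - {x}"
    by (rule pair_bdry_nonzeroE) auto
  then have *: "insert x F \<inter> G' = {}" "insert x F \<union> G' \<subseteq> U" "card (insert x F) = Suc i" "G' \<in> J"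
    using pchainD[OF assms(2) x(2)] by blast+
  moreover have "G' \<subseteq> G" using x(3) by auto
  ultimately show "F \<inter> G = {} \<and> F \<union> G \<subseteq> U \<and> card F = i \<and> G \<in> J"
    using x(1,3) assms(1) unfolding up_closed_def by auto
qed

text \<open>
  The elements of \<open>U\<close> are moved one by one into the second component, until only \<open>({}, U)\<close> is left.
\<close>

lemma pchain_push:
  fixes z :: "'v::finite set \<Rightarrow> 'v set \<Rightarrow> 'k::comm_ring_1"
  assumes up: "up_closed J" and z: "pchain J U i z" "\<And>F G. pair_bdry z F G = 0"
    and X: "finite X" "X \<subseteq> U"
  shows "\<exists>w. pchain J U (Suc i) w \<and> (\<forall>F G. z F G - pair_bdry w F G \<noteq> 0 \<longrightarrow> X \<subseteq> G)"
  using X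
proof (induction X rule: finite_induct)
  case empty
  show ?case by (intro exI[of _ "\<lambda>_ _. 0"]) (auto simp: pchain_def)
next
  case (insert x X)
  then obtain w where w: "pchain J U (Suc i) w" and wX: "\<And>F G. z F G - pair_bdry w F G \<noteq> 0 \<Longrightarrow> X \<subseteq> G"
    by blast
  define z' where "z' F G = z F G - pair_bdry w F G" for F G
  have z'_cyc: "pair_bdry z' F G = 0" for F G
    unfolding z'_def[abs_def] pair_bdry_diff by (simp add: z)
  have z'_X: "X \<subseteq> G" if "z' F G \<noteq> 0" for F G using wX that by (simp add: z'_def)
  have z'_chain: "pchain J U i z'"
    unfolding pchain_def
  proof (intro allI impI)
    fix F G assume "z' F G \<noteq> 0"
    then have "z F G \<noteq> 0 \<or> pair_bdry w F G \<noteq> 0" by (auto simp: z'_def)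
    then show "F \<inter> G = {} \<and> F \<union> G \<subseteq> U \<and> card F = i \<and> G \<in> J"
      using pchainD[OF z(1), of F G] pchainD[OF pchain_pair_bdry[OF up w], of F G] by blast
  qed
  \<comment> \<open>A cone over the terms with \<open>x\<close> outside \<open>G\<close>.
    Subtracting its boundary kills all terms with \<open>x\<close> in neither component.\<close>
  define w' where "w' F G = (if x \<in> F \<and> x \<notin> G then pos_sign (F - {x}) x * z' (F - {x}) G else 0)"
      for F G
  have w'_nz: "x \<in> F \<and> x \<notin> G \<and> z' (F - {x}) G \<noteq> 0" if "w' F G \<noteq> 0" for F G
    using that by (auto simp: w'_def split: if_splits)
  have w'_chain: "pchain J U (Suc i) w'"
    unfolding pchain_def
  proof (intro allI impI)
    fix F G assume "w' F G \<noteq> 0"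
    then have *: "x \<in> F" "x \<notin> G" "z' (F - {x}) G \<noteq> 0" using w'_nz by blast+
    then have "(F - {x}) \<inter> G = {}" "(F - {x}) \<union> G \<subseteq> U" "card (F - {x}) = i" "G \<in> J"
      using pchainD[OF z'_chain] by blast+
    then show "F \<inter> G = {} \<and> F \<union> G \<subseteq> U \<and> card F = Suc i \<and> G \<in> J"
      using * insert.prems card_Suc_Diff1[of F x] by auto
  qed
  define z'' where "z'' F G = z' F G - pair_bdry w' F G" for F G
  have z''_cyc: "pair_bdry z'' F G = 0" for F G
    unfolding z''_def[abs_def] pair_bdry_diff by (simp add: z'_cyc)
  have out: "z'' F G = 0" if "x \<notin> F" "x \<notin> G" for F G
  proof -
    have "pair_bdry w' F G = (\<Sum>y\<in>-F. if y = x then z' F G else 0)"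
      unfolding pair_bdry_def
    proof (intro sum.cong refl)
      fix y assume "y \<in> - F"
      show "pos_sign F y * (if y \<in> G then - w' (insert y F) (G - {y}) else w' (insert y F) G) =
          (if y = x then z' F G else 0)"
        using that by (auto simp: w'_def)
    qed
    then show ?thesis using that by (simp add: z''_def)
  qed
  \<comment> \<open>In the cycle condition at \<open>(F - {x}, G)\<close> every other summand has
    \<open>x\<close> in neither component and is already zero, so the one remaining summand must
    vanish too.\<close>
  have inF: "z'' F G = 0" if "x \<in> F" "x \<notin> G" for F G
  proof -
    define F0 where "F0 = F - {x}"
    have F0: "F = insert x F0" "x \<notin> F0" using that by (auto simp: F0_def)
    have "pair_bdry z'' F0 G = (\<Sum>y\<in>-F0. if y = x then pos_sign F0 x * z'' F G else 0)"
      unfolding pair_bdry_def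
    proof (intro sum.cong refl)
      fix y assume "y \<in> - F0"
      show "pos_sign F0 y * (if y \<in> G then - z'' (insert y F0) (G - {y}) else z'' (insert y F0) G) =
          (if y = x then pos_sign F0 x * z'' F G else 0)"
        using that F0 by (auto simp: out)
    qed
    then have "pos_sign F0 x * z'' F G = 0" using z''_cyc[of F0 G] F0 by simp
    then show ?thesis by (metis mult_zero_right pos_sign_square_left)
  qed
  have "insert x X \<subseteq> G" if nz: "z'' F G \<noteq> 0" for F G
  proof -
    have "x \<in> G" using out inF nz by blast
    moreover have "X \<subseteq> G"
    proof (cases "z' F G = 0")
      case True
      then have "pair_bdry w' F G \<noteq> 0" using nz by (simp add: z''_def)
      then show ?thesis by (rule pair_bdry_nonzeroE) (use w'_nz z'_X in blast)+
    qed (use z'_X in blast)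
    ultimately show ?thesis by blast
  qed
  moreover have "z F G - pair_bdry (\<lambda>F G. w F G + w' F G) F G = z'' F G" for F G
    unfolding pair_bdry_add by (simp add: z''_def z'_def)
  moreover have "pchain J U (Suc i) (\<lambda>F G. w F G + w' F G)"
    unfolding pchain_def
  proof (intro allI impI)
    fix F G assume "w F G + w' F G \<noteq> 0"
    then have "w F G \<noteq> 0 \<or> w' F G \<noteq> 0" by auto
    then show "F \<inter> G = {} \<and> F \<union> G \<subseteq> U \<and> card F = Suc i \<and> G \<in> J"
      using pchainD[OF w, of F G] pchainD[OF w'_chain, of F G] by blast
  qed
  ultimately show ?case by (intro exI[of _ "\<lambda>F G. w F G + w' F G"]) simp
qed

text \<open>Once all of \<open>U\<close> has been pushed over, only a multiple of
  \<open>({}, U)\<close> can be left. It occurs only in position \<open>0\<close>, and its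
  coefficient is the value of the augmentation.\<close>

lemma pchain_exact:
  fixes z :: "'v::finite set \<Rightarrow> 'v set \<Rightarrow> 'k::comm_ring_1"
  assumes up: "up_closed J" and z: "pchain J U i z" "\<And>F G. pair_bdry z F G = 0"
    and aug: "i = 0 \<Longrightarrow> (\<Sum>G\<in>UNIV. z {} G) = 0"
  shows "\<exists>w. pchain J U (Suc i) w \<and> pair_bdry w = z"
proof -
  obtain w where w: "pchain J U (Suc i) w" and wU: "\<And>F G. z F G - pair_bdry w F G \<noteq> 0 \<Longrightarrow> U \<subseteq> G"
    using pchain_push[OF up z finite subset_refl] by blast
  define z' where "z' F G = z F G - pair_bdry w F G" for F G
  have z': "F = {} \<and> G = U \<and> i = 0" if "z' F G \<noteq> 0" for F G
  proof -
    have "z F G \<noteq> 0 \<or> pair_bdry w F G \<noteq> 0" using that by (auto simp: z'_def)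
    then have "F \<inter> G = {}" "F \<union> G \<subseteq> U" "card F = i"
      using pchainD[OF z(1), of F G] pchainD[OF pchain_pair_bdry[OF up w], of F G] by blast+
    moreover have "U \<subseteq> G" using wU that by (simp add: z'_def)
    ultimately have "F = {}" "G = U" "card F = i" by blast+
    then show ?thesis by simp
  qed
  have "z' F G = 0" for F G
  proof (rule ccontr)
    assume nz: "z' F G \<noteq> 0"
    then have FG: "F = {}" "G = U" "i = 0" using z' by blast+
    have "(\<Sum>G\<in>UNIV. z' {} G) = (\<Sum>G\<in>UNIV. if G = U then z' {} U else 0)"
      using z' by (intro sum.cong) auto
    then have "(\<Sum>G\<in>UNIV. z' {} G) = z' {} U" by simp
    moreover have "(\<Sum>G\<in>UNIV. z' {} G) = 0"
      using aug FG(3) by (simp add: z'_def sum_subtractf sum_pair_bdry_eq_0)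
    ultimately show False using nz FG by simp
  qed
  then have "pair_bdry w = z" by (intro ext) (simp add: z'_def)
  then show ?thesis using w by blast
qed

section \<open>Multidegrees and polynomial coefficients\<close>

definition sqfree_exp :: "'v::finite set \<Rightarrow> ('v \<Rightarrow>\<^sub>0 nat)"
  where "sqfree_exp A = (\<Sum>x\<in>A. Poly_Mapping.single x 1)"

definition sqfree_monom :: "'v::finite set \<Rightarrow> ('v, 'k::field) mpoly"
  where "sqfree_monom A = Poly_Mapping.single (sqfree_exp A) 1"

lemma lookup_sqfree_exp: "Poly_Mapping.lookup (sqfree_exp A) x = (if x \<in> A then 1 else 0)"
proof -
  have "Poly_Mapping.lookup (sqfree_exp A) x = (\<Sum>y\<in>A. if y = x then 1 else 0)"
    unfolding sqfree_exp_def lookup_sum by (intro sum.cong) (auto simp: lookup_single when_def)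
  then show ?thesis by simp
qed

lemma total_deg_sqfree_exp: "total_deg (sqfree_exp A) = card A"
  by (simp add: total_deg_eq lookup_sqfree_exp sum.If_cases)

lemma lookup_mult_single:
  fixes h :: "('v::finite, 'k::field) mpoly"
  shows "Poly_Mapping.lookup (h * Poly_Mapping.single m 1) \<mu> =
    (if \<forall>x. Poly_Mapping.lookup m x \<le> Poly_Mapping.lookup \<mu> x then Poly_Mapping.lookup h (\<mu> - m)
        else 0)"
proof -
  have "Poly_Mapping.lookup (h * Poly_Mapping.single m 1) \<mu> =
      (\<Sum>a. Poly_Mapping.lookup h a when \<mu> = a + m)"
  proof -
    have "(\<Sum>b. Poly_Mapping.lookup (Poly_Mapping.single m (1 :: 'k)) b when \<mu> = a + b) =
        (\<Sum>b. (1 when \<mu> = a + m) when b = m)" for a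
      by (intro Sum_any.cong) (auto simp: lookup_single when_def)
    then show ?thesis by (simp add: lookup_mult mult_when)
  qed
  also have "\<dots> = (if \<forall>x. Poly_Mapping.lookup m x \<le> Poly_Mapping.lookup \<mu> x
      then Poly_Mapping.lookup h (\<mu> - m) else 0)"
  proof (cases "\<forall>x. Poly_Mapping.lookup m x \<le> Poly_Mapping.lookup \<mu> x")
    case True
    then have "\<mu> = a + m \<longleftrightarrow> a = \<mu> - m" for a
      by (auto simp: poly_mapping_eq_iff fun_eq_iff lookup_add lookup_minus)
    then show ?thesis using True by simp
  next
    case False
    then have "\<mu> \<noteq> a + m" for a by (auto simp: lookup_add)
    then show ?thesis unfolding if_not_P[OF False] by simp
  qed
  finally show ?thesis .
qed

text \<open>The differential of \<open>pair_bdry\<close> with its variable restored: dropping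
  \<open>x\<close> costs a factor \<open>x\<close>, while moving \<open>x\<close> into
  \<open>G\<close> costs only a sign. Both preserve the multidegree.\<close>

definition poly_bdry :: "('v::finite set \<Rightarrow> 'v set \<Rightarrow> ('v, 'k::field) mpoly) \<Rightarrow> 'v set \<Rightarrow> 'v set \<Rightarrow>
    ('v, 'k) mpoly"
  where "poly_bdry f F G = (\<Sum>x\<in>- F. pos_sign F x *
    (if x \<in> G then - f (insert x F) (G - {x}) else f (insert x F) G * sqfree_monom {x}))"

text \<open>The coefficient of \<open>f\<close> in multidegree \<open>\<mu>\<close>, where the basis element \<open>(F, G)\<close> has
  multidegree \<open>F \<union> G\<close>.\<close>

definition mcoeff :: "('v::finite \<Rightarrow>\<^sub>0 nat) \<Rightarrow> ('v set \<Rightarrow> 'v set \<Rightarrow> ('v, 'k::field) mpoly) \<Rightarrow> 'v set \<Rightarrow>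
    'v set \<Rightarrow> 'k"
  where "mcoeff \<mu> f F G = (if F \<union> G \<subseteq> Poly_Mapping.keys \<mu>
    then Poly_Mapping.lookup (f F G) (\<mu> - sqfree_exp (F \<union> G)) else 0)"

lemma lookup_pos_sign_mult:
  fixes h :: "('v::finite, 'k::field) mpoly"
  shows "Poly_Mapping.lookup (pos_sign F x * h) m = pos_sign F x * Poly_Mapping.lookup h m"
  by (simp add: pos_sign_def minus_one_power_iff)

lemma sqfree_exp_le_iff:
  "(\<forall>x. Poly_Mapping.lookup (sqfree_exp A) x \<le> Poly_Mapping.lookup \<mu> x) \<longleftrightarrow> A \<subseteq> Poly_Mapping.keys \<mu>"
  by (auto simp: lookup_sqfree_exp in_keys_iff Suc_le_eq)

text \<open>Fixing a multidegree removes the variables from the differential. As basis elements have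
  squarefree multidegree, \<open>\<mu>\<close> matters only through its support.\<close>

lemma mcoeff_poly_bdry: "mcoeff \<mu> (poly_bdry f) F G = pair_bdry (mcoeff \<mu> f) F G"
proof (cases "F \<union> G \<subseteq> Poly_Mapping.keys \<mu>")
  case True
  define \<nu> where "\<nu> = \<mu> - sqfree_exp (F \<union> G)"
  have "mcoeff \<mu> (poly_bdry f) F G = (\<Sum>x\<in>-F. pos_sign F x * (if x \<in> G then - Poly_Mapping.lookup
      (f (insert x F) (G - {x})) \<nu>
      else Poly_Mapping.lookup (f (insert x F) G * sqfree_monom {x}) \<nu>))"
    unfolding mcoeff_def if_P[OF True] poly_bdry_def \<nu>_def[symmetric] lookup_sum
        lookup_pos_sign_mult
    by (intro sum.cong refl) simp
  also have "\<dots> = pair_bdry (mcoeff \<mu> f) F G"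
    unfolding pair_bdry_def
  proof (intro sum.cong refl)
    fix x assume x: "x \<in> - F"
    have "Poly_Mapping.lookup (f (insert x F) (G - {x})) \<nu> = mcoeff \<mu> f (insert x F) (G - {x})" if
        "x \<in> G"
    proof -
      have "insert x F \<union> (G - {x}) = F \<union> G" using that by auto
      then show ?thesis using True by (simp add: mcoeff_def \<nu>_def)
    qed
    moreover have "Poly_Mapping.lookup (f (insert x F) G * sqfree_monom {x}) \<nu> = mcoeff \<mu> f
        (insert x F) G" if "x \<notin> G"
    proof -
      have "x \<in> Poly_Mapping.keys \<nu> \<longleftrightarrow> x \<in> Poly_Mapping.keys \<mu>"
        using x that by (simp add: in_keys_iff \<nu>_def lookup_minus lookup_sqfree_exp)
      moreover have "\<nu> - sqfree_exp {x} = \<mu> - sqfree_exp (insert x F \<union> G)"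
        using x that by (auto simp: poly_mapping_eq_iff fun_eq_iff \<nu>_def lookup_minus
            lookup_sqfree_exp)
      ultimately show ?thesis
        using True unfolding sqfree_monom_def lookup_mult_single sqfree_exp_le_iff by (simp add:
            mcoeff_def)
    qed
    ultimately show "pos_sign F x * (if x \<in> G then - Poly_Mapping.lookup (f (insert x F) (G -
        {x})) \<nu>
        else Poly_Mapping.lookup (f (insert x F) G * sqfree_monom {x}) \<nu>) =
      pos_sign F x * (if x \<in> G then - mcoeff \<mu> f (insert x F) (G - {x}) else mcoeff \<mu> f (insert x
          F) G)"
      by simp
  qed
  finally show ?thesis .
next
  case False
  have "pos_sign F x * (if x \<in> G then - mcoeff \<mu> f (insert x F) (G - {x}) else mcoeff \<mu> f (insert
      x F) G) = 0" for x
  proof -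
    have "\<not> insert x F \<union> (G - {x}) \<subseteq> Poly_Mapping.keys \<mu>" "\<not> insert x F \<union> G \<subseteq> Poly_Mapping.keys \<mu>"
      using False by auto
    then have "mcoeff \<mu> f (insert x F) (G - {x}) = 0" "mcoeff \<mu> f (insert x F) G = 0"
      unfolding mcoeff_def by (simp_all only: if_False)
    then show ?thesis by simp
  qed
  then have "pair_bdry (mcoeff \<mu> f) F G = 0" unfolding pair_bdry_def by (intro sum.neutral) blast
  moreover have "mcoeff \<mu> (poly_bdry f) F G = 0" unfolding mcoeff_def by (rule if_not_P[OF False])
  ultimately show ?thesis by simp
qed

lemma lookup_eq_mcoeff:
  "Poly_Mapping.lookup (f F G) m = mcoeff (m + sqfree_exp (F \<union> G)) f F G"
proof -
  have "F \<union> G \<subseteq> Poly_Mapping.keys (m + sqfree_exp (F \<union> G))"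
    by (auto simp: in_keys_iff lookup_add lookup_sqfree_exp)
  then show ?thesis by (simp add: mcoeff_def)
qed

lemma mcoeff_eqI:
  assumes "\<And>\<mu> F G. mcoeff \<mu> f F G = mcoeff \<mu> g F G"
  shows "f = g"
  by (intro ext poly_mapping_eqI) (simp add: lookup_eq_mcoeff assms)

lemma mcoeff_0 [simp]: "mcoeff \<mu> (\<lambda>_ _. 0) F G = 0"
  by (simp add: mcoeff_def)

lemma poly_bdry_poly_bdry: "poly_bdry (poly_bdry f) = (\<lambda>_ _. 0)"
proof (rule mcoeff_eqI)
  fix \<mu> :: "'a \<Rightarrow>\<^sub>0 nat" and F G
  have "mcoeff \<mu> (poly_bdry f) = pair_bdry (mcoeff \<mu> f)" by (intro ext mcoeff_poly_bdry)
  then show "mcoeff \<mu> (poly_bdry (poly_bdry f)) F G = mcoeff \<mu> (\<lambda>_ _. 0) F G" by (simp add: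
      mcoeff_poly_bdry)
qed

lemma lookup_sum_sqfree_monom:
  fixes f :: "'v::finite set \<Rightarrow> 'v set \<Rightarrow> ('v, 'k::field) mpoly"
  shows "Poly_Mapping.lookup (\<Sum>G\<in>UNIV. f {} G * sqfree_monom G) \<mu> = (\<Sum>G\<in>UNIV. mcoeff \<mu> f {} G)"
  unfolding lookup_sum sqfree_monom_def lookup_mult_single sqfree_exp_le_iff mcoeff_def
      Un_empty_left by simp

lemma pchain_mcoeff:
  assumes "pchain J UNIV i f"
  shows "pchain J (Poly_Mapping.keys \<mu>) i (mcoeff \<mu> f)"
  unfolding pchain_def
proof (intro allI impI)
  fix F G assume "mcoeff \<mu> f F G \<noteq> 0"
  then have "F \<union> G \<subseteq> Poly_Mapping.keys \<mu>" "f F G \<noteq> 0" by (auto simp: mcoeff_def split: if_splits)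
  then show "F \<inter> G = {} \<and> F \<union> G \<subseteq> Poly_Mapping.keys \<mu> \<and> card F = i \<and> G \<in> J"
    using pchainD[OF assms, of F G] by blast
qed

lemma pchain_poly_bdry:
  assumes "up_closed J" "pchain J UNIV (Suc i) f"
  shows "pchain J UNIV i (poly_bdry f)"
  unfolding pchain_def
proof (intro allI impI)
  fix F G assume "poly_bdry f F G \<noteq> 0"
  then obtain m where "Poly_Mapping.lookup (poly_bdry f F G) m \<noteq> 0"
    by (metis poly_mapping_eqI lookup_zero)
  then have "pair_bdry (mcoeff (m + sqfree_exp (F \<union> G)) f) F G \<noteq> 0"
    unfolding lookup_eq_mcoeff mcoeff_poly_bdry .
  then show "F \<inter> G = {} \<and> F \<union> G \<subseteq> UNIV \<and> card F = i \<and> G \<in> J"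
    using pchainD[OF pchain_pair_bdry[OF assms(1) pchain_mcoeff[OF assms(2)]]] by blast
qed

lemma sum_poly_bdry_sqfree_monom: "(\<Sum>G\<in>UNIV. poly_bdry f {} G * sqfree_monom G) = 0"
proof (rule poly_mapping_eqI)
  fix \<mu>
  show "Poly_Mapping.lookup (\<Sum>G\<in>UNIV. poly_bdry f {} G * sqfree_monom G) \<mu> = Poly_Mapping.lookup 0
      \<mu>"
    unfolding lookup_sum_sqfree_monom mcoeff_poly_bdry by (simp add: sum_pair_bdry_eq_0)
qed

text \<open>A polynomial chain has only finitely many multidegrees. Each of them is filled
  separately over the field and the fillings are added up.\<close>

lemma poly_bdry_exact:
  fixes f :: "'v::finite set \<Rightarrow> 'v set \<Rightarrow> ('v, 'k::field) mpoly"
  assumes up: "up_closed J" and f: "pchain J UNIV i f" "poly_bdry f = (\<lambda>_ _. 0)"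
    and aug: "i = 0 \<Longrightarrow> (\<Sum>G\<in>UNIV. f {} G * sqfree_monom G) = 0"
  shows "\<exists>g. pchain J UNIV (Suc i) g \<and> poly_bdry g = f"
proof -
  define M where "M = (\<Union>F. \<Union>G. (\<lambda>m. m + sqfree_exp (F \<union> G)) ` Poly_Mapping.keys (f F G))"
  have fin: "finite M" by (auto simp: M_def)
  have M: "mcoeff \<mu> f F G = 0" if "\<mu> \<notin> M" for \<mu> F G
  proof (rule ccontr)
    assume nz: "mcoeff \<mu> f F G \<noteq> 0"
    then have FG: "F \<union> G \<subseteq> Poly_Mapping.keys \<mu>" and "\<mu> - sqfree_exp (F \<union> G) \<in> Poly_Mapping.keys (f
        F G)"
      by (auto simp: mcoeff_def in_keys_iff split: if_splits)
    moreover have "\<mu> = \<mu> - sqfree_exp (F \<union> G) + sqfree_exp (F \<union> G)"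
      using FG unfolding sqfree_exp_le_iff[symmetric] by (auto simp: poly_mapping_eq_iff
          fun_eq_iff lookup_add lookup_minus)
    ultimately show False using that unfolding M_def by blast
  qed
  \<comment> \<open>Outside \<open>M\<close> the zero filling is prescribed, so that the sum over
    \<open>M\<close> defining \<open>g\<close> has the right coefficients in every
    multidegree.\<close>
  have "\<exists>w. pchain J (Poly_Mapping.keys \<mu>) (Suc i) w \<and> pair_bdry w = mcoeff \<mu> f \<and> (\<mu> \<notin> M \<longrightarrow> w = (\<lambda>_
      _. 0))" for \<mu>
  proof (cases "\<mu> \<in> M")
    case True
    have "pair_bdry (mcoeff \<mu> f) F G = 0" for F G by (simp add: f(2) flip: mcoeff_poly_bdry)
    moreover have "(\<Sum>G\<in>UNIV. mcoeff \<mu> f {} G) = 0" if "i = 0"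
      by (simp add: aug[OF that] flip: lookup_sum_sqfree_monom)
    ultimately show ?thesis
      using pchain_exact[OF up pchain_mcoeff[OF f(1), of \<mu>]] True by blast
  next
    case False
    then show ?thesis using M by (intro exI[of _ "\<lambda>_ _. 0"]) (auto simp: pchain_def fun_eq_iff)
  qed
  then obtain w where w: "\<And>\<mu>. pchain J (Poly_Mapping.keys \<mu>) (Suc i) (w \<mu>)"
    "\<And>\<mu>. pair_bdry (w \<mu>) = mcoeff \<mu> f" "\<And>\<mu>. \<mu> \<notin> M \<Longrightarrow> w \<mu> = (\<lambda>_ _. 0)" by metis
  define g where "g F G = (\<Sum>\<mu>\<in>{\<mu> \<in> M. F \<union> G \<subseteq> Poly_Mapping.keys \<mu>}.
    Poly_Mapping.single (\<mu> - sqfree_exp (F \<union> G)) (w \<mu> F G))" for F G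
  have g: "mcoeff \<mu> g F G = w \<mu> F G" for \<mu> F G
  proof (cases "F \<union> G \<subseteq> Poly_Mapping.keys \<mu>")
    case True
    have inj: "\<nu> - sqfree_exp (F \<union> G) = \<mu> - sqfree_exp (F \<union> G) \<longleftrightarrow> \<nu> = \<mu>"
      if "F \<union> G \<subseteq> Poly_Mapping.keys \<nu>" for \<nu>
    proof
      assume eq: "\<nu> - sqfree_exp (F \<union> G) = \<mu> - sqfree_exp (F \<union> G)"
      have "Poly_Mapping.lookup \<nu> x = Poly_Mapping.lookup \<mu> x" for x
      proof -
        have "Poly_Mapping.lookup (sqfree_exp (F \<union> G)) x \<le> Poly_Mapping.lookup \<nu> x"
          "Poly_Mapping.lookup (sqfree_exp (F \<union> G)) x \<le> Poly_Mapping.lookup \<mu> x"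
          using that True unfolding sqfree_exp_le_iff[symmetric] by blast+
        moreover have "Poly_Mapping.lookup (\<nu> - sqfree_exp (F \<union> G)) x = Poly_Mapping.lookup (\<mu> -
            sqfree_exp (F \<union> G)) x"
          by (simp only: eq)
        ultimately show ?thesis by (simp add: lookup_minus)
      qed
      then show "\<nu> = \<mu>" by (rule poly_mapping_eqI)
    qed simp
    have "mcoeff \<mu> g F G = (\<Sum>\<nu>\<in>{\<mu> \<in> M. F \<union> G \<subseteq> Poly_Mapping.keys \<mu>}. if \<nu> = \<mu> then w \<mu> F G else 0)"
      unfolding mcoeff_def g_def lookup_sum if_P[OF True]
    proof (intro sum.cong refl)
      fix \<nu> assume "\<nu> \<in> {\<mu> \<in> M. F \<union> G \<subseteq> Poly_Mapping.keys \<mu>}"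
      then have "\<nu> - sqfree_exp (F \<union> G) = \<mu> - sqfree_exp (F \<union> G) \<longleftrightarrow> \<nu> = \<mu>" using inj by blast
      then show "Poly_Mapping.lookup (Poly_Mapping.single (\<nu> - sqfree_exp (F \<union> G)) (w \<nu> F G)) (\<mu> -
          sqfree_exp (F \<union> G)) =
          (if \<nu> = \<mu> then w \<mu> F G else 0)"
        by (simp add: lookup_single when_def)
    qed
    also have "\<dots> = w \<mu> F G" using fin True w(3)[of \<mu>] by (cases "\<mu> \<in> M") auto
    finally show ?thesis .
  next
    case False
    then have "w \<mu> F G = 0" using pchainD[OF w(1)[of \<mu>], of F G] by blast
    then show ?thesis unfolding mcoeff_def if_not_P[OF False] by simp
  qed
  have "poly_bdry g = f"
  proof (rule mcoeff_eqI)
    fix \<mu> F G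
    have "mcoeff \<mu> g = w \<mu>" by (intro ext g)
    then show "mcoeff \<mu> (poly_bdry g) F G = mcoeff \<mu> f F G" by (simp add: mcoeff_poly_bdry w(2))
  qed
  moreover have "pchain J UNIV (Suc i) g"
    unfolding pchain_def
  proof (intro allI impI)
    fix F G assume "g F G \<noteq> 0"
    then obtain \<mu> where "Poly_Mapping.single (\<mu> - sqfree_exp (F \<union> G)) (w \<mu> F G) \<noteq> 0"
      unfolding g_def by (rule sum.not_neutral_contains_not_neutral)
    then have "w \<mu> F G \<noteq> 0" by auto
    from pchainD[OF w(1) this] show "F \<inter> G = {} \<and> F \<union> G \<subseteq> UNIV \<and> card F = Suc i \<and> G \<in> J" by blast
  qed
  ultimately show ?thesis by blast
qed

section \<open>The resolution as a record with numbered basis elements\<close>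

definition pairs :: "'v::finite set set \<Rightarrow> nat \<Rightarrow> ('v set \<times> 'v set) set"
  where "pairs J i = {(F, G). F \<inter> G = {} \<and> card F = i \<and> G \<in> J}"

definition entry :: "'v::finite set \<times> 'v set \<Rightarrow> 'v set \<times> 'v set \<Rightarrow> ('v, 'k::field) mpoly"
  where "entry p q = poly_bdry (\<lambda>F G. if (F, G) = p then 1 else 0) (fst q) (snd q)"

abbreviation pair_at :: "'v::finite set set \<Rightarrow> nat \<Rightarrow> nat \<Rightarrow> 'v set \<times> 'v set"
  where "pair_at J i \<equiv> from_nat_into (pairs J i)"

abbreviation index_at :: "'v::finite set set \<Rightarrow> nat \<Rightarrow> 'v set \<times> 'v set \<Rightarrow> nat"
  where "index_at J i \<equiv> to_nat_on (pairs J i)"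

definition sqfree_res :: "'v::finite set set \<Rightarrow> ('v, 'k::field) graded_free_data"
  where "sqfree_res J = \<lparr>rank = (\<lambda>i. card (pairs J i)),
    shift = (\<lambda>i k. int (card (fst (pair_at J i k)) + card (snd (pair_at J i k)))),
    bd = (\<lambda>i k l. entry (pair_at J (Suc i) k) (pair_at J i l)),
    aug = (\<lambda>k. sqfree_monom (snd (pair_at J 0 k)))\<rparr>"

definition of_vec :: "'v::finite set set \<Rightarrow> nat \<Rightarrow> (nat \<Rightarrow> 'a::zero) \<Rightarrow> 'v set \<Rightarrow> 'v set \<Rightarrow> 'a"
  where "of_vec J i v F G = (if (F, G) \<in> pairs J i then v (index_at J i (F, G)) else 0)"

definition to_vec :: "'v::finite set set \<Rightarrow> nat \<Rightarrow> ('v set \<Rightarrow> 'v set \<Rightarrow> 'a::zero) \<Rightarrow> nat \<Rightarrow> 'a"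
  where "to_vec J i f k = (if k < card (pairs J i) then f (fst (pair_at J i k)) (snd (pair_at J i
      k)) else 0)"

lemma pair_at_bij: "bij_betw (pair_at J i) {..<card (pairs J i)} (pairs J i)"
  by (rule bij_betw_from_nat_into_finite) simp

lemma pair_at_pairs: "k < card (pairs J i) \<Longrightarrow> pair_at J i k \<in> pairs J i"
  using bij_betwE[OF pair_at_bij] by blast

lemma index_at_less: "p \<in> pairs J i \<Longrightarrow> index_at J i p < card (pairs J i)"
  using bij_betwE[OF to_nat_on_finite[of "pairs J i"]] by simp

lemma pair_at_index_at: "p \<in> pairs J i \<Longrightarrow> pair_at J i (index_at J i p) = p"
  by (simp add: countable_finite)

lemma index_at_pair_at:
  assumes "k < card (pairs J i)"
  shows "index_at J i (pair_at J i k) = k"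
proof -
  have "k \<in> index_at J i ` pairs J i"
    using assms bij_betw_imp_surj_on[OF to_nat_on_finite[of "pairs J i"]] by simp
  then show ?thesis by simp
qed

lemma pchain_of_vec: "pchain J UNIV i (of_vec J i v)"
  by (auto simp: pchain_def of_vec_def pairs_def)

lemma of_to_vec:
  assumes "pchain J UNIV i f"
  shows "of_vec J i (to_vec J i f) = f"
proof (intro ext)
  fix F G
  show "of_vec J i (to_vec J i f) F G = f F G"
  proof (cases "(F, G) \<in> pairs J i")
    case True
    then show ?thesis by (simp add: of_vec_def to_vec_def index_at_less pair_at_index_at)
  next
    case False
    then have "f F G = 0" using pchainD[OF assms, of F G] by (auto simp: pairs_def)
    then show ?thesis using False by (simp add: of_vec_def)
  qed
qed

lemma to_of_vec:
  assumes "\<And>k. k \<ge> card (pairs J i) \<Longrightarrow> v k = 0"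
  shows "to_vec J i (of_vec J i v) = v"
proof
  fix k
  show "to_vec J i (of_vec J i v) k = v k"
    using assms[of k] by (cases "k < card (pairs J i)") (simp_all add: to_vec_def of_vec_def
        pair_at_pairs index_at_pair_at)
qed

lemma of_vec_inject:
  assumes "of_vec J i v = of_vec J i w"
    "\<And>k. k \<ge> card (pairs J i) \<Longrightarrow> v k = 0" "\<And>k. k \<ge> card (pairs J i) \<Longrightarrow> w k = 0"
  shows "v = w"
  using assms to_of_vec by metis

lemma sum_rank: "(\<Sum>k<card (pairs J i). h (pair_at J i k)) = (\<Sum>p\<in>pairs J i. h p)"
  by (rule sum.reindex_bij_betw[OF pair_at_bij])

lemma sum_rank_vec:
  "(\<Sum>k<card (pairs J i). v k * h (pair_at J i k)) = (\<Sum>p\<in>pairs J i. of_vec J i v (fst p) (snd p) *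
      h p)"
  unfolding sum_rank[symmetric] by (intro sum.cong refl) (simp add: of_vec_def pair_at_pairs
      index_at_pair_at)

lemma poly_bdry_eq_sum_entry:
  assumes "pchain J UNIV i f"
  shows "poly_bdry f F G = (\<Sum>p\<in>pairs J i. f (fst p) (snd p) * entry p (F, G))"
proof -
  have delta: "(\<Sum>p\<in>pairs J i. f (fst p) (snd p) * (if q = p then 1 else 0)) = f (fst q) (snd q)"
      for q
  proof -
    have "(\<Sum>p\<in>pairs J i. f (fst p) (snd p) * (if q = p then 1 else 0)) =
        (\<Sum>p\<in>pairs J i. if p = q then f (fst q) (snd q) else 0)"
      by (intro sum.cong) auto
    also have "\<dots> = f (fst q) (snd q)"
      using pchainD[OF assms, of "fst q" "snd q"] by (cases q) (auto simp: pairs_def)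
    finally show ?thesis .
  qed
  have "(\<Sum>p\<in>pairs J i. f (fst p) (snd p) * entry p (F, G)) =
    (\<Sum>x\<in>-F. \<Sum>p\<in>pairs J i. f (fst p) (snd p) * (pos_sign F x *
      (if x \<in> G then - (if (insert x F, G - {x}) = p then 1 else 0)
       else (if (insert x F, G) = p then 1 else 0) * sqfree_monom {x})))"
    unfolding entry_def poly_bdry_def sum_distrib_left fst_conv snd_conv by (rule sum.swap)
  also have "\<dots> = poly_bdry f F G"
    unfolding poly_bdry_def
  proof (intro sum.cong refl)
    fix x
    show "(\<Sum>p\<in>pairs J i. f (fst p) (snd p) * (pos_sign F x *
      (if x \<in> G then - (if (insert x F, G - {x}) = p then 1 else 0)
       else (if (insert x F, G) = p then 1 else 0) * sqfree_monom {x}))) =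
      pos_sign F x * (if x \<in> G then - f (insert x F) (G - {x}) else f (insert x F) G *
          sqfree_monom {x})"
    proof (cases "x \<in> G")
      case True
      have "(\<Sum>p\<in>pairs J i. f (fst p) (snd p) * (pos_sign F x * - (if (insert x F, G - {x}) = p
          then 1 else 0))) =
        - pos_sign F x * (\<Sum>p\<in>pairs J i. f (fst p) (snd p) * (if (insert x F, G - {x}) = p then 1
            else 0))"
        unfolding sum_distrib_left by (intro sum.cong) (simp_all add: mult_ac)
      then show ?thesis using True unfolding delta by simp
    next
      case False
      have "(\<Sum>p\<in>pairs J i. f (fst p) (snd p) * (pos_sign F x * ((if (insert x F, G) = p then 1
          else 0) * sqfree_monom {x}))) =
        pos_sign F x * (\<Sum>p\<in>pairs J i. f (fst p) (snd p) * (if (insert x F, G) = p then 1 else 0))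
            * sqfree_monom {x}"
        unfolding sum_distrib_left sum_distrib_right by (intro sum.cong) (simp_all add: mult_ac)
      then show ?thesis using False unfolding delta by (simp add: mult.assoc)
    qed
  qed
  finally show ?thesis ..
qed

lemma bd_map_sqfree_res:
  assumes "up_closed J"
  shows "of_vec J i (bd_map (sqfree_res J) i v) = poly_bdry (of_vec J (Suc i) v)"
proof (intro ext)
  fix F G
  show "of_vec J i (bd_map (sqfree_res J) i v) F G = poly_bdry (of_vec J (Suc i) v) F G"
  proof (cases "(F, G) \<in> pairs J i")
    case True
    then have "of_vec J i (bd_map (sqfree_res J) i v) F G =
        (\<Sum>k<card (pairs J (Suc i)). v k * entry (pair_at J (Suc i) k) (F, G))"
      by (simp add: of_vec_def bd_map_def sqfree_res_def index_at_less pair_at_index_at)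
    also have "\<dots> = poly_bdry (of_vec J (Suc i) v) F G"
      unfolding sum_rank_vec[where h = "\<lambda>p. entry p (F, G)"] poly_bdry_eq_sum_entry[OF
          pchain_of_vec] ..
    finally show ?thesis .
  next
    case False
    then have "poly_bdry (of_vec J (Suc i) v) F G = 0"
      using pchainD[OF pchain_poly_bdry[OF assms pchain_of_vec]] by (fastforce simp: pairs_def)
    then show ?thesis using False by (simp add: of_vec_def)
  qed
qed

lemma aug_map_sqfree_res:
  "aug_map (sqfree_res J) v = (\<Sum>G\<in>UNIV. of_vec J 0 v {} G * sqfree_monom G)"
proof -
  have "aug_map (sqfree_res J) v = (\<Sum>p\<in>pairs J 0. of_vec J 0 v (fst p) (snd p) * sqfree_monom (snd
      p))"
    by (simp add: aug_map_def sqfree_res_def sum_rank_vec[where h = "\<lambda>p. sqfree_monom (snd p)"])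
  also have "\<dots> = (\<Sum>p\<in>Pair {} ` UNIV. of_vec J 0 v (fst p) (snd p) * sqfree_monom (snd p))"
    by (rule sum.mono_neutral_left) (auto simp: pairs_def of_vec_def)
  also have "\<dots> = (\<Sum>G\<in>UNIV. of_vec J 0 v {} G * sqfree_monom G)"
    by (subst sum.reindex) (auto simp: inj_on_def)
  finally show ?thesis .
qed

lemma homogeneous_uminus: "homogeneous n f \<Longrightarrow> homogeneous n (- f)"
  using homogeneous_diff[of n 0 f] by simp

lemma homogeneous_pos_sign_mult: "homogeneous n f \<Longrightarrow> homogeneous n (pos_sign F x * f)"
  for f :: "('v::finite, 'k::field) mpoly"
  by (auto simp: pos_sign_def minus_one_power_iff homogeneous_uminus)

lemma homogeneous_sqfree_monom: "homogeneous (int (card A)) (sqfree_monom A)"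
  by (simp add: homogeneous_def sqfree_monom_def total_deg_sqfree_exp)

text \<open>Moving \<open>x\<close> between the components preserves the total size and gives
  entries \<open>1\<close> or \<open>-1\<close>; dropping \<open>x\<close> lowers the size by one
  and gives a variable. The unit entries are why the resolution is not minimal in general.\<close>

lemma homogeneous_entry:
  assumes "F \<inter> G = {}" "F' \<inter> G' = {}"
  shows "homogeneous (int (card F + card G) - int (card F' + card G')) (entry (F, G) (F', G'))"
  unfolding entry_def poly_bdry_def fst_conv snd_conv
proof (intro homogeneous_sum homogeneous_pos_sign_mult)
  fix x assume x: "x \<in> - F'"
  let ?d = "int (card F + card G) - int (card F' + card G')"
  have 1: "?d = 0" if "x \<in> G'" "(insert x F', G' - {x}) = (F, G)"
    using that x card_Suc_Diff1[of G' x] by auto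
  have 2: "?d = 1" if "(insert x F', G') = (F, G)"
    using that x by auto
  show "homogeneous ?d (if x \<in> G' then - (if (insert x F', G' - {x}) = (F, G) then 1 else 0)
      else (if (insert x F', G') = (F, G) then 1 else 0) * sqfree_monom {x})"
  proof (cases "x \<in> G'")
    case True
    then show ?thesis using 1 by (auto intro!: homogeneous_uminus)
  next
    case False
    then show ?thesis using 2 homogeneous_sqfree_monom[of "{x}"] by auto
  qed
qed

section \<open>Squarefree monomial ideals and their resolution\<close>

lemma mult_module: "module ((*) :: 'a::comm_ring_1 \<Rightarrow> 'a \<Rightarrow> 'a)"
  by unfold_locales (simp_all add: algebra_simps)

lemma sqfree_monom_mult: "A \<inter> B = {} \<Longrightarrow> sqfree_monom A * sqfree_monom B = sqfree_monom (A \<union> B)"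
proof -
  assume "A \<inter> B = {}"
  then have "sqfree_exp A + sqfree_exp B = sqfree_exp (A \<union> B)"
    by (auto simp: poly_mapping_eq_iff fun_eq_iff lookup_add lookup_sqfree_exp)
  then show ?thesis by (simp add: sqfree_monom_def mult_single)
qed

text \<open>The sum runs over all squarefree monomials of the ideal and not just over the
  generators, because these index the basis in position \<open>0\<close>.\<close>

lemma ideal_of_sqfree_monom:
  "ideal_of (sqfree_monom ` B) = {\<Sum>G\<in>UNIV. f G * sqfree_monom G | f :: 'v::finite set \<Rightarrow> ('v,
      'k::field) mpoly.
    \<forall>G. f G \<noteq> 0 \<longrightarrow> (\<exists>A\<in>B. A \<subseteq> G)}" (is "_ = ?I")
proof
  interpret module "(*) :: ('v, 'k) mpoly \<Rightarrow> _" by (rule mult_module)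
  show "?I \<subseteq> ideal_of (sqfree_monom ` B)"
  proof
    fix g assume "g \<in> ?I"
    then obtain f where f: "g = (\<Sum>G\<in>UNIV. f G * sqfree_monom G)" "\<And>G. f G \<noteq> 0 \<Longrightarrow> \<exists>A\<in>B. A \<subseteq> G" by
        blast
    have "f G * sqfree_monom G \<in> span (sqfree_monom ` B)" for G
    proof (cases "f G = 0")
      case False
      then obtain A where A: "A \<in> B" "A \<subseteq> G" using f by blast
      then have eq: "sqfree_monom G = sqfree_monom (G - A) * (sqfree_monom A :: ('v, 'k) mpoly)"
        by (subst sqfree_monom_mult) (auto simp: Un_absorb2)
      have "sqfree_monom A \<in> span (sqfree_monom ` B)" using A(1) by (intro span_base imageI)
      then show ?thesis unfolding eq mult.assoc[symmetric] by (rule span_scale)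
    qed (simp add: span_zero)
    then show "g \<in> ideal_of (sqfree_monom ` B)" unfolding f(1) ideal_of_def by (intro span_sum)
  qed
  have I: "g \<in> ?I" if "g = (\<Sum>G\<in>UNIV. h G * sqfree_monom G)" "\<And>G. h G \<noteq> 0 \<Longrightarrow> \<exists>A\<in>B. A \<subseteq> G" for g h
    by (rule CollectI) (use that in \<open>intro exI[of _ h] conjI; simp\<close>)
  have "subspace ?I"
  proof (rule subspaceI)
    show "0 \<in> ?I" by (intro CollectI exI[of _ "\<lambda>_. 0"]) simp
  next
    fix a b assume "a \<in> ?I" "b \<in> ?I"
    then obtain f g where f: "a = (\<Sum>G\<in>UNIV. f G * sqfree_monom G)" "\<forall>G. f G \<noteq> 0 \<longrightarrow> (\<exists>A\<in>B. A \<subseteq> G)"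
      and g: "b = (\<Sum>G\<in>UNIV. g G * sqfree_monom G)" "\<forall>G. g G \<noteq> 0 \<longrightarrow> (\<exists>A\<in>B. A \<subseteq> G)" by blast
    have "a + b = (\<Sum>G\<in>UNIV. (f G + g G) * sqfree_monom G)"
      by (simp add: f(1) g(1) distrib_right sum.distrib)
    moreover have "\<exists>A\<in>B. A \<subseteq> G" if "f G + g G \<noteq> 0" for G
      using f(2) g(2) that by (metis add_0)
    ultimately show "a + b \<in> ?I" by (rule I)
  next
    fix c a assume "a \<in> ?I"
    then obtain f where f: "a = (\<Sum>G\<in>UNIV. f G * sqfree_monom G)" "\<forall>G. f G \<noteq> 0 \<longrightarrow> (\<exists>A\<in>B. A \<subseteq> G)" by
        blast
    have "c * a = (\<Sum>G\<in>UNIV. (c * f G) * sqfree_monom G)"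
      unfolding f(1) sum_distrib_left by (simp only: mult.assoc)
    moreover have "\<exists>A\<in>B. A \<subseteq> G" if "c * f G \<noteq> 0" for G
      using f(2) that by (metis mult_zero_right)
    ultimately show "c * a \<in> ?I" by (rule I)
  qed
  moreover have "sqfree_monom ` B \<subseteq> ?I"
  proof
    fix g :: "('v, 'k) mpoly" assume "g \<in> sqfree_monom ` B"
    then obtain A where A: "A \<in> B" "g = sqfree_monom A" by blast
    have "(\<Sum>G\<in>UNIV. (if G = A then 1 else 0) * sqfree_monom G) = (\<Sum>G\<in>UNIV. if G = A then
        sqfree_monom A else 0 :: ('v, 'k) mpoly)"
      by (intro sum.cong) auto
    then show "g \<in> ?I" using A by (intro CollectI exI[of _ "\<lambda>G. if G = A then 1 else 0"]) auto
  qed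
  ultimately show "ideal_of (sqfree_monom ` B) \<subseteq> ?I" unfolding ideal_of_def by (rule
      span_minimal[rotated])
qed

text \<open>All exactness is contained in \<open>poly_bdry_exact\<close>; the remaining work is to
  transport it between functions on pairs and numbered vectors.\<close>

theorem sqfree_res_resolution:
  fixes B :: "'v::finite set set"
  assumes J: "J = {G. \<exists>A\<in>B. A \<subseteq> G}"
  shows "graded_free_resolution (sqfree_res J) (ideal_of (sqfree_monom ` B) :: ('v, 'k::field)
      mpoly set)"
proof -
  let ?R = "sqfree_res J :: ('v, 'k) graded_free_data"
  have up: "up_closed J" unfolding J up_closed_def by blast
  have free: "free_mod ?R i = {v. \<forall>k\<ge>card (pairs J i). v k = 0}" for i
    by (simp add: free_mod_def sqfree_res_def)
  have bd_free: "bd_map ?R i v \<in> free_mod ?R i" for i v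
    unfolding free by (simp add: bd_map_def sqfree_res_def)
  have bd_0: "bd_map ?R i v = (\<lambda>_. 0) \<longleftrightarrow> poly_bdry (of_vec J (Suc i) v) = (\<lambda>_ _. 0)" for i v
  proof
    assume "poly_bdry (of_vec J (Suc i) v) = (\<lambda>_ _. 0)"
    then have "of_vec J i (bd_map ?R i v) = of_vec J i (\<lambda>_. 0)"
      unfolding bd_map_sqfree_res[OF up] by (auto simp: of_vec_def fun_eq_iff)
    then show "bd_map ?R i v = (\<lambda>_. 0)"
      using bd_free[of i v] unfolding free by (intro of_vec_inject) auto
  next
    assume "bd_map ?R i v = (\<lambda>_. 0)"
    then have "of_vec J i (\<lambda>_. 0) = poly_bdry (of_vec J (Suc i) v)"
      using bd_map_sqfree_res[OF up, of i v] by simp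
    then show "poly_bdry (of_vec J (Suc i) v) = (\<lambda>_ _. 0)" by (auto simp: of_vec_def fun_eq_iff)
  qed
  have bd_image: "v \<in> bd_map ?R i ` free_mod ?R (Suc i) \<longleftrightarrow>
      v \<in> free_mod ?R i \<and> (\<exists>g. pchain J UNIV (Suc i) g \<and> poly_bdry g = of_vec J i v)" for i v
  proof
    assume "v \<in> bd_map ?R i ` free_mod ?R (Suc i)"
    then obtain w where "v = bd_map ?R i w" by blast
    then show "v \<in> free_mod ?R i \<and> (\<exists>g. pchain J UNIV (Suc i) g \<and> poly_bdry g = of_vec J i v)"
      using bd_free bd_map_sqfree_res[OF up] pchain_of_vec by metis
  next
    assume v: "v \<in> free_mod ?R i \<and> (\<exists>g. pchain J UNIV (Suc i) g \<and> poly_bdry g = of_vec J i v)"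
    then obtain g where g: "pchain J UNIV (Suc i) g" "poly_bdry g = of_vec J i v" by blast
    let ?w = "to_vec J (Suc i) g"
    have "of_vec J i (bd_map ?R i ?w) = of_vec J i v"
      unfolding bd_map_sqfree_res[OF up] of_to_vec[OF g(1)] g(2) ..
    then have "bd_map ?R i ?w = v"
      using v bd_free[of i ?w] unfolding free by (intro of_vec_inject) auto
    moreover have "?w \<in> free_mod ?R (Suc i)" unfolding free by (simp add: to_vec_def)
    ultimately show "v \<in> bd_map ?R i ` free_mod ?R (Suc i)" by blast
  qed
  show ?thesis
    unfolding graded_free_resolution_def
  proof (intro conjI allI impI)
    fix k assume k: "k < rank ?R 0"
    then have "fst (pair_at J 0 k) = {}" using pair_at_pairs[of k J 0] by (auto simp:
        sqfree_res_def pairs_def)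
    then show "homogeneous (shift ?R 0 k) (aug ?R k)"
      using homogeneous_sqfree_monom[of "snd (pair_at J 0 k)"] by (simp add: sqfree_res_def)
  next
    fix i k l assume "k < rank ?R (Suc i)" "l < rank ?R i"
    then have "pair_at J (Suc i) k \<in> pairs J (Suc i)" "pair_at J i l \<in> pairs J i"
      by (auto simp: sqfree_res_def pair_at_pairs)
    then show "homogeneous (shift ?R (Suc i) k - shift ?R i l) (bd ?R i k l)"
      using homogeneous_entry[of "fst (pair_at J (Suc i) k)" "snd (pair_at J (Suc i) k)" "fst
          (pair_at J i l)" "snd (pair_at J i l)"]
      by (auto simp: sqfree_res_def pairs_def)
  next
    show "aug_map ?R ` free_mod ?R 0 = ideal_of (sqfree_monom ` B)"
    proof
      show "aug_map ?R ` free_mod ?R 0 \<subseteq> ideal_of (sqfree_monom ` B)"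
        unfolding aug_map_sqfree_res[abs_def] ideal_of_sqfree_monom
        by (auto simp: of_vec_def pairs_def J split: if_splits)
      show "ideal_of (sqfree_monom ` B) \<subseteq> aug_map ?R ` free_mod ?R 0"
      proof
        fix g :: "('v, 'k) mpoly" assume "g \<in> ideal_of (sqfree_monom ` B)"
        then obtain f where f: "g = (\<Sum>G\<in>UNIV. f G * sqfree_monom G)" "\<forall>G. f G \<noteq> 0 \<longrightarrow> (\<exists>A\<in>B. A \<subseteq> G)"
          unfolding ideal_of_sqfree_monom by blast
        define f' where "f' F G = (if F = {} then f G else 0)" for F :: "'v set" and G
        have "pchain J UNIV 0 f'" using f(2) by (auto simp: pchain_def f'_def J)
        from of_to_vec[OF this] have "aug_map ?R (to_vec J 0 f') = g"
          by (simp add: aug_map_sqfree_res f(1) f'_def)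
        moreover have "to_vec J 0 f' \<in> free_mod ?R 0" unfolding free by (simp add: to_vec_def)
        ultimately show "g \<in> aug_map ?R ` free_mod ?R 0" by blast
      qed
    qed
  next
    show "{f \<in> free_mod ?R 0. aug_map ?R f = 0} = bd_map ?R 0 ` free_mod ?R 1"
    proof (intro set_eqI iffI)
      fix v assume v: "v \<in> {f \<in> free_mod ?R 0. aug_map ?R f = 0}"
      \<comment> \<open>In position \<open>0\<close> only the empty first component occurs, so the
        differential vanishes and the cycle condition is the one on the augmentation.\<close>
      have "poly_bdry (of_vec J 0 v) = (\<lambda>_ _. 0)"
      proof (intro ext)
        fix F G
        have "of_vec J 0 v (insert x F) H = 0" for x H
          using pchainD[OF pchain_of_vec, of J 0 v "insert x F" H] by auto
        then show "poly_bdry (of_vec J 0 v) F G = 0" unfolding poly_bdry_def by (auto intro!: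
            sum.neutral)
      qed
      then have "\<exists>g. pchain J UNIV (Suc 0) g \<and> poly_bdry g = of_vec J 0 v"
        using v by (intro poly_bdry_exact[OF up pchain_of_vec]) (auto simp: aug_map_sqfree_res)
      then show "v \<in> bd_map ?R 0 ` free_mod ?R 1" using bd_image[of v 0] v by simp
    next
      fix v assume "v \<in> bd_map ?R 0 ` free_mod ?R 1"
      then obtain g where g: "v \<in> free_mod ?R 0" "poly_bdry g = of_vec J 0 v" using bd_image[of v
          0] by auto
      have "aug_map ?R v = 0" unfolding aug_map_sqfree_res g(2)[symmetric] by (rule
          sum_poly_bdry_sqfree_monom)
      then show "v \<in> {f \<in> free_mod ?R 0. aug_map ?R f = 0}" using g(1) by simp
    qed
  next
    fix i
    show "{f \<in> free_mod ?R (Suc i). bd_map ?R i f = (\<lambda>_. 0)} = bd_map ?R (Suc i) ` free_mod ?R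
        (Suc (Suc i))"
    proof (intro set_eqI iffI)
      fix v assume v: "v \<in> {f \<in> free_mod ?R (Suc i). bd_map ?R i f = (\<lambda>_. 0)}"
      then have "\<exists>g. pchain J UNIV (Suc (Suc i)) g \<and> poly_bdry g = of_vec J (Suc i) v"
        by (intro poly_bdry_exact[OF up pchain_of_vec]) (auto simp: bd_0)
      then show "v \<in> bd_map ?R (Suc i) ` free_mod ?R (Suc (Suc i))" using bd_image[of v "Suc i"] v
          by simp
    next
      fix v assume "v \<in> bd_map ?R (Suc i) ` free_mod ?R (Suc (Suc i))"
      then obtain g where g: "v \<in> free_mod ?R (Suc i)" "poly_bdry g = of_vec J (Suc i) v"
        using bd_image[of v "Suc i"] by auto
      then have "bd_map ?R i v = (\<lambda>_. 0)" unfolding bd_0 g(2)[symmetric] by (simp add: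
          poly_bdry_poly_bdry)
      then show "v \<in> {f \<in> free_mod ?R (Suc i). bd_map ?R i f = (\<lambda>_. 0)}" using g(1) by simp
    qed
  qed
qed

section \<open>Tor of squarefree monomial ideals\<close>

text \<open>
  \<open>sqfree_res J\<close> tensored with \<open>K\<close> splits into the strands \<open>F \<union> G = W\<close>; each strand is, up to
  sign, the complex of \<open>chain J W\<close>.
\<close>

definition strand :: "'v set \<Rightarrow> ('v set \<Rightarrow> 'v set \<Rightarrow> 'a::zero) \<Rightarrow> 'v set \<Rightarrow> 'a"
  where "strand W z F = (if F \<subseteq> W then z F (W - F) else 0)"

lemma strand_eqI:
  assumes "pchain J UNIV i z" "pchain J' UNIV i' z'" "\<And>W. strand W z = strand W z'"
  shows "z = z'"
proof (intro ext)
  fix F G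
  show "z F G = z' F G"
  proof (cases "F \<inter> G = {}")
    case True
    then have "F \<union> G - F = G" by blast
    then show ?thesis using fun_cong[OF assms(3)[of "F \<union> G"], of F] by (simp add: strand_def)
  next
    case False
    then show ?thesis using pchainD[OF assms(1), of F G] pchainD[OF assms(2), of F G] by metis
  qed
qed

lemma chain_strand: "pchain J UNIV i z \<Longrightarrow> chain J W i (strand W z)"
  unfolding chain_def strand_def using pchainD by (metis (no_types, lifting))

text \<open>Modulo the variables only the moves of \<open>x\<close> from the first to the second
  component survive. They keep the union, which is why the complex splits into strands.\<close>

lemma lookup_entry_0:
  "Poly_Mapping.lookup (entry p (F, G) :: ('v::finite, 'k::field) mpoly) 0 =
    (\<Sum>x\<in>G - F. - (pos_sign F x * (if (insert x F, G - {x}) = p then 1 else 0)))"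
proof -
  have xm0: "Poly_Mapping.lookup (h * sqfree_monom {x} :: ('v, 'k) mpoly) 0 = 0" for h x
    unfolding sqfree_monom_def lookup_mult_single sqfree_exp_le_iff by simp
  have "Poly_Mapping.lookup (entry p (F, G) :: ('v, 'k) mpoly) 0 =
      (\<Sum>x\<in>-F. if x \<in> G then - (pos_sign F x * (if (insert x F, G - {x}) = p then 1 else 0)) else 0)"
    unfolding entry_def poly_bdry_def fst_conv snd_conv lookup_sum lookup_pos_sign_mult
    by (intro sum.cong) (simp_all add: xm0)
  also have "\<dots> = (\<Sum>x\<in>-F \<inter> G. - (pos_sign F x * (if (insert x F, G - {x}) = p then 1 else 0)))"
    by (simp add: sum.inter_restrict)
  also have "- F \<inter> G = G - F" by blast
  finally show ?thesis .
qed

lemma of_vec_bd_K: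
  fixes c :: "nat \<Rightarrow> 'k::field"
  assumes "(F, G) \<in> pairs J i"
  shows "of_vec J i (bd_K (sqfree_res J) i c) F G =
    - (\<Sum>x\<in>G. pos_sign F x * of_vec J (Suc i) c (insert x F) (G - {x}))"
proof -
  have GF: "G - F = G" using assms by (auto simp: pairs_def)
  have delta: "(\<Sum>p\<in>pairs J (Suc i). of_vec J (Suc i) c (fst p) (snd p) * (if q = p then 1 else 0)) =
      of_vec J (Suc i) c (fst q) (snd q)" for q
  proof -
    have "(\<Sum>p\<in>pairs J (Suc i). of_vec J (Suc i) c (fst p) (snd p) * (if q = p then 1 else 0)) =
        (\<Sum>p\<in>pairs J (Suc i). if p = q then of_vec J (Suc i) c (fst q) (snd q) else 0)"
      by (intro sum.cong) auto
    then show ?thesis by (simp add: of_vec_def)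
  qed
  have "of_vec J i (bd_K (sqfree_res J) i c) F G =
      (\<Sum>p\<in>pairs J (Suc i). of_vec J (Suc i) c (fst p) (snd p) * Poly_Mapping.lookup (entry p (F,
          G)) 0)"
    using assms sum_rank_vec[where h = "\<lambda>p. Poly_Mapping.lookup (entry p (F, G)) 0"]
    by (simp add: of_vec_def[of J i] bd_K_def sqfree_res_def index_at_less pair_at_index_at)
  also have "\<dots> = (\<Sum>x\<in>G. \<Sum>p\<in>pairs J (Suc i). of_vec J (Suc i) c (fst p) (snd p) *
      - (pos_sign F x * (if (insert x F, G - {x}) = p then 1 else 0)))"
    unfolding lookup_entry_0 GF sum_distrib_left by (rule sum.swap)
  also have "\<dots> = (\<Sum>x\<in>G. - (pos_sign F x * of_vec J (Suc i) c (insert x F) (G - {x})))"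
  proof (intro sum.cong refl)
    fix x
    have "(\<Sum>p\<in>pairs J (Suc i). of_vec J (Suc i) c (fst p) (snd p) *
        - (pos_sign F x * (if (insert x F, G - {x}) = p then 1 else 0))) =
      - (pos_sign F x * (\<Sum>p\<in>pairs J (Suc i). of_vec J (Suc i) c (fst p) (snd p) *
        (if (insert x F, G - {x}) = p then 1 else 0)))"
      unfolding sum_distrib_left sum_negf[symmetric] by (intro sum.cong) (simp_all add: mult_ac)
    then show "(\<Sum>p\<in>pairs J (Suc i). of_vec J (Suc i) c (fst p) (snd p) *
        - (pos_sign F x * (if (insert x F, G - {x}) = p then 1 else 0))) =
      - (pos_sign F x * of_vec J (Suc i) c (insert x F) (G - {x}))"
      unfolding delta by simp
  qed
  finally show ?thesis by (simp add: sum_negf)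
qed

text \<open>The overall minus sign is the one carried by the moves into the second component; it
  affects neither cycles nor boundaries.\<close>

lemma strand_bd_K:
  fixes c :: "nat \<Rightarrow> 'k::field"
  assumes up: "up_closed J"
  shows "strand W (of_vec J i (bd_K (sqfree_res J) i c)) F = - bdry (strand W (of_vec J (Suc i)
      c)) F"
proof (cases "F \<subseteq> W")
  case False
  have "bdry (strand W (of_vec J (Suc i) c)) F = 0"
    unfolding bdry_def using False by (intro sum.neutral) (auto simp: strand_def)
  then show ?thesis using False by (simp add: strand_def)
next
  case True
  have "bdry (strand W (of_vec J (Suc i) c)) F =
      (\<Sum>x\<in>W - F. pos_sign F x * of_vec J (Suc i) c (insert x F) (W - F - {x}))"
  proof -
    have "bdry (strand W (of_vec J (Suc i) c)) F = (\<Sum>x\<in>W - F. pos_sign F x * strand W (of_vec J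
        (Suc i) c) (insert x F))"
      unfolding bdry_def by (rule sum.mono_neutral_right) (auto simp: strand_def)
    also have "\<dots> = (\<Sum>x\<in>W - F. pos_sign F x * of_vec J (Suc i) c (insert x F) (W - F - {x}))"
    proof (intro sum.cong refl)
      fix x assume "x \<in> W - F"
      moreover have "W - insert x F = W - F - {x}" by blast
      ultimately show "pos_sign F x * strand W (of_vec J (Suc i) c) (insert x F) =
          pos_sign F x * of_vec J (Suc i) c (insert x F) (W - F - {x})"
        using True by (simp add: strand_def)
    qed
    finally show ?thesis .
  qed
  moreover have "of_vec J i (bd_K (sqfree_res J) i c) F (W - F) =
      - (\<Sum>x\<in>W - F. pos_sign F x * of_vec J (Suc i) c (insert x F) (W - F - {x}))"
  proof (cases "(F, W - F) \<in> pairs J i")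
    case False
    \<comment> \<open>A nonzero term would have its second component in \<open>J\<close>, and then
      up-closedness would make \<open>(F, W - F)\<close> a basis pair.\<close>
    have "of_vec J (Suc i) c (insert x F) (W - F - {x}) = 0" if x: "x \<in> W - F" for x
    proof (rule ccontr)
      assume "of_vec J (Suc i) c (insert x F) (W - F - {x}) \<noteq> 0"
      then have "card (insert x F) = Suc i" "W - F - {x} \<in> J"
        using pchainD[OF pchain_of_vec] by blast+
      then have "card F = i" "W - F \<in> J" using x up unfolding up_closed_def by auto
      then show False using False by (auto simp: pairs_def)
    qed
    then show ?thesis using False by (simp add: of_vec_def[of J i])
  qed (rule of_vec_bd_K)
  ultimately show ?thesis using True by (simp add: strand_def)
qed

text \<open>The inverse of decomposing into strands: a disjoint pair determines its strand by the
  union.\<close>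

definition glue :: "('v set \<Rightarrow> 'v set \<Rightarrow> 'a::zero) \<Rightarrow> 'v set \<Rightarrow> 'v set \<Rightarrow> 'a"
  where "glue y F G = (if F \<inter> G = {} then y (F \<union> G) F else 0)"

lemma pchain_glue:
  assumes "\<And>W. chain J W i (y W)"
  shows "pchain J UNIV i (glue y)"
  unfolding pchain_def
proof (intro allI impI)
  fix F G assume "glue y F G \<noteq> 0"
  then have FG: "F \<inter> G = {}" "y (F \<union> G) F \<noteq> 0" by (auto simp: glue_def split: if_splits)
  moreover have "F \<union> G - F = G" using FG(1) by blast
  ultimately show "F \<inter> G = {} \<and> F \<union> G \<subseteq> UNIV \<and> card F = i \<and> G \<in> J"
    using assms[of "F \<union> G"] unfolding chain_def by auto
qed

lemma strand_glue:
  assumes "\<And>W. chain J W i (y W)"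
  shows "strand W (glue y) = y W"
proof
  fix F
  show "strand W (glue y) F = y W F"
  proof (cases "F \<subseteq> W")
    case True
    then have "F \<union> (W - F) = W" "F \<inter> (W - F) = {}" by blast+
    then show ?thesis using True by (simp add: strand_def glue_def)
  next
    case False
    then show ?thesis using assms[of W] by (auto simp: strand_def chain_def)
  qed
qed

lemma tensor_K_sqfree_res:
  fixes c :: "nat \<Rightarrow> 'k::field"
  shows "c \<in> tensor_K (sqfree_res J :: ('v::finite, 'k) graded_free_data) i j \<longleftrightarrow>
    (\<forall>k\<ge>card (pairs J i). c k = 0) \<and> (\<forall>W. strand W (of_vec J i c) \<noteq> (\<lambda>_. 0) \<longrightarrow> int (card W) = j)"
    (is "?L \<longleftrightarrow> ?R")
proof
  assume L: ?L
  then have "c k = 0" if "k \<ge> card (pairs J i)" for k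
    using that unfolding tensor_K_def sqfree_res_def by fastforce
  moreover have "int (card W) = j" if nz: "strand W (of_vec J i c) \<noteq> (\<lambda>_. 0)" for W
  proof -
    obtain F where F: "strand W (of_vec J i c) F \<noteq> 0" using nz by auto
    then have FW: "F \<subseteq> W" "(F, W - F) \<in> pairs J i" "c (index_at J i (F, W - F)) \<noteq> 0"
      by (auto simp: strand_def of_vec_def split: if_splits)
    then have "int (card F + card (W - F)) = j"
      using L unfolding tensor_K_def by (auto simp: sqfree_res_def pair_at_index_at)
    then show ?thesis using FW(1) by (simp add: card_Diff_subset card_mono)
  qed
  ultimately show ?R by blast
next
  assume R: ?R
  show ?L
    unfolding tensor_K_def
  proof (intro CollectI allI impI)
    fix k assume nz: "c k \<noteq> 0"
    then have k: "k < card (pairs J i)" using R not_le by blast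
    obtain F G where FG: "pair_at J i k = (F, G)" by fastforce
    then have P: "(F, G) \<in> pairs J i" using pair_at_pairs[OF k] by simp
    then have disj: "F \<inter> G = {}" by (simp add: pairs_def)
    then have "F \<union> G - F = G" by blast
    moreover have "index_at J i (F, G) = k" using index_at_pair_at[OF k] FG by simp
    ultimately have "strand (F \<union> G) (of_vec J i c) F \<noteq> 0"
      using P nz by (simp add: strand_def of_vec_def)
    then have "int (card (F \<union> G)) = j" using R by (metis (no_types))
    then show "k < rank (sqfree_res J :: ('v, 'k) graded_free_data) i \<and> shift (sqfree_res J ::
        ('v, 'k) graded_free_data) i k = j"
      using k FG disj by (simp add: sqfree_res_def card_Un_disjoint)
  qed
qed

lemma strand_bd_K_eq_0_iff:
  fixes c :: "nat \<Rightarrow> 'k::field"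
  assumes up: "up_closed J"
  shows "bd_K (sqfree_res J :: ('v::finite, 'k) graded_free_data) i c = (\<lambda>_. 0) \<longleftrightarrow>
    (\<forall>W F. bdry (strand W (of_vec J (Suc i) c)) F = 0)"
proof
  assume "bd_K (sqfree_res J :: ('v, 'k) graded_free_data) i c = (\<lambda>_. 0)"
  then have "strand W (of_vec J i (bd_K (sqfree_res J) i c)) F = 0" for W F
    by (simp add: strand_def of_vec_def)
  then show "\<forall>W F. bdry (strand W (of_vec J (Suc i) c)) F = 0" unfolding strand_bd_K[OF up] by simp
next
  assume "\<forall>W F. bdry (strand W (of_vec J (Suc i) c)) F = 0"
  then have "strand W (of_vec J i (bd_K (sqfree_res J) i c)) F = 0" for W F
    unfolding strand_bd_K[OF up] by simp
  then have "strand W (of_vec J i (bd_K (sqfree_res J) i c)) = strand W (of_vec J i (\<lambda>_. 0))" for W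
    by (auto simp: strand_def of_vec_def fun_eq_iff)
  then have "of_vec J i (bd_K (sqfree_res J) i c) = of_vec J i (\<lambda>_. 0)"
    by (rule strand_eqI[OF pchain_of_vec pchain_of_vec])
  then show "bd_K (sqfree_res J :: ('v, 'k) graded_free_data) i c = (\<lambda>_. 0)"
    by (rule of_vec_inject) (auto simp: bd_K_def sqfree_res_def)
qed

text \<open>A cycle on the single strand \<open>W\<close>, extended by zero to the other strands, is
  a homogeneous cycle of degree \<open>card W\<close>; the strand at \<open>W\<close> of a filling
  fills it up to sign.\<close>

lemma exact_at_if_cycles_subset:
  fixes K :: "'k::field itself" and J :: "'v::finite set set"
  assumes up: "up_closed J"
    and sub: "cycles_K (sqfree_res J :: ('v, 'k) graded_free_data) (Suc i) (int (card W)) \<subseteq>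
      boundaries_K (sqfree_res J) (Suc i) (int (card W))"
  shows "exact_at K J W (Suc i)"
  unfolding exact_at_def
proof (intro allI impI)
  let ?R = "sqfree_res J :: ('v, 'k) graded_free_data"
  fix z :: "'v set \<Rightarrow> 'k" assume z: "chain J W (Suc i) z \<and> (\<forall>F. bdry z F = 0)"
  define y where "y W' = (if W' = W then z else (\<lambda>_. 0))" for W'
  have y: "chain J W' (Suc i) (y W')" for W' using z by (auto simp: y_def chain_def)
  define c where "c = to_vec J (Suc i) (glue y)"
  have c: "of_vec J (Suc i) c = glue y" unfolding c_def by (rule of_to_vec[OF pchain_glue[OF y]])
  have strand: "strand W' (of_vec J (Suc i) c) = y W'" for W' unfolding c by (rule strand_glue[OF
      y])
  have "c \<in> tensor_K ?R (Suc i) (int (card W))"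
    unfolding tensor_K_sqfree_res strand by (auto simp: c_def to_vec_def y_def)
  moreover have "bd_K ?R i c = (\<lambda>_. 0)"
    unfolding strand_bd_K_eq_0_iff[OF up] strand using z by (simp add: y_def)
  ultimately obtain c' where c': "c = bd_K ?R (Suc i) c'"
    using sub by (auto simp: boundaries_K_def)
  have "z F = - bdry (strand W (of_vec J (Suc (Suc i)) c')) F" for F
    using strand_bd_K[OF up, of W "Suc i" c' F] strand[of W] unfolding c' by (simp add: y_def)
  then have "bdry (\<lambda>F. 0 - strand W (of_vec J (Suc (Suc i)) c') F) = z"
    by (intro ext) (simp only: bdry_diff bdry_zero, simp)
  moreover have "chain J W (Suc (Suc i)) (\<lambda>F. 0 - strand W (of_vec J (Suc (Suc i)) c') F)"
    using chain_strand[OF pchain_of_vec, of J W "Suc (Suc i)" c'] by (simp add: chain_def)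
  ultimately show "\<exists>y. chain J W (Suc (Suc i)) y \<and> bdry y = z" by blast
qed

text \<open>Strands are filled one by one and glued. The filling is chosen zero on strands of any
  other size, so that the result is again homogeneous of degree \<open>j\<close>.\<close>

lemma cycles_eq_boundaries_if_exact:
  fixes K :: "'k::field itself" and J :: "'v::finite set set"
  assumes up: "up_closed J"
    and exact: "\<And>W. int (card W) = j \<Longrightarrow> exact_at K J W (Suc i)"
  shows "cycles_K (sqfree_res J :: ('v, 'k) graded_free_data) (Suc i) j = boundaries_K (sqfree_res
      J) (Suc i) j"
proof (intro set_eqI iffI)
  let ?R = "sqfree_res J :: ('v, 'k) graded_free_data"
  fix c assume "c \<in> cycles_K ?R (Suc i) j"
  then have c: "c \<in> tensor_K ?R (Suc i) j" "bd_K ?R i c = (\<lambda>_. 0)" by auto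
  have "\<exists>y. chain J W (Suc (Suc i)) y \<and> bdry y = strand W (of_vec J (Suc i) c) \<and>
      (int (card W) \<noteq> j \<longrightarrow> y = (\<lambda>_. 0))" for W
  proof (cases "int (card W) = j")
    case True
    then show ?thesis
      using exact[OF True] chain_strand[OF pchain_of_vec, of J W "Suc i" c] c(2)
      unfolding strand_bd_K_eq_0_iff[OF up] exact_at_def by blast
  next
    case False
    then have "strand W (of_vec J (Suc i) c) = (\<lambda>_. 0)" using c(1) unfolding tensor_K_sqfree_res
        by blast
    then show ?thesis by (intro exI[of _ "\<lambda>_. 0"]) (auto simp: chain_def)
  qed
  then obtain y where y: "\<And>W. chain J W (Suc (Suc i)) (y W)" "\<And>W. bdry (y W) = strand W (of_vec J
      (Suc i) c)"
    "\<And>W. int (card W) \<noteq> j \<Longrightarrow> y W = (\<lambda>_. 0)" by metis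
  define y' where "y' W F = 0 - y W F" for W F
  have y': "chain J W (Suc (Suc i)) (y' W)" for W using y(1)[of W] by (simp add: chain_def y'_def)
  define c' where "c' = to_vec J (Suc (Suc i)) (glue y')"
  have strand: "strand W (of_vec J (Suc (Suc i)) c') = y' W" for W
    unfolding c'_def of_to_vec[OF pchain_glue[OF y']] by (rule strand_glue[OF y'])
  have "c' \<in> tensor_K ?R (Suc (Suc i)) j"
    unfolding tensor_K_sqfree_res strand using y(3) by (auto simp: c'_def to_vec_def y'_def)
  moreover have "bd_K ?R (Suc i) c' = c"
  proof (rule of_vec_inject)
    show "of_vec J (Suc i) (bd_K ?R (Suc i) c') = of_vec J (Suc i) c"
    proof (rule strand_eqI[OF pchain_of_vec pchain_of_vec])
      fix W
      have "bdry (y' W) F = - strand W (of_vec J (Suc i) c) F" for F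
        unfolding y'_def[abs_def] bdry_diff using y(2) by simp
      then show "strand W (of_vec J (Suc i) (bd_K ?R (Suc i) c')) = strand W (of_vec J (Suc i) c)"
        by (intro ext) (simp add: strand_bd_K[OF up] strand)
    qed
    show "bd_K ?R (Suc i) c' k = 0" if "k \<ge> card (pairs J (Suc i))" for k
      using that by (simp add: bd_K_def sqfree_res_def)
    show "c k = 0" if "k \<ge> card (pairs J (Suc i))" for k
      using that c(1) unfolding tensor_K_sqfree_res by blast
  qed
  ultimately show "c \<in> boundaries_K ?R (Suc i) j" unfolding boundaries_K_def by blast
next
  let ?R = "sqfree_res J :: ('v, 'k) graded_free_data"
  fix c assume "c \<in> boundaries_K ?R (Suc i) j"
  then obtain c' where c': "c' \<in> tensor_K ?R (Suc (Suc i)) j" "c = bd_K ?R (Suc i) c'"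
    by (auto simp: boundaries_K_def)
  have strand: "strand W (of_vec J (Suc i) c) = (\<lambda>F. 0 - bdry (strand W (of_vec J (Suc (Suc i))
      c')) F)" for W
    unfolding c'(2) by (intro ext) (simp add: strand_bd_K[OF up])
  have "int (card W) = j" if "strand W (of_vec J (Suc i) c) \<noteq> (\<lambda>_. 0)" for W
  proof (rule ccontr)
    assume "int (card W) \<noteq> j"
    then have "strand W (of_vec J (Suc (Suc i)) c') = (\<lambda>_. 0)" using c'(1) unfolding
        tensor_K_sqfree_res by blast
    then show False using that unfolding strand by simp
  qed
  then have "c \<in> tensor_K ?R (Suc i) j"
    unfolding tensor_K_sqfree_res by (auto simp: c'(2) bd_K_def sqfree_res_def)
  moreover have "bd_K ?R i c = (\<lambda>_. 0)"
    unfolding strand_bd_K_eq_0_iff[OF up] strand bdry_diff by simp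
  ultimately show "c \<in> cycles_K ?R (Suc i) j" by simp
qed

text \<open>From left to right the comparison of resolutions is needed; from right to left the
  squarefree resolution itself is the witness.\<close>

lemma tor_zero_sqfree_iff:
  fixes K :: "'k::field itself" and B :: "'v::finite set set"
  shows "tor_zero (ideal_of (sqfree_monom ` B) :: ('v, 'k) mpoly set) (Suc i) j \<longleftrightarrow>
    (\<forall>W. int (card W) = j \<longrightarrow> exact_at K (upset B) W (Suc i))"
proof
  have res: "graded_free_resolution (sqfree_res (upset B)) (ideal_of (sqfree_monom ` B) :: ('v,
      'k) mpoly set)"
    by (rule sqfree_res_resolution) (simp add: upset_def)
  show "\<forall>W. int (card W) = j \<longrightarrow> exact_at K (upset B) W (Suc i)"
    if "tor_zero (ideal_of (sqfree_monom ` B) :: ('v, 'k) mpoly set) (Suc i) j"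
    using tor_zero_imp_cycles_subset_boundaries[OF res that] exact_at_if_cycles_subset[OF
        up_closed_upset]
    by blast
  show "tor_zero (ideal_of (sqfree_monom ` B) :: ('v, 'k) mpoly set) (Suc i) j"
    if "\<forall>W. int (card W) = j \<longrightarrow> exact_at K (upset B) W (Suc i)"
    unfolding tor_zero_def using res cycles_eq_boundaries_if_exact[OF up_closed_upset, where K =
        K] that by blast
qed

section \<open>Edge ideals and 4-path ideals as squarefree monomial ideals\<close>

lemma var_eq_sqfree_monom: "var x = sqfree_monom {x}"
  by (simp add: var_def sqfree_monom_def sqfree_exp_def)

lemma edge_ideal_eq:
  fixes E :: "'v::finite set set"
  assumes "simple_graph E"
  shows "(edge_ideal E :: ('v, 'k::field) mpoly set) = ideal_of (sqfree_monom ` E)"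
proof -
  have var: "var x * var y = (sqfree_monom {x, y} :: ('v, 'k) mpoly)" if "{x, y} \<in> E" for x y
  proof -
    have "x \<noteq> y" using assms that by (auto simp: simple_graph_def)
    then show ?thesis by (simp add: var_eq_sqfree_monom sqfree_monom_mult insert_commute)
  qed
  have edge: "\<exists>x y. e = {x, y}" if "e \<in> E" for e
    using assms that unfolding simple_graph_def by (metis card_2_iff)
  have "{var x * var y | x y. {x, y} \<in> E} = (sqfree_monom ` E :: ('v, 'k) mpoly set)"
  proof (intro set_eqI iffI)
    fix g :: "('v, 'k) mpoly" assume "g \<in> sqfree_monom ` E"
    then obtain e where e: "e \<in> E" "g = sqfree_monom e" by blast
    moreover obtain x y where "e = {x, y}" using edge[OF e(1)] by blast
    ultimately have "g = var x * var y \<and> {x, y} \<in> E" using var[of x y] by simp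
    then show "g \<in> {var x * var y | x y. {x, y} \<in> E}" by blast
  qed (auto simp: var)
  then show ?thesis by (simp add: edge_ideal_def)
qed

definition path_sets :: "'v set set \<Rightarrow> 'v set set"
  where "path_sets E = {{a, b, c, d} | a b c d.
    distinct [a, b, c, d] \<and> {a, b} \<in> E \<and> {b, c} \<in> E \<and> {c, d} \<in> E}"

lemma path4_ideal_eq:
  fixes E :: "'v::finite set set"
  shows "(path4_ideal E :: ('v, 'k::field) mpoly set) = ideal_of (sqfree_monom ` path_sets E)"
proof -
  have "var a * var b * var c * var d = (sqfree_monom {a, b, c, d} :: ('v, 'k) mpoly)" if
      "distinct [a, b, c, d]" for a b c d
    using that by (simp add: var_eq_sqfree_monom sqfree_monom_mult insert_commute)
  then have "{var a * var b * var c * var d :: ('v, 'k) mpoly | a b c d.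
      distinct [a, b, c, d] \<and> {a, b} \<in> E \<and> {b, c} \<in> E \<and> {c, d} \<in> E} =
    {sqfree_monom {a, b, c, d} | a b c d. distinct [a, b, c, d] \<and> {a, b} \<in> E \<and> {b, c} \<in> E \<and> {c, d}
        \<in> E}"
    by (intro Collect_cong) metis
  also have "\<dots> = sqfree_monom ` path_sets E"
    unfolding path_sets_def image_def by blast
  finally have "{var a * var b * var c * var d :: ('v, 'k) mpoly | a b c d.
    distinct [a, b, c, d] \<and> {a, b} \<in> E \<and> {b, c} \<in> E \<and> {c, d} \<in> E} = sqfree_monom ` path_sets E" .
  then show ?thesis by (simp add: path4_ideal_def)
qed

lemma upset_path_sets:
  assumes "simple_graph E" "gap_free E"
  shows "upset (path_sets E) = two_matchings E"
proof (intro set_eqI)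
  fix A
  have "A \<in> upset (path_sets E) \<longleftrightarrow> (\<exists>a b c d. distinct [a, b, c, d] \<and> {a, b} \<in> E \<and> {b, c} \<in> E \<and>
      {c, d} \<in> E \<and> {a, b, c, d} \<subseteq> A)" (is "?L \<longleftrightarrow> ?R")
  proof
    assume ?L
    then obtain e where "e \<in> path_sets E" "e \<subseteq> A" by (auto simp: upset_def)
    then obtain a b c d where "e = {a, b, c, d}" "distinct [a, b, c, d]" "{a, b} \<in> E" "{b, c} \<in> E"
        "{c, d} \<in> E"
      unfolding path_sets_def mem_Collect_eq by (elim exE conjE)
    then show ?R using \<open>e \<subseteq> A\<close> by metis
  next
    assume ?R
    then obtain a b c d where "distinct [a, b, c, d] \<and> {a, b} \<in> E \<and> {b, c} \<in> E \<and> {c, d} \<in> E"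
      and A: "{a, b, c, d} \<subseteq> A" by (elim exE conjE) (rule that, intro conjI)
    then have "{a, b, c, d} \<in> path_sets E" unfolding path_sets_def mem_Collect_eq by metis
    then show ?L using A unfolding upset_def by blast
  qed
  then show "A \<in> upset (path_sets E) \<longleftrightarrow> A \<in> two_matchings E"
    using path4_supersets[OF assms(2,1)] by simp
qed

text \<open>Induced cycles of the complement are the only information passed from one ideal to the
  other: linearity of the edge ideal excludes them up to length \<open>p + 3\<close>, and this
  exclusion suffices for the 4-path ideal.\<close>

lemma linear_up_to_path4_ideal:
  fixes E :: "'v::finite set set"
  assumes E: "simple_graph E" "gap_free E"
    and lin: "linear_up_to 2 p (edge_ideal E :: ('v, 'k::field) mpoly set)"
  shows "linear_up_to 4 p (path4_ideal E :: ('v, 'k) mpoly set)"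
proof -
  have cyc: "\<not> anticycle E l f" if "l \<le> p + 3" for l f
  proof
    assume f: "anticycle E l f"
    \<comment> \<open>\<open>Suc i\<close> is \<open>l - 3\<close>, which lies between
      \<open>1\<close> and \<open>p\<close>. The cycle has degree \<open>l\<close>, whereas the
      linear degree in that position is \<open>l - 1\<close>, so Tor vanishes there by
      hypothesis.\<close>
    define i where "i = l - 4"
    have l: "l = Suc i + 3" using f by (simp add: anticycle_def i_def)
    have "tor_zero (edge_ideal E :: ('v, 'k) mpoly set) (Suc i) (int l)"
      using lin that l unfolding linear_up_to_def by auto
    then have "exact_at TYPE('k) (upset E) (f ` {..<l}) (Suc i)"
      unfolding edge_ideal_eq[OF E(1)] tor_zero_sqfree_iff[where K = "TYPE('k)"]
      using anticycle_not_exact(1)[OF E(1) f l] by simp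
    then show False using anticycle_not_exact(2)[OF E(1) f l] by blast
  qed
  show ?thesis
    unfolding linear_up_to_def
  proof (intro allI impI)
    fix i j assume ij: "1 \<le> i \<and> i \<le> p \<and> j \<noteq> int (i + 4)"
    then obtain i' where i': "i = Suc i'" by (cases i) auto
    have "exact_at TYPE('k) (two_matchings E) W i" if W: "int (card W) = j" for W
    \<comment> \<open>The excluded degree \<open>i + 4\<close> separates two cases: above it the
      exactness theorem applies, and below it fewer than four vertices remain outside
      \<open>F\<close>, too few for two disjoint edges.\<close>
    proof (cases "card W \<ge> i + 5")
      case True
      then show ?thesis using ij cyc by (intro exact_at_two_matchings[OF E]) auto
    next
      case False
      then have small: "card W < i + 4" using W ij by auto
      show ?thesis
      proof (rule exact_at_trivial)
        fix F assume F: "F \<subseteq> W" "card F = i"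
        show "W - F \<notin> two_matchings E"
        proof
          assume "W - F \<in> two_matchings E"
          then obtain e e' where "e \<in> E" "e' \<in> E" "e \<inter> e' = {}" "e \<union> e' \<subseteq> W - F"
            unfolding two_matchings_def by blast
          moreover from this have "card (e \<union> e') = 4"
            using E(1) by (simp add: card_Un_disjoint simple_graph_def)
          ultimately have "4 \<le> card (W - F)" using card_mono[of "W - F" "e \<union> e'"] by simp
          then show False using F small by (simp add: card_Diff_subset)
        qed
      qed
    qed
    then show "tor_zero (path4_ideal E :: ('v, 'k) mpoly set) i j"
      unfolding path4_ideal_eq i' tor_zero_sqfree_iff[where K = "TYPE('k)"] upset_path_sets[OF E]
          by blast
  qed
qed

theorem theorem3p6:
  fixes E :: "'v::finite set set"
  assumes "simple_graph E"
    and "gap_free E"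
    and "(path4_ideal E :: ('v, 'k::field) mpoly set) \<noteq> {0}"
  shows "(\<forall>p\<ge>2. linear_up_to 2 p (edge_ideal E :: ('v, 'k) mpoly set) \<longrightarrow>
            linear_up_to 4 p (path4_ideal E :: ('v, 'k) mpoly set)) \<and>
         (linear_resolution 2 (edge_ideal E :: ('v, 'k) mpoly set) \<longrightarrow>
            linear_resolution 4 (path4_ideal E :: ('v, 'k) mpoly set))"
  using linear_up_to_path4_ideal[OF assms(1,2)] unfolding linear_resolution_def by blast

end
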